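(* (General Riesz Characterisation Theorem) Let $\Omega$ be a locally compact Hausdorff space and $E,F$ Banach spaces. For any continuous linear operator $T\colon C_0(\Omega,E)\to F$ there exists a unique regular weak* i-measure $\mu\colon\mathfrak{B}(\Omega)\to\mathcal{L}(E,F^{**})$ such that $Tf=\int^{w*}_\Omega f\,\mathrm{d}\mu$ for any $f\in C_0(\Omega,E)$ (with $F$ regarded as a subspace of $F^{**}$ via the canonical embedding). Moreover, $\|T\|=\|\mu\|_\Omega$.
   Context: Banach spaces are over a fixed field $\mathbb{K}$ of real or complex numbers; $\mathcal{L}(E,G)$ is the Banach space of continuous linear operators $E\to G$; $C_0(\Omega,E)$ is the space of continuous functions $\Omega\to E$ vanishing at infinity with the sup-norm; $\mathfrak{B}(\Omega)$ is the Borel $\sigma$-algebra. For $T_n\in\mathcal{L}(E,G)$, $\sum_n T_n$ is independently convergent if $\sum_n T_nx_n$ converges in the norm of $G$ for every bounded sequence $(x_n)$ in $E$. For a $\sigma$-algebra $\mathfrak{M}$ on a set $Z$, $\nu\colon\mathfrak{M}\to\mathcal{L}(E,G)$ is an i-measure if for any pairwise disjoint $A_n\in\mathfrak{M}$, $\nu(\bigcup_n A_n)x=\sum_n\nu(A_n)x$ for each $x\in E$ and $\sum_n\nu(A_n)$ is independently convergent. An i-measure $\nu$ on $\mathfrak{B}(\Omega)$ is regular if every $A\in\mathfrak{B}(\Omega)$ includes a $\sigma$-compact set $K$ (a countable union of compact sets) such that $\nu$ vanishes on every Borel set contained in $A\setminus K$. For a Banach space $H$ (here $H=F^*$), a set function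 $\mu\colon\mathfrak{M}\to\mathcal{L}(E,H^* )$ is a weak* i-measure if for every $v\in H$ the set function $\mu_v\colon\mathfrak{M}\to\mathcal{L}(E,\mathbb{K})$, $\mu_v(A)x=(\mu(A)x)(v)$, is an i-measure; for $\mathfrak{M}=\mathfrak{B}(\Omega)$, $\mu$ is regular if each $\mu_v$ $(v\in H)$ is a regular i-measure. The total semivariation $\|\mu\|_Z$ is the supremum of $\|\sum_{n=1}^N\mu(A_n)x_n\|$ over finite $N$, pairwise disjoint $A_n\in\mathfrak{M}$, $x_n\in E$ with $\|x_n\|\le1$; it is known to be finite. $S_{\mathfrak{M}}(Z,E)$ is the set of bounded $f\colon Z\to E$ with $f(Z)$ countable and $f^{-1}(\{e\})\in\mathfrak{M}$ for all $e\in E$; for such $f$ the weak* integral $\int^{w*}_Z f\,\mathrm{d}\mu\in H^*$ is given by $(\int^{w*}_Z f\,\mathrm{d}\mu)(v)=\sum_{e\in E}(\mu(f^{-1}(\{e\}))e)(v)$, $v\in H$. It is linear and sup-norm continuous on $S_{\mathfrak{M}}(Z,E)$ with norm $\|\mu\|_Z$ and is extended by continuity to the uniform closure $M_{\mathfrak{M}}(Z,E)$ of $S_{\mathfrak{M}}(Z,E)$, which consists of all bounded $f\colon Z\to E$ with $f(Z)$ separable and $\psi\circ f$ $\mathfrak{M}$-measurable for every $\psi\in E^*$. Note $C_0(\Omega,E)\subset M_{\mathfrak{B}(\Omega)}(\Omega,E)$. *)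

theory Defs
  imports "HOL-Analysis.Analysis"
begin

section \<open>Scalars and Banach spaces over them\<close>

text \<open>
  The scalar field is a type of the following class: a normed field that is, as a normed real
  algebra, a copy of the real or of the complex numbers (inside \<^typ>\<open>complex\<close>).
\<close>

class real_or_complex = real_normed_field +
  assumes real_or_complex:
    "\<exists>\<phi> :: 'a \<Rightarrow> complex.
       (\<forall>x y. \<phi> (x + y) = \<phi> x + \<phi> y) \<and> (\<forall>x y. \<phi> (x * y) = \<phi> x * \<phi> y) \<and>
       (\<forall>r x. \<phi> (r *\<^sub>R x) = r *\<^sub>R \<phi> x) \<and> (\<forall>x. norm (\<phi> x) = norm x) \<and>
       (range \<phi> = \<real> \<or> range \<phi> = UNIV)"

instance real :: real_or_complex
  by standard (rule exI[of _ complex_of_real],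
    auto simp: Reals_def scaleR_conv_of_real)

instance complex :: real_or_complex
  by standard (rule exI[of _ "\<lambda>z. z"], auto)

text \<open>
  A Banach space over \<open>'k\<close> is a real Banach space together with a scalar
  multiplication by \<open>'k\<close> that extends the real one and is compatible with the norm.
\<close>

locale banach_over = vector_space scale
  for scale :: "'k::real_or_complex \<Rightarrow> 'v::banach \<Rightarrow> 'v" +
  assumes scale_of_real: "scale (of_real r) x = r *\<^sub>R x"
    and norm_scale: "norm (scale c x) = norm c * norm x"


section \<open>Linear operators and dual spaces\<close>

definition continuous_klinear_on ::
    "'a::real_normed_vector set \<Rightarrow> ('k \<Rightarrow> 'a \<Rightarrow> 'a) \<Rightarrow> ('k \<Rightarrow> 'b::real_normed_vector \<Rightarrow> 'b) \<Rightarrow>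
      ('a \<Rightarrow> 'b) \<Rightarrow> bool" where
  "continuous_klinear_on S s\<^sub>1 s\<^sub>2 T \<longleftrightarrow>
     (\<forall>x\<in>S. \<forall>y\<in>S. T (x + y) = T x + T y) \<and>
     (\<forall>c. \<forall>x\<in>S. T (s\<^sub>1 c x) = s\<^sub>2 c (T x)) \<and>
     continuous_on S T"

text \<open>Extended-real valued, so that unbounded suprema are not silently given a junk value.\<close>

definition op_norm_on :: "'a::real_normed_vector set \<Rightarrow> ('a \<Rightarrow> 'b::real_normed_vector) \<Rightarrow> ereal" where
  "op_norm_on S T = (SUP x\<in>{x\<in>S. norm x \<le> 1}. ereal (norm (T x)))"

text \<open>
  The dual of a whole type is carved out of the type of bounded real-linear maps, and carries
  its operator norm.  It is in general a proper subset of that type (for complex scalars), so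
  below the predual \<open>H\<close> is always a set together with a scalar multiplication \<open>s\<close>.
\<close>

definition dual_space :: "('k::real_or_complex \<Rightarrow> 'v::real_normed_vector \<Rightarrow> 'v) \<Rightarrow> ('v \<Rightarrow>\<^sub>L 'k) set" where
  "dual_space s = {v. continuous_klinear_on UNIV s (*) (blinfun_apply v)}"

definition dual_scale :: "'k::real_or_complex \<Rightarrow> ('v::real_normed_vector \<Rightarrow>\<^sub>L 'k) \<Rightarrow> ('v \<Rightarrow>\<^sub>L 'k)" where
  "dual_scale c v = blinfun_mult_right c o\<^sub>L v"

text \<open>
  Functionals on a set \<open>H\<close> are extensional functions, so that equal functionals are equal as
  functions.  Their dual norm is \<^const>\<open>op_norm_on\<close> \<open>H\<close>.
\<close>

definition dual_on ::
    "('k::real_or_complex \<Rightarrow> 'h::real_normed_vector \<Rightarrow> 'h) \<Rightarrow> 'h set \<Rightarrow> ('h \<Rightarrow> 'k) set" where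
  "dual_on s H = {\<Phi> \<in> extensional H. continuous_klinear_on H s (*) \<Phi>}"

definition canonical_embedding ::
    "('k::real_or_complex \<Rightarrow> 'v::real_normed_vector \<Rightarrow> 'v) \<Rightarrow> 'v \<Rightarrow> ('v \<Rightarrow>\<^sub>L 'k) \<Rightarrow> 'k" where
  "canonical_embedding s y = (\<lambda>v\<in>dual_space s. blinfun_apply v y)"

text \<open>The continuous linear operators from \<open>E\<close> to \<open>H\<^sup>*\<close>.\<close>

definition operators_to_dual ::
    "('k::real_or_complex \<Rightarrow> 'e::real_normed_vector \<Rightarrow> 'e) \<Rightarrow>
      ('k \<Rightarrow> 'h::real_normed_vector \<Rightarrow> 'h) \<Rightarrow> 'h set \<Rightarrow> ('e \<Rightarrow> 'h \<Rightarrow> 'k) set" where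
  "operators_to_dual sE s H =
     {\<tau>. (\<forall>x. \<tau> x \<in> dual_on s H) \<and>
         (\<forall>x y. \<forall>v\<in>H. \<tau> (x + y) v = \<tau> x v + \<tau> y v) \<and>
         (\<forall>c x. \<forall>v\<in>H. \<tau> (sE c x) v = c * \<tau> x v) \<and>
         (\<exists>B::real. \<forall>x. op_norm_on H (\<tau> x) \<le> ereal (B * norm x))}"


section \<open>I-measures\<close>

text \<open>A value \<open>M\<close> of type \<open>'z measure\<close> serves only as the sigma-algebra \<open>sets M\<close> on \<open>space M\<close>.\<close>

definition independently_convergent ::
    "(nat \<Rightarrow> 'e::real_normed_vector \<Rightarrow> 'g::real_normed_vector) \<Rightarrow> bool" where
  "independently_convergent T \<longleftrightarrow>
     (\<forall>x::nat \<Rightarrow> 'e. bounded (range x) \<longrightarrow> summable (\<lambda>n. T n (x n)))"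

definition i_measure ::
    "('k \<Rightarrow> 'e::real_normed_vector \<Rightarrow> 'e) \<Rightarrow> ('k \<Rightarrow> 'g::real_normed_vector \<Rightarrow> 'g) \<Rightarrow>
      'z measure \<Rightarrow> ('z set \<Rightarrow> 'e \<Rightarrow> 'g) \<Rightarrow> bool" where
  "i_measure sE sG M \<nu> \<longleftrightarrow>
     (\<forall>A\<in>sets M. continuous_klinear_on UNIV sE sG (\<nu> A)) \<and>
     (\<forall>A::nat \<Rightarrow> 'z set. range A \<subseteq> sets M \<longrightarrow> disjoint_family A \<longrightarrow>
        (\<forall>x. (\<lambda>n. \<nu> (A n) x) sums \<nu> (\<Union>n. A n) x) \<and>
        independently_convergent (\<lambda>n. \<nu> (A n)))"

definition sigma_compact :: "'z::topological_space set \<Rightarrow> bool" where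
  "sigma_compact K \<longleftrightarrow> (\<exists>C::nat \<Rightarrow> 'z set. (\<forall>n. compact (C n)) \<and> K = (\<Union>n. C n))"

definition regular_i_measure ::
    "('k \<Rightarrow> 'e::real_normed_vector \<Rightarrow> 'e) \<Rightarrow> ('k \<Rightarrow> 'g::real_normed_vector \<Rightarrow> 'g) \<Rightarrow>
      ('z::topological_space set \<Rightarrow> 'e \<Rightarrow> 'g) \<Rightarrow> bool" where
  "regular_i_measure sE sG \<nu> \<longleftrightarrow> i_measure sE sG borel \<nu> \<and>
     (\<forall>A\<in>sets borel. \<exists>K. sigma_compact K \<and> K \<subseteq> A \<and>
        (\<forall>B\<in>sets borel. B \<subseteq> A - K \<longrightarrow> (\<forall>x. \<nu> B x = 0)))"

text \<open>
  The set function \<open>\<mu>\<^sub>v\<close> is \<open>\<lambda>A x. \<mu> A x v\<close>.  As a map on \<open>sets M\<close>, \<open>\<mu>\<close> is extensional, so that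
  uniqueness of such a \<open>\<mu>\<close> is plain equality.
\<close>

definition weak_star_i_measure ::
    "('k::real_or_complex \<Rightarrow> 'e::real_normed_vector \<Rightarrow> 'e) \<Rightarrow>
      ('k \<Rightarrow> 'h::real_normed_vector \<Rightarrow> 'h) \<Rightarrow> 'h set \<Rightarrow>
      'z measure \<Rightarrow> ('z set \<Rightarrow> 'e \<Rightarrow> 'h \<Rightarrow> 'k) \<Rightarrow> bool" where
  "weak_star_i_measure sE s H M \<mu> \<longleftrightarrow>
     \<mu> \<in> sets M \<rightarrow>\<^sub>E operators_to_dual sE s H \<and>
     (\<forall>v\<in>H. i_measure sE (*) M (\<lambda>A x. \<mu> A x v))"

definition regular_weak_star_i_measure ::
    "('k::real_or_complex \<Rightarrow> 'e::real_normed_vector \<Rightarrow> 'e) \<Rightarrow>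
      ('k \<Rightarrow> 'h::real_normed_vector \<Rightarrow> 'h) \<Rightarrow> 'h set \<Rightarrow>
      ('z::topological_space set \<Rightarrow> 'e \<Rightarrow> 'h \<Rightarrow> 'k) \<Rightarrow> bool" where
  "regular_weak_star_i_measure sE s H \<mu> \<longleftrightarrow>
     weak_star_i_measure sE s H borel \<mu> \<and>
     (\<forall>v\<in>H. regular_i_measure sE (*) (\<lambda>A x. \<mu> A x v))"

definition total_semivariation ::
    "'h::real_normed_vector set \<Rightarrow> 'z measure \<Rightarrow>
      ('z set \<Rightarrow> 'e::real_normed_vector \<Rightarrow> 'h \<Rightarrow> 'k::real_or_complex) \<Rightarrow> ereal" where
  "total_semivariation H M \<mu> =
     Sup {op_norm_on H (\<lambda>v. \<Sum>n<N. \<mu> (A n) (x n) v) | (N::nat) A x.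
            (\<forall>n<N. A n \<in> sets M \<and> norm (x n) \<le> 1) \<and> disjoint_family_on A {..<N}}"


section \<open>The weak* integral\<close>

definition countably_valued :: "'z measure \<Rightarrow> ('z \<Rightarrow> 'e::real_normed_vector) set" where
  "countably_valued M =
     {f. bounded (f ` space M) \<and> countable (f ` space M) \<and> (\<forall>e. f -` {e} \<inter> space M \<in> sets M)}"

definition uniformly_measurable :: "'z measure \<Rightarrow> ('z \<Rightarrow> 'e::real_normed_vector) set" where
  "uniformly_measurable M =
     {f. \<exists>g. (\<forall>n. g n \<in> countably_valued M) \<and> uniform_limit (space M) g f sequentially}"

definition simple_weak_star_integral ::
    "'h set \<Rightarrow> 'z measure \<Rightarrow> ('z set \<Rightarrow> 'e \<Rightarrow> 'h \<Rightarrow> 'k::real_or_complex) \<Rightarrow>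
      ('z \<Rightarrow> 'e) \<Rightarrow> 'h \<Rightarrow> 'k" where
  "simple_weak_star_integral H M \<mu> f = (\<lambda>v\<in>H. \<Sum>\<^sub>\<infinity>e\<in>UNIV. \<mu> (f -` {e} \<inter> space M) e v)"

text \<open>
  Extension by continuity from the countably valued functions to their uniform closure: \<open>\<Phi>\<close> is
  the integral of \<open>f\<close> if the integrals of all countably valued sequences tending uniformly to \<open>f\<close>
  tend to \<open>\<Phi>\<close> in the norm of \<open>H\<^sup>*\<close>.  As \<open>f\<close> is required to be a uniform limit of such a
  sequence, \<open>\<Phi>\<close> is determined by \<open>f\<close>.
\<close>

definition has_weak_star_integral ::
    "('k::real_or_complex \<Rightarrow> 'h::real_normed_vector \<Rightarrow> 'h) \<Rightarrow> 'h set \<Rightarrow> 'z measure \<Rightarrow>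
      ('z set \<Rightarrow> 'e::real_normed_vector \<Rightarrow> 'h \<Rightarrow> 'k) \<Rightarrow> ('z \<Rightarrow> 'e) \<Rightarrow> ('h \<Rightarrow> 'k) \<Rightarrow> bool" where
  "has_weak_star_integral s H M \<mu> f \<Phi> \<longleftrightarrow>
     f \<in> uniformly_measurable M \<and> \<Phi> \<in> dual_on s H \<and>
     (\<forall>g. (\<forall>n. g n \<in> countably_valued M) \<longrightarrow> uniform_limit (space M) g f sequentially \<longrightarrow>
        (\<lambda>n. op_norm_on H (\<lambda>v. simple_weak_star_integral H M \<mu> (g n) v - \<Phi> v)) \<longlonglongrightarrow> 0)"


section \<open>Continuous functions vanishing at infinity\<close>

definition C0 :: "('z::topological_space \<Rightarrow>\<^sub>C 'e::real_normed_vector) set" where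
  "C0 = {f. \<forall>\<epsilon>>0. compact {z. \<epsilon> \<le> norm (apply_bcontfun f z)}}"

text \<open>Pointwise scalar multiplication (it preserves bounded continuity for \<^locale>\<open>banach_over\<close>).\<close>

definition bcontfun_scale ::
    "('k \<Rightarrow> 'e::real_normed_vector \<Rightarrow> 'e) \<Rightarrow> 'k \<Rightarrow> ('z::topological_space \<Rightarrow>\<^sub>C 'e) \<Rightarrow> ('z \<Rightarrow>\<^sub>C 'e)" where
  "bcontfun_scale s c f = Bcontfun (\<lambda>z. s c (apply_bcontfun f z))"

end

theory Submission
  imports Defs
begin

text \<open>
  Every \<open>v\<close> in the dual of \<open>F\<close> turns the operator into a scalar functional \<open>\<Phi> f = v (T f)\<close>.  The
  suprema of \<open>|\<Phi> f|\<close> over the unit ball of functions vanishing off an open set generate a finite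
  Radon measure, the variation of \<open>\<Phi>\<close>.  It controls the limit of \<open>\<Phi> (g x)\<close> as cutoff functions \<open>g\<close>
  approach the indicator function of a Borel set \<open>A\<close>, and this limit is \<open>\<mu> A x v\<close>; no duality for
  \<open>L\<^sup>1\<close> is needed.  Uniqueness is a statement about the scalar measures \<open>A \<mapsto> \<mu> A x v\<close>: by regularity
  they are determined by compact sets, on which they are limits of integrals of cutoff functions.
  The equality of norms uses that functionals of norm at most one recover the norm of \<open>F\<close>.
\<close>

section \<open>The scalar field\<close>

text \<open>Two substitutes shape the estimates: radial truncation, whose remainder
  \<open>f - clip a f\<close> vanishes off the compact set where \<open>norm f\<close> is at least
  \<open>a\<close>, and unimodular factors on disjoint sets, which make the supremum of
  \<open>norm (\<Phi> f)\<close> superadditive. The variation depends on \<open>v\<close>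
  nonlinearly, and no measure dominating all \<open>v\<close> is used; what is uniform in
  \<open>v\<close> is the total mass, at most the norm of \<open>T\<close> times that of
  \<open>v\<close>. Hence the estimates are made for one \<open>v\<close> at a time with errors
  proportional to this bound, and norm statements follow by taking the supremum over the unit ball
  of the dual. In the uniqueness part the regularity of a competitor speaks only of null sets
  outside sigma-compact sets. The uniform smallness on all subsets that the argument needs is
  extracted from countable additivity of scalar values alone.\<close>

instance real_or_complex \<subseteq> banach
proof
  fix X :: "nat \<Rightarrow> 'a"
  assume X: "Cauchy X"
  obtain \<phi> :: "'a \<Rightarrow> complex" where add: "\<And>x y. \<phi> (x + y) = \<phi> x + \<phi> y"
    and norm: "\<And>x. norm (\<phi> x) = norm x" and range: "range \<phi> = \<real> \<or> range \<phi> = UNIV"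
    using real_or_complex by metis
  have diff: "\<phi> (x - y) = \<phi> x - \<phi> y" for x y
    using add[of "x - y" y] by simp
  have dist: "dist (\<phi> x) (\<phi> y) = dist x y" for x y
    by (simp add: dist_norm norm flip: diff)
  have "Cauchy (\<lambda>n. \<phi> (X n))"
    using X by (simp add: Cauchy_def dist)
  then obtain l where l: "(\<lambda>n. \<phi> (X n)) \<longlonglongrightarrow> l"
    using Cauchy_convergent_iff convergent_def by blast
  \<comment> \<open>Both possible ranges are closed, so the limit found in \<open>complex\<close>
    comes from the scalar type. Completeness of the scalars later supplies the limits that define
    the measure.\<close>
  have "closed (range \<phi>)"
    using range closed_complex_Reals by auto
  then have "l \<in> range \<phi>"
    using closed_sequentially[OF _ _ l] by blast
  then obtain y where "l = \<phi> y" by blast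
  with l have "X \<longlonglongrightarrow> y"
    by (simp add: lim_sequentially dist)
  then show "convergent X"
    by (auto simp: convergent_def)
qed

text \<open>After this lemma \<open>\<phi>\<close> can be forgotten. The last complex property says
  that the real part is bounded by the modulus; it recovers real parts from equations between
  scalars.\<close>

lemma scalar_cases:
  obtains (reals) "\<And>c::'k::real_or_complex. \<exists>a. c = of_real a"
  | (complexes) i :: "'k::real_or_complex" where "i * i = -1" "\<And>c. \<exists>a b. c = of_real a + i * of_real b"
      "\<And>a b. \<bar>a\<bar> \<le> norm (of_real a + i * of_real b)"
proof -
  obtain \<phi> :: "'k \<Rightarrow> complex" where add: "\<And>x y. \<phi> (x + y) = \<phi> x + \<phi> y"
    and mult: "\<And>x y. \<phi> (x * y) = \<phi> x * \<phi> y" and scale: "\<And>r x. \<phi> (r *\<^sub>R x) = r *\<^sub>R \<phi> x"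
    and norm: "\<And>x. norm (\<phi> x) = norm x" and range: "range \<phi> = \<real> \<or> range \<phi> = UNIV"
    using real_or_complex by metis
  have diff: "\<phi> (x - y) = \<phi> x - \<phi> y" for x y
    using add[of "x - y" y] by simp
  have inj: "x = y" if "\<phi> x = \<phi> y" for x y
    using that norm[of "x - y"] by (simp add: diff)
  \<comment> \<open>Preservation of 1 is not assumed: \<open>\<phi> 1\<close> is a nonzero
    idempotent in a field, hence 1.\<close>
  have "\<phi> 1 = \<phi> 1 * \<phi> 1" "\<phi> 1 \<noteq> 0"
    using mult[of 1 1] norm[of 1] by auto
  then have one: "\<phi> 1 = 1" by simp
  have of_real: "\<phi> (of_real a) = of_real a" for a
    by (simp add: of_real_def scale one)
  from range show thesis
  proof
    assume "range \<phi> = \<real>"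
    have "\<exists>a. c = of_real a" for c :: 'k
    proof -
      have "\<phi> c \<in> \<real>"
        using \<open>range \<phi> = \<real>\<close> by blast
      then obtain a where "\<phi> c = of_real a"
        by (rule Reals_cases)
      then have "c = of_real a"
        by (intro inj) (simp add: of_real)
      then show ?thesis ..
    qed
    then show thesis by (rule reals)
  next
    assume "range \<phi> = UNIV"
    then obtain i where i: "\<phi> i = \<i>" by (metis surjD)
    show thesis
    proof (rule complexes)
      have "\<phi> (i * i) = \<phi> (0 - 1)"
        using diff[of 0 0] by (simp add: diff mult i one del: diff_0)
      then show "i * i = -1"
        using inj by fastforce
      show "\<exists>a b. c = of_real a + i * of_real b" for c
      proof (intro exI)
        show "c = of_real (Re (\<phi> c)) + i * of_real (Im (\<phi> c))"
          by (rule inj) (simp add: add mult i of_real flip: complex_eq)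
      qed
      show "\<bar>a\<bar> \<le> norm (of_real a + i * of_real b)" for a b
        using abs_Re_le_cmod[of "of_real a + \<i> * of_real b"]
        by (simp add: add mult i of_real flip: norm)
    qed
  qed
qed

lemma ex_unimodular_mult_eq_norm:
  fixes c :: "'k::real_normed_field"
  shows "\<exists>u. norm u = 1 \<and> u * c = of_real (norm c)"
proof (cases "c = 0")
  case True
  then show ?thesis by (intro exI[of _ 1]) simp
next
  case False
  then show ?thesis
    by (intro exI[of _ "of_real (norm c) / c"]) (simp add: norm_divide)
qed


section \<open>Norming functionals\<close>

text \<open>Homogeneity is only an inequality, the form that is checked for infima; applying it to
  the factor \<open>1 / t\<close> gives equality.\<close>

definition sublinear :: "('a::real_vector \<Rightarrow> real) \<Rightarrow> bool" where
  "sublinear p \<longleftrightarrow> (\<forall>x y. p (x + y) \<le> p x + p y) \<and> (\<forall>t>0. \<forall>x. p (t *\<^sub>R x) \<le> t * p x)"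

lemma sublinear_scaleR:
  assumes "sublinear p" "t > 0"
  shows "p (t *\<^sub>R x) = t * p x"
proof (rule antisym)
  show "p (t *\<^sub>R x) \<le> t * p x"
    using assms by (simp add: sublinear_def)
  have "p ((1 / t) *\<^sub>R t *\<^sub>R x) \<le> (1 / t) * p (t *\<^sub>R x)"
    using assms(2) by (intro assms(1)[unfolded sublinear_def, THEN conjunct2, rule_format]) simp
  then show "t * p x \<le> p (t *\<^sub>R x)"
    using assms(2) by (simp add: field_simps)
qed

lemma sublinear_zero:
  assumes "sublinear p"
  shows "p 0 = 0"
proof -
  have "p (2 *\<^sub>R 0) = 2 * p 0"
    by (rule sublinear_scaleR) (use assms in auto)
  then show ?thesis
    unfolding scaleR_zero_right by linarith
qed

lemma sublinear_ge:
  assumes "sublinear p"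
  shows "- p (- x) \<le> p x"
  using assms sublinear_zero[OF assms] unfolding sublinear_def
  by (metis add.right_inverse diff_ge_0_iff_ge diff_minus_eq_add)

text \<open>For a minimal sublinear \<open>p\<close> this forces \<open>q = p\<close>, hence \<open>p (- x) = - p x\<close> and \<open>p\<close> is linear.\<close>

lemma sublinear_lower:
  fixes x :: "'a::real_vector"
  assumes p: "sublinear p"
  shows "\<exists>q. sublinear q \<and> q \<le> p \<and> q (- x) \<le> - p x"
proof -
  \<comment> \<open>This lowers \<open>p\<close> along the ray in direction \<open>x\<close>:
    \<open>t = 0\<close> gives \<open>q \<le> p\<close>, and \<open>t = 1\<close> at
    \<open>- x\<close> gives \<open>q (- x) \<le> - p x\<close>. Subadditivity survives because the
    parameters of two rays add up.\<close>
  define q where "q z = (INF t\<in>{0..}. p (z + t *\<^sub>R x) - t * p x)" for z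
  have sub: "p (y + z) \<le> p y + p z" for y z
    using p by (simp add: sublinear_def)
  have hom: "p (t *\<^sub>R z) = t * p z" if "t \<ge> 0" for t z
    using sublinear_scaleR[OF p] sublinear_zero[OF p] that by (cases "t = 0") auto
  have lower: "- p (- z) \<le> p (z + t *\<^sub>R x) - t * p x" if "t \<ge> 0" for t z
    using sub[of "z + t *\<^sub>R x" "- z"] hom[OF that, of x] by simp
  have bdd: "bdd_below ((\<lambda>t. p (z + t *\<^sub>R x) - t * p x) ` {0..})" for z
    using lower by (intro bdd_belowI2[where m = "- p (- z)"]) auto
  have upper: "q z \<le> p (z + t *\<^sub>R x) - t * p x" if "t \<ge> 0" for t z
    unfolding q_def using that bdd by (intro cINF_lower) auto
  have greatest: "b \<le> q z" if "\<And>t. t \<ge> 0 \<Longrightarrow> b \<le> p (z + t *\<^sub>R x) - t * p x" for b z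
    unfolding q_def using that by (intro cINF_greatest) auto
  have "q (y + z) \<le> q y + q z" for y z
  proof -
    have "q (y + z) - (p (y + s *\<^sub>R x) - s * p x) \<le> q z" if "s \<ge> 0" for s
    proof (rule greatest)
      fix t :: real assume "t \<ge> 0"
      then have "q (y + z) \<le> p ((y + z) + (s + t) *\<^sub>R x) - (s + t) * p x"
        using that by (intro upper) auto
      also have "p ((y + z) + (s + t) *\<^sub>R x) \<le> p (y + s *\<^sub>R x) + p (z + t *\<^sub>R x)"
        using sub[of "y + s *\<^sub>R x" "z + t *\<^sub>R x"] by (simp add: algebra_simps)
      finally show "q (y + z) - (p (y + s *\<^sub>R x) - s * p x) \<le> p (z + t *\<^sub>R x) - t * p x"
        by (simp add: algebra_simps)
    qed
    then have "q (y + z) - q z \<le> p (y + s *\<^sub>R x) - s * p x" if "s \<ge> 0" for s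
      using that by (simp add: algebra_simps)
    from greatest[OF this] show ?thesis by simp
  qed
  moreover have "q (t *\<^sub>R z) \<le> t * q z" if "t > 0" for t z
  proof -
    have "q (t *\<^sub>R z) / t \<le> q z"
    proof (rule greatest)
      fix s :: real assume "s \<ge> 0"
      then have "q (t *\<^sub>R z) \<le> p (t *\<^sub>R z + (t * s) *\<^sub>R x) - (t * s) * p x"
        using that by (intro upper) auto
      also have "p (t *\<^sub>R z + (t * s) *\<^sub>R x) = t * p (z + s *\<^sub>R x)"
        using hom[of t "z + s *\<^sub>R x"] that by (simp add: scaleR_add_right)
      finally show "q (t *\<^sub>R z) / t \<le> p (z + s *\<^sub>R x) - s * p x"
        using that by (simp add: field_simps)
    qed
    then show ?thesis using that by (simp add: field_simps)
  qed
  ultimately have "sublinear q" by (simp add: sublinear_def)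
  moreover have "q \<le> p"
    using upper[of 0] by (auto simp: le_fun_def)
  moreover have "q (- x) \<le> - p x"
    using upper[of 1 "- x"] sublinear_zero[OF p] by simp
  ultimately show ?thesis by blast
qed

text \<open>Zorn's lemma for the reversed order: a chain is bounded by its pointwise infimum, which
  is finite because sublinearity keeps every member at \<open>x\<close> above
  \<open>- p\<^sub>0 (- x)\<close>.\<close>

lemma ex_minimal_sublinear:
  assumes p0: "sublinear p\<^sub>0"
  shows "\<exists>p. sublinear p \<and> p \<le> p\<^sub>0 \<and> (\<forall>q. sublinear q \<longrightarrow> q \<le> p \<longrightarrow> q = p)"
proof -
  define A where "A = {p. sublinear p \<and> p \<le> p\<^sub>0}"
  have "\<exists>p\<in>A. \<forall>q\<in>A. q \<le> p \<longrightarrow> q = p"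
  proof (rule predicate_Zorn)
    show "partial_order_on A (relation_of (\<lambda>p q. q \<le> p) A)"
      by (rule partial_order_on_relation_ofI) auto
    fix C assume C: "C \<in> Chains (relation_of (\<lambda>p q. q \<le> p) A)"
    then have CA: "C \<subseteq> A"
      and comparable: "\<And>p q. p \<in> C \<Longrightarrow> q \<in> C \<Longrightarrow> p \<le> q \<or> q \<le> p"
      by (auto simp: Chains_def relation_of_def)
    show "\<exists>u\<in>A. \<forall>a\<in>C. u \<le> a"
    proof (cases "C = {}")
      case True
      then show ?thesis using p0 by (auto simp: A_def)
    next
      case False
      define r where "r x = (INF p\<in>C. p x)" for x
      have sublin: "sublinear p" if "p \<in> C" for p
        using CA that by (auto simp: A_def)
      have "- p\<^sub>0 (- x) \<le> p x" if "p \<in> C" for p x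
        using sublinear_ge[OF sublin[OF that], of x] CA that
        by (force simp: A_def le_fun_def dest: spec[of _ "- x"])
      then have bdd: "bdd_below ((\<lambda>p. p x) ` C)" for x
        by (intro bdd_belowI2) auto
      have upper: "r x \<le> p x" if "p \<in> C" for p x
        unfolding r_def using that bdd by (intro cINF_lower) auto
      have greatest: "b \<le> r x" if "\<And>p. p \<in> C \<Longrightarrow> b \<le> p x" for b x
        unfolding r_def using that False by (intro cINF_greatest) auto
      have "r (x + y) \<le> r x + r y" for x y
      proof -
        \<comment> \<open>The infima at \<open>x\<close> and \<open>y\<close> may be approached
          along different members of the chain; the smaller of the two serves both.\<close>
        have "r (x + y) \<le> p x + q y" if "p \<in> C" "q \<in> C" for p q
        proof -
          obtain m where m: "m \<in> C" "m \<le> p" "m \<le> q"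
            using comparable[OF \<open>p \<in> C\<close> \<open>q \<in> C\<close>] \<open>p \<in> C\<close> \<open>q \<in> C\<close> by blast
          have "r (x + y) \<le> m (x + y)" by (rule upper[OF m(1)])
          also have "\<dots> \<le> m x + m y"
            using sublin[OF m(1)] by (simp add: sublinear_def)
          finally show ?thesis
            using m(2,3) by (fastforce simp: le_fun_def intro: order_trans add_mono)
        qed
        then have "r (x + y) - p x \<le> r y" if "p \<in> C" for p
          using that by (intro greatest) (metis add.commute diff_le_eq)
        then have "r (x + y) - r y \<le> r x"
          by (intro greatest) (simp add: diff_le_eq add.commute)
        then show ?thesis by simp
      qed
      moreover have "r (t *\<^sub>R x) \<le> t * r x" if "t > 0" for t x
      proof -
        have "r (t *\<^sub>R x) / t \<le> r x"
        proof (rule greatest)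
          fix p assume p: "p \<in> C"
          then have "r (t *\<^sub>R x) \<le> t * p x"
            using upper[OF p, of "t *\<^sub>R x"] sublinear_scaleR[OF sublin[OF p] that, of x] by simp
          then show "r (t *\<^sub>R x) / t \<le> p x"
            using that by (simp add: field_simps)
        qed
        then show ?thesis using that by (simp add: field_simps)
      qed
      ultimately have "sublinear r" by (simp add: sublinear_def)
      moreover have "r \<le> p" if "p \<in> C" for p
        using upper[OF that] by (simp add: le_fun_def)
      ultimately show ?thesis
        using False CA unfolding A_def by (metis (no_types, lifting) all_not_in_conv mem_Collect_eq order_trans subset_iff)
    qed
  qed
  then show ?thesis
    unfolding A_def by (metis (no_types, lifting) mem_Collect_eq order_trans)
qed

text \<open>Hahn-Banach in norming form. Lowering the norm at \<open>y\<close> before minimising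
  pins the value at \<open>y\<close>; minimality then makes the functional odd, hence
  linear.\<close>

lemma ex_norming_real_functional:
  fixes y :: "'a::real_normed_vector"
  shows "\<exists>u. linear u \<and> (\<forall>x. \<bar>u x\<bar> \<le> norm x) \<and> u y = norm y"
proof -
  have "sublinear (norm :: 'a \<Rightarrow> real)"
    by (simp add: sublinear_def norm_triangle_ineq)
  then obtain p0 where p0: "sublinear p0" "p0 \<le> norm" "p0 (- y) \<le> - norm y"
    using sublinear_lower by blast
  then obtain p where p: "sublinear p" "p \<le> p0" "\<And>q. sublinear q \<Longrightarrow> q \<le> p \<Longrightarrow> q = p"
    using ex_minimal_sublinear by metis
  have neg: "p (- x) = - p x" for x
    using sublinear_lower[OF p(1), of x] sublinear_ge[OF p(1), of x] p(3)
    by (metis antisym minus_le_iff)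
  have sub: "p (x + z) \<le> p x + p z" for x z
    using p(1) by (simp add: sublinear_def)
  have "p (x + z) = p x + p z" for x z
    using sub[of x z] sub[of "- x" "- z"] neg[of "x + z"] by (simp add: neg)
  moreover have "p (t *\<^sub>R x) = t * p x" for t x
  proof (cases t "0::real" rule: linorder_cases)
    case less
    then show ?thesis
      using sublinear_scaleR[OF p(1), of "- t" x] neg[of "t *\<^sub>R x"] by simp
  qed (use sublinear_scaleR[OF p(1)] sublinear_zero[OF p(1)] in auto)
  ultimately have "linear p" by (intro linearI) auto
  have le: "p x \<le> norm x" for x
    using p(2) p0(2) by (auto simp: le_fun_def intro: order_trans)
  have "\<bar>p x\<bar> \<le> norm x" for x
    using le[of x] le[of "- x"] by (simp add: neg)
  moreover have "p y = norm y"
    using le[of y] p0(3) p(2) neg[of y] by (force simp: le_fun_def dest: spec[of _ "- y"])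
  ultimately show ?thesis using \<open>linear p\<close> by blast
qed

text \<open>A norming functional of the underlying real space is complexified where necessary.
  Rotating the argument until the value is a nonnegative real shows that complexification does not
  increase the norm.\<close>

lemma (in banach_over) ex_norming_functional:
  "\<exists>v\<in>dual_space scale. norm v \<le> 1 \<and> norm (blinfun_apply v y) = norm y"
proof -
  obtain u where u: "linear u" "\<And>x. \<bar>u x\<bar> \<le> norm x" "u y = norm y"
    using ex_norming_real_functional[of y] by blast
  note u_simps = linear_add[OF u(1)] linear_diff[OF u(1)] linear_scale[OF u(1)] linear_neg[OF u(1)]
  have "\<exists>w. (\<forall>x z. w (x + z) = w x + w z) \<and> (\<forall>c x. w (scale c x) = c * w x) \<and>
    (\<forall>x. norm (w x) \<le> norm x) \<and> norm (w y) = norm y"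
  proof (cases rule: scalar_cases[where ?'k = 'k])
    case reals
    have "of_real (u (scale c x)) = c * of_real (u x)" for c x
      using reals[of c] by (auto simp: scale_of_real u_simps)
    then show ?thesis
      using u by (intro exI[of _ "\<lambda>x. of_real (u x)"]) (auto simp: u_simps)
  next
    case (complexes i)
    \<comment> \<open>Linearity forces this formula: the imaginary part at \<open>x\<close> must be
      minus the real part at \<open>scale i x\<close>.\<close>
    define w where "w x = of_real (u x) - i * of_real (u (scale i x))" for x
    have add: "w (x + z) = w x + w z" for x z
      by (simp add: w_def scale_right_distrib u_simps algebra_simps)
    have "scale i (a *\<^sub>R x) = a *\<^sub>R scale i x" for a x
      by (simp add: scale_left_commute flip: scale_of_real)
    then have w_real: "w (scale (of_real a) x) = of_real a * w x" for a x
      by (simp add: w_def scale_of_real u_simps algebra_simps)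
    have w_i: "w (scale i x) = i * w x" for x
    proof -
      have "scale i (scale i x) = - x"
        using complexes(1) by simp
      then show ?thesis
        using complexes(1) by (simp add: w_def u_simps right_diff_distrib flip: mult.assoc)
    qed
    have mult: "w (scale c x) = c * w x" for c x
    proof -
      obtain a b where "c = of_real a + i * of_real b" using complexes(2) by blast
      then show ?thesis
        using w_real w_i by (simp add: scale_left_distrib add algebra_simps flip: scale_scale)
    qed
    have le: "norm (w x) \<le> norm x" for x
    proof -
      obtain c where c: "norm c = 1" "c * w x = of_real (norm (w x))"
        using ex_unimodular_mult_eq_norm by blast
      then have "w (scale c x) = of_real (norm (w x))"
        by (simp add: mult)
      then have "of_real (u (scale c x) - norm (w x)) + i * of_real (- u (scale i (scale c x))) = 0"
        unfolding w_def[of "scale c x"] by (simp add: algebra_simps del: scale_scale)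
      then have "norm (w x) = u (scale c x)"
        using complexes(3)[of "u (scale c x) - norm (w x)" "- u (scale i (scale c x))"] by simp
      also have "\<dots> \<le> norm x"
        using u(2)[of "scale c x"] c(1) by (simp add: norm_scale)
      finally show ?thesis .
    qed
    moreover have "norm (w y) = norm y"
      using complexes(3)[of "u y" "- u (scale i y)"] u(3) le[of y] by (simp add: w_def)
    ultimately show ?thesis
      using add mult by (intro exI[of _ w]) simp
  qed
  then obtain w where w: "\<And>x z. w (x + z) = w x + w z" "\<And>c x. w (scale c x) = c * w x"
    "\<And>x. norm (w x) \<le> norm x" "norm (w y) = norm y"
    by blast
  have bl: "bounded_linear w"
  proof (rule bounded_linear_intro)
    show "w (r *\<^sub>R x) = r *\<^sub>R w x" for r x
      using w(2)[of "of_real r" x] by (simp add: scale_of_real scaleR_conv_of_real)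
    show "norm (w x) \<le> norm x * 1" for x using w(3) by simp
  qed (rule w(1))
  then have Blinfun_w: "blinfun_apply (Blinfun w) = w"
    by (rule bounded_linear_Blinfun_apply)
  show ?thesis
  proof (intro bexI conjI)
    show "norm (Blinfun w) \<le> 1"
      by (rule norm_blinfun_bound) (simp_all add: Blinfun_w w(3))
    show "Blinfun w \<in> dual_space scale"
      using bl by (simp add: dual_space_def continuous_klinear_on_def Blinfun_w w(1,2) linear_continuous_on)
  qed (simp add: Blinfun_w w(4))
qed

section \<open>Functions vanishing at infinity\<close>

text \<open>Stated for plain functions, so that sums, multiples and truncations need no repackaging
  as bounded continuous functions; boundedness is a consequence.\<close>

definition C0_fun :: "('z::topological_space \<Rightarrow> 'e::real_normed_vector) \<Rightarrow> bool" where
  "C0_fun f \<longleftrightarrow> continuous_on UNIV f \<and> (\<forall>\<epsilon>>0. compact {z. \<epsilon> \<le> norm (f z)})"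

lemma C0_fun_continuous: "C0_fun f \<Longrightarrow> continuous_on UNIV f"
  by (simp add: C0_fun_def)

lemma compact_closed_superlevel:
  fixes f :: "'z::topological_space \<Rightarrow> real"
  assumes "continuous_on UNIV f" "compact K" "{z. c \<le> f z} \<subseteq> K"
  shows "compact {z. c \<le> f z}"
proof -
  have "closed {z. c \<le> f z}"
    using assms(1) by (intro closed_Collect_le continuous_on_const)
  then show ?thesis
    using compact_Int_closed[OF assms(2)] assms(3) by (metis inf.absorb_iff2)
qed

lemma C0_fun_dominated:
  assumes f: "C0_fun f" and g: "continuous_on UNIV g" and le: "\<And>z. norm (g z) \<le> C * norm (f z)"
  shows "C0_fun g"
  unfolding C0_fun_def
proof (intro conjI allI impI)
  fix \<epsilon> :: real assume "\<epsilon> > 0"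
  \<comment> \<open>\<open>C\<close> may be zero or negative, but the level
    \<open>\<epsilon> / D\<close> must be positive.\<close>
  define D where "D = \<bar>C\<bar> + 1"
  have "D > 0" by (simp add: D_def)
  have le': "norm (g z) \<le> D * norm (f z)" for z
    by (rule order_trans[OF le]) (intro mult_right_mono, auto simp: D_def)
  show "compact {z. \<epsilon> \<le> norm (g z)}"
  proof (rule compact_closed_superlevel)
    show "compact {z. \<epsilon> / D \<le> norm (f z)}"
      using f \<open>\<epsilon> > 0\<close> \<open>D > 0\<close> by (simp add: C0_fun_def)
    show "{z. \<epsilon> \<le> norm (g z)} \<subseteq> {z. \<epsilon> / D \<le> norm (f z)}"
      using le' \<open>D > 0\<close> by (auto simp: pos_divide_le_eq mult.commute intro: order_trans)
  qed (intro continuous_intros g)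
qed (rule g)

lemma C0_fun_compact_support:
  assumes "continuous_on UNIV f" "compact K" "\<And>z. z \<notin> K \<Longrightarrow> f z = 0"
  shows "C0_fun f"
  unfolding C0_fun_def
proof (intro conjI allI impI)
  fix \<epsilon> :: real assume "\<epsilon> > 0"
  show "compact {z. \<epsilon> \<le> norm (f z)}"
    by (rule compact_closed_superlevel[OF _ assms(2)])
      (use assms \<open>\<epsilon> > 0\<close> in \<open>force intro!: continuous_intros\<close>)+
qed (rule assms(1))

lemma C0_fun_zero: "C0_fun (\<lambda>_. 0)"
  by (rule C0_fun_compact_support[of _ "{}"]) auto

lemma C0_fun_add:
  assumes "C0_fun f" "C0_fun g"
  shows "C0_fun (\<lambda>z. f z + g z)"
  unfolding C0_fun_def
proof (intro conjI allI impI)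
  fix \<epsilon> :: real assume "\<epsilon> > 0"
  show "compact {z. \<epsilon> \<le> norm (f z + g z)}"
  proof (rule compact_closed_superlevel)
    show "compact ({z. \<epsilon> / 2 \<le> norm (f z)} \<union> {z. \<epsilon> / 2 \<le> norm (g z)})"
      using assms half_gt_zero[OF \<open>\<epsilon> > 0\<close>] unfolding C0_fun_def by (blast intro: compact_Un)
    show "{z. \<epsilon> \<le> norm (f z + g z)} \<subseteq> {z. \<epsilon> / 2 \<le> norm (f z)} \<union> {z. \<epsilon> / 2 \<le> norm (g z)}"
    proof
      fix z assume "z \<in> {z. \<epsilon> \<le> norm (f z + g z)}"
      then show "z \<in> {z. \<epsilon> / 2 \<le> norm (f z)} \<union> {z. \<epsilon> / 2 \<le> norm (g z)}"
        using norm_triangle_ineq[of "f z" "g z"] by auto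
    qed
  qed (use assms in \<open>auto intro!: continuous_intros simp: C0_fun_def\<close>)
qed (use assms in \<open>auto intro!: continuous_intros simp: C0_fun_def\<close>)

lemma C0_fun_scaleR:
  fixes g :: "'z::topological_space \<Rightarrow> real"
  assumes "C0_fun f" "continuous_on UNIV g" "\<And>z. \<bar>g z\<bar> \<le> C"
  shows "C0_fun (\<lambda>z. g z *\<^sub>R f z)"
  by (rule C0_fun_dominated[OF assms(1), where C = C])
    (use assms in \<open>auto intro!: continuous_intros mult_right_mono simp: C0_fun_def\<close>)

lemma C0_fun_bounded_linear:
  assumes "C0_fun f" "bounded_linear h"
  shows "C0_fun (\<lambda>z. h (f z))"
proof -
  obtain C where "\<And>x. norm (h x) \<le> norm x * C"
    using bounded_linear.bounded[OF assms(2)] by blast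
  then show ?thesis
    using assms by (intro C0_fun_dominated[OF assms(1), where C = C])
      (auto intro: bounded_linear.continuous_on C0_fun_continuous simp: mult.commute)
qed

lemma C0_fun_minus: "C0_fun f \<Longrightarrow> C0_fun (\<lambda>z. - f z)"
  using C0_fun_bounded_linear[of f uminus] bounded_linear_minus[OF bounded_linear_ident] by simp

lemma C0_fun_diff: "C0_fun f \<Longrightarrow> C0_fun g \<Longrightarrow> C0_fun (\<lambda>z. f z - g z)"
  using C0_fun_add[of f "\<lambda>z. - g z"] C0_fun_minus[of g] by simp

lemma C0_fun_sum: "(\<And>i. i \<in> I \<Longrightarrow> C0_fun (f i)) \<Longrightarrow> C0_fun (\<lambda>z. \<Sum>i\<in>I. f i z)"
  by (induction I rule: infinite_finite_induct) (auto intro: C0_fun_zero C0_fun_add)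

lemma C0_fun_bounded:
  assumes "C0_fun f"
  obtains b where "b > 0" "\<And>z. norm (f z) \<le> b"
proof -
  have "compact (f ` {z. 1 \<le> norm (f z)})"
    using assms by (intro compact_continuous_image) (auto simp: C0_fun_def intro: continuous_on_subset)
  then obtain b where "\<forall>x\<in>f ` {z. 1 \<le> norm (f z)}. norm x \<le> b"
    using compact_imp_bounded bounded_iff by metis
  then have b: "1 \<le> norm (f z) \<Longrightarrow> norm (f z) \<le> b" for z
    by simp
  show thesis
  proof (rule that)
    show "norm (f z) \<le> max 1 b" for z
      using b[of z] by linarith
  qed simp
qed

text \<open>Vanishing off \<open>U\<close> is meant pointwise, which makes the notion monotone in
  \<open>K\<close> and \<open>U\<close>; the compact set \<open>C\<close> is not tied to
  \<open>U\<close>. With \<open>K\<close> empty and \<open>U\<close> the whole space, this describes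
  any continuous function into the unit interval that vanishes off some compact set.\<close>

definition cutoff :: "'z::topological_space set \<Rightarrow> 'z set \<Rightarrow> ('z \<Rightarrow> real) \<Rightarrow> bool" where
  "cutoff K U g \<longleftrightarrow> continuous_on UNIV g \<and> (\<forall>z. 0 \<le> g z \<and> g z \<le> 1) \<and> (\<forall>z\<in>K. g z = 1) \<and>
     (\<forall>z. z \<notin> U \<longrightarrow> g z = 0) \<and> (\<exists>C. compact C \<and> (\<forall>z. z \<notin> C \<longrightarrow> g z = 0))"

lemma cutoff_mono: "cutoff K U g \<Longrightarrow> K' \<subseteq> K \<Longrightarrow> U \<subseteq> U' \<Longrightarrow> cutoff K' U' g"
  unfolding cutoff_def by blast

lemma cutoff_C0_fun: "cutoff K U g \<Longrightarrow> C0_fun (\<lambda>z. g z *\<^sub>R x)"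
  unfolding cutoff_def
  by (elim conjE exE) (rule C0_fun_compact_support, auto intro!: continuous_intros)

text \<open>Urysohn's lemma is applied to \<open>K\<close> and the complement of
  \<open>U \<inter> V\<close>, where \<open>V\<close> is an open neighbourhood of \<open>K\<close>
  inside a compact \<open>L\<close>; thus the function vanishes off \<open>L\<close>.\<close>

lemma ex_cutoff:
  fixes K U :: "'z::t2_space set"
  assumes lc: "locally_compact_space (euclidean :: 'z topology)"
    and K: "compact K" and U: "open U" and KU: "K \<subseteq> U"
  shows "\<exists>g. cutoff K U g"
proof -
  have haus: "Hausdorff_space (euclidean :: 'z topology)"
    unfolding Hausdorff_space_def disjnt_def using separation_t2 by (metis open_openin)
  obtain V L where V: "open V" "compact L" "K \<subseteq> V" "V \<subseteq> L"
    using lc K unfolding locally_compact_space_compact_closed_compact[OF disjI1[OF haus]]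
    by (metis compactin_euclidean_iff open_openin)
  have "completely_regular_space (euclidean :: 'z topology)"
    using haus lc locally_compact_Hausdorff_imp_regular_space
      locally_compact_regular_imp_completely_regular_space by blast
  moreover have "compactin euclidean K" "closedin euclidean (- (U \<inter> V))" "disjnt K (- (U \<inter> V))"
    using K U V KU by (auto simp: disjnt_def)
  ultimately obtain g :: "'z \<Rightarrow> real"
    where "continuous_map euclidean (subtopology euclidean {0..1}) g"
      and "g ` (- (U \<inter> V)) \<subseteq> {0}" "g ` K \<subseteq> {1}"
    using Urysohn_completely_regular_closed_compact[of 0 1 euclidean K "- (U \<inter> V)"]
      Urysohn_completely_regular_compact_closed[of 0 1 euclidean K "- (U \<inter> V)"]
      Urysohn_completely_regular_closed_compact[of 0 1 euclidean "- (U \<inter> V)" K]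
    by (metis disjnt_sym zero_le_one)
  then have "cutoff K U g"
    using V unfolding cutoff_def by (auto simp: continuous_map_in_subtopology image_subset_iff Pi_iff intro!: exI[of _ L])
  then show ?thesis by blast
qed

text \<open>For \<open>a > 0\<close> this is the radial retraction onto the closed ball of radius
  \<open>a\<close>, a substitute for \<open>min f a\<close> when the values carry no order.\<close>

definition clip :: "real \<Rightarrow> 'e::real_normed_vector \<Rightarrow> 'e" where
  "clip a x = x /\<^sub>R max 1 (norm x / a)"

lemma continuous_on_clip [continuous_intros]:
  "continuous_on S f \<Longrightarrow> a > 0 \<Longrightarrow> continuous_on S (\<lambda>z. clip a (f z))"
  unfolding clip_def by (intro continuous_intros) auto

lemma clip_eq: "norm x \<le> a \<Longrightarrow> a > 0 \<Longrightarrow> clip a x = x"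
  by (simp add: clip_def max_def)

lemma norm_clip_le:
  assumes "a > 0"
  shows "norm (clip a x) \<le> a"
  using assms by (auto simp: clip_def max_def field_simps)

lemma norm_clip_le_norm:
  assumes "a > 0"
  shows "norm (clip a x) \<le> norm x"
  using norm_clip_le[OF assms, of x] clip_eq[OF _ assms, of x] by fastforce

lemma norm_diff_clip_le:
  assumes "a > 0"
  shows "norm (x - clip a x) \<le> norm x"
proof -
  let ?m = "max 1 (norm x / a)"
  have "x - clip a x = (1 - inverse ?m) *\<^sub>R x"
    by (simp add: clip_def algebra_simps)
  moreover have "0 \<le> inverse ?m" "inverse ?m \<le> 1"
    by (auto simp: inverse_le_1_iff)
  ultimately show ?thesis
    by (simp add: mult_left_le_one_le)
qed

lemma C0_fun_clip: "C0_fun f \<Longrightarrow> a > 0 \<Longrightarrow> C0_fun (\<lambda>z. clip a (f z))"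
  by (rule C0_fun_dominated[where C = 1])
    (auto intro!: continuous_intros simp: norm_clip_le_norm C0_fun_continuous)

lemma (in banach_over) bounded_linear_scale: "bounded_linear (scale c)"
proof (rule bounded_linear_intro)
  show "scale c (r *\<^sub>R x) = r *\<^sub>R scale c x" for r x
    by (simp add: scale_left_commute flip: scale_of_real)
  show "norm (scale c x) \<le> norm x * norm c" for x
    by (simp add: norm_scale)
qed (rule scale_right_distrib)

text \<open>The constant \<open>c\<close> collects all factors of \<open>\<epsilon>\<close> in an
  estimate; with its sign left open, they need no bookkeeping.\<close>

lemma le_of_le_add_mult_epsilon:
  fixes x y c :: real
  assumes "\<And>\<epsilon>. \<epsilon> > 0 \<Longrightarrow> x \<le> y + \<epsilon> * c"
  shows "x \<le> y"
proof (rule field_le_epsilon)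
  fix e :: real assume "e > 0"
  have "x \<le> y + e / (\<bar>c\<bar> + 1) * c"
    using \<open>e > 0\<close> by (intro assms) auto
  also have "e / (\<bar>c\<bar> + 1) * c \<le> e"
    using \<open>e > 0\<close> by (auto simp: field_simps abs_if mult_left_mono)
  finally show "x \<le> y + e" by simp
qed

section \<open>The variation measure of a functional\<close>

text \<open>The laws are restricted to arguments satisfying \<open>C0_fun\<close>, as
  \<open>\<Phi>\<close> acts on all functions of the type. \<open>B\<close> is any bound for the
  norm; for the functional attached to \<open>v\<close> it will be
  \<open>op_norm * norm v\<close>.\<close>

locale C0_functional = banach_over scale
  for scale :: "'k::real_or_complex \<Rightarrow> 'e::banach \<Rightarrow> 'e" +
  fixes \<Phi> :: "('z::t2_space \<Rightarrow> 'e) \<Rightarrow> 'k" and B :: real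
  assumes locally_compact: "locally_compact_space (euclidean :: 'z topology)"
    and \<Phi>_add: "C0_fun f \<Longrightarrow> C0_fun g \<Longrightarrow> \<Phi> (\<lambda>z. f z + g z) = \<Phi> f + \<Phi> g"
    and \<Phi>_scale: "C0_fun f \<Longrightarrow> \<Phi> (\<lambda>z. scale c (f z)) = c * \<Phi> f"
    and \<Phi>_bound: "C0_fun f \<Longrightarrow> (\<And>z. norm (f z) \<le> b) \<Longrightarrow> norm (\<Phi> f) \<le> B * b"
begin

lemma \<Phi>_scaleR: "C0_fun f \<Longrightarrow> \<Phi> (\<lambda>z. r *\<^sub>R f z) = of_real r * \<Phi> f"
  using \<Phi>_scale[of f "of_real r"] by (simp add: scale_of_real)

lemma \<Phi>_zero: "\<Phi> (\<lambda>_. 0) = 0"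
  using \<Phi>_scaleR[of "\<lambda>_. 0" 0] C0_fun_zero by simp

lemma \<Phi>_diff: "C0_fun f \<Longrightarrow> C0_fun g \<Longrightarrow> \<Phi> (\<lambda>z. f z - g z) = \<Phi> f - \<Phi> g"
  using \<Phi>_add[of f "\<lambda>z. - g z"] \<Phi>_scaleR[of g "-1"] C0_fun_minus[of g] by simp

lemma \<Phi>_sum:
  "(\<And>i. i \<in> I \<Longrightarrow> C0_fun (f i)) \<Longrightarrow> \<Phi> (\<lambda>z. \<Sum>i\<in>I. f i z) = (\<Sum>i\<in>I. \<Phi> (f i))"
  by (induction I rule: infinite_finite_induct) (simp_all add: \<Phi>_zero \<Phi>_add C0_fun_sum)

lemma C0_fun_scale: "C0_fun f \<Longrightarrow> C0_fun (\<lambda>z. scale c (f z))"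
  using C0_fun_bounded_linear bounded_linear_scale by blast

lemma B_nonneg: "0 \<le> B"
  using order_trans[OF norm_ge_zero \<Phi>_bound[of "\<lambda>_. 0" 1]] C0_fun_zero by simp

section \<open>The norm of the functional on functions vanishing off a set\<close>

definition unit_ball_on :: "'z set \<Rightarrow> ('z \<Rightarrow> 'e) set" where
  "unit_ball_on U = {f. C0_fun f \<and> (\<forall>z. norm (f z) \<le> 1) \<and> (\<forall>z. z \<notin> U \<longrightarrow> f z = 0)}"

lemma unit_ball_onD:
  assumes "f \<in> unit_ball_on U"
  shows "C0_fun f" "norm (f z) \<le> 1" "z \<notin> U \<Longrightarrow> f z = 0"
  using assms by (auto simp: unit_ball_on_def)

lemma zero_in_unit_ball_on: "(\<lambda>_. 0) \<in> unit_ball_on U"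
  by (simp add: unit_ball_on_def C0_fun_zero)

lemma unit_ball_on_mono: "U \<subseteq> V \<Longrightarrow> unit_ball_on U \<subseteq> unit_ball_on V"
  by (auto simp: unit_ball_on_def)

definition mass :: "'z set \<Rightarrow> real" where
  "mass U = (SUP f\<in>unit_ball_on U. norm (\<Phi> f))"

lemma bdd_above_unit_ball_on: "bdd_above ((\<lambda>f. norm (\<Phi> f)) ` unit_ball_on U)"
  using \<Phi>_bound[where b = 1] by (intro bdd_aboveI2[where M = B]) (auto simp: unit_ball_on_def)

lemma mass_upper: "f \<in> unit_ball_on U \<Longrightarrow> norm (\<Phi> f) \<le> mass U"
  unfolding mass_def by (rule cSUP_upper[OF _ bdd_above_unit_ball_on])

lemma mass_least: "(\<And>f. f \<in> unit_ball_on U \<Longrightarrow> norm (\<Phi> f) \<le> c) \<Longrightarrow> mass U \<le> c"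
  unfolding mass_def using zero_in_unit_ball_on by (intro cSUP_least) auto

lemma mass_nonneg: "0 \<le> mass U"
  using mass_upper[OF zero_in_unit_ball_on, of U] by (simp add: \<Phi>_zero)

lemma mass_mono: "U \<subseteq> V \<Longrightarrow> mass U \<le> mass V"
  using unit_ball_on_mono mass_upper by (intro mass_least) blast

lemma mass_le_B: "mass U \<le> B"
  using \<Phi>_bound[where b = 1] by (intro mass_least) (auto simp: unit_ball_on_def)

lemma mass_empty: "mass {} = 0"
proof (rule antisym[OF mass_least mass_nonneg])
  fix f assume "f \<in> unit_ball_on {}"
  then have "f = (\<lambda>_. 0)"
    by (auto dest: unit_ball_onD(3))
  then show "norm (\<Phi> f) \<le> 0" by (simp add: \<Phi>_zero)
qed

lemma norm_\<Phi>_le_mass: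
  assumes f: "C0_fun f" and le: "\<And>z. norm (f z) \<le> b" and supp: "\<And>z. z \<notin> U \<Longrightarrow> f z = 0"
  shows "norm (\<Phi> f) \<le> b * mass U"
proof -
  have "b \<ge> 0" using order_trans[OF norm_ge_zero le] .
  show ?thesis
  proof (cases "b = 0")
    case True
    then have "f = (\<lambda>_. 0)" using le by auto
    then show ?thesis using True by (simp add: \<Phi>_zero)
  next
    case False
    then have "b > 0" using \<open>b \<ge> 0\<close> by simp
    have "(\<lambda>z. (1 / b) *\<^sub>R f z) \<in> unit_ball_on U"
      using C0_fun_scaleR[OF f, of "\<lambda>_. 1 / b" "\<bar>1 / b\<bar>"] le supp \<open>b > 0\<close>
      by (auto simp: unit_ball_on_def field_simps)
    from mass_upper[OF this] show ?thesis
      using \<open>b > 0\<close> by (simp add: \<Phi>_scaleR[OF f] norm_mult norm_divide field_simps)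
  qed
qed

text \<open>What truncation discards is \<open>clip a (f z)\<close>, which has norm at most
  \<open>a\<close> and vanishes wherever \<open>f\<close> does.\<close>

lemma norm_\<Phi>_truncate_le:
  assumes f: "C0_fun f" and "a > 0" and supp: "\<And>z. z \<notin> U \<Longrightarrow> f z = 0"
  shows "norm (\<Phi> f - \<Phi> (\<lambda>z. f z - clip a (f z))) \<le> a * mass U"
proof -
  have "norm (\<Phi> (\<lambda>z. clip a (f z))) \<le> a * mass U"
    using assms by (intro norm_\<Phi>_le_mass C0_fun_clip norm_clip_le) (auto simp: clip_def)
  then show ?thesis
    using assms(1,2) by (simp add: \<Phi>_diff C0_fun_clip)
qed

text \<open>The set where \<open>norm f\<close> is at least \<open>\<epsilon>\<close> is compact
  because \<open>f\<close> vanishes at infinity. Subtracting the truncation makes \<open>f\<close>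
  vanish off this set exactly, without a cutoff function.\<close>

lemma unit_ball_on_compact_approx:
  assumes f: "f \<in> unit_ball_on U" and "\<epsilon> > 0"
  obtains K f' where "compact K" "K \<subseteq> U" "f' \<in> unit_ball_on K" "norm (\<Phi> f - \<Phi> f') \<le> \<epsilon> * B"
proof
  define f' where "f' z = f z - clip \<epsilon> (f z)" for z
  note f_props = unit_ball_onD[OF f]
  show "compact {z. \<epsilon> \<le> norm (f z)}"
    using f_props(1) \<open>\<epsilon> > 0\<close> by (simp add: C0_fun_def)
  show "{z. \<epsilon> \<le> norm (f z)} \<subseteq> U"
    using f_props(3) \<open>\<epsilon> > 0\<close> by force
  show "f' \<in> unit_ball_on {z. \<epsilon> \<le> norm (f z)}"
    unfolding unit_ball_on_def f'_def using f_props(1,2) \<open>\<epsilon> > 0\<close>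
    by (auto intro!: C0_fun_diff C0_fun_clip order_trans[OF norm_diff_clip_le] simp: clip_eq)
  have "norm (\<Phi> f - \<Phi> f') \<le> \<epsilon> * mass UNIV"
    unfolding f'_def by (rule norm_\<Phi>_truncate_le[OF f_props(1) \<open>\<epsilon> > 0\<close>]) simp
  also have "\<dots> \<le> \<epsilon> * B"
    using \<open>\<epsilon> > 0\<close> mass_le_B by (intro mult_left_mono) auto
  finally show "norm (\<Phi> f - \<Phi> f') \<le> \<epsilon> * B" .
qed

lemma mass_compact_approx:
  assumes "c < mass U"
  obtains K f where "compact K" "K \<subseteq> U" "f \<in> unit_ball_on K" "c < norm (\<Phi> f)"
proof -
  obtain f where f: "f \<in> unit_ball_on U" "c < norm (\<Phi> f)"
    using assms mass_least[of U c] by (meson not_le)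
  \<comment> \<open>The loss \<open>\<epsilon> * B\<close> must stay below the gap; adding 1 to the
    denominator covers \<open>B = 0\<close>.\<close>
  define \<epsilon> where "\<epsilon> = (norm (\<Phi> f) - c) / (B + 1)"
  have "\<epsilon> > 0" "\<epsilon> * B < norm (\<Phi> f) - c"
    using f(2) B_nonneg by (auto simp: \<epsilon>_def field_simps)
  obtain K f' where "compact K" "K \<subseteq> U" "f' \<in> unit_ball_on K" "norm (\<Phi> f - \<Phi> f') \<le> \<epsilon> * B"
    using unit_ball_on_compact_approx[OF f(1) \<open>\<epsilon> > 0\<close>] by blast
  moreover from this have "c < norm (\<Phi> f')"
    using \<open>\<epsilon> * B < norm (\<Phi> f) - c\<close> norm_triangle_ineq2[of "\<Phi> f" "\<Phi> f'"] by linarith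
  ultimately show thesis using that by blast
qed

text \<open>A nearly extremal \<open>f\<close> that vanishes off a compact \<open>K\<close> is split
  by a cutoff function \<open>g\<close> for \<open>K - V\<close> in \<open>U\<close>. The part with
  factor \<open>1 - g\<close> vanishes off \<open>V\<close>, because \<open>g\<close> is 1 on
  \<open>K - V\<close> and \<open>f\<close> is 0 off \<open>K\<close>.\<close>

lemma mass_Un_le:
  assumes "open U" "open V"
  shows "mass (U \<union> V) \<le> mass U + mass V"
proof (rule ccontr)
  assume "\<not> ?thesis"
  then obtain K f where K: "compact K" "K \<subseteq> U \<union> V" and f: "f \<in> unit_ball_on K"
    and less: "mass U + mass V < norm (\<Phi> f)"
    by (meson mass_compact_approx not_le)
  note f_props = unit_ball_onD[OF f]
  have "compact (K - V)" "K - V \<subseteq> U"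
    using K assms by (auto intro: compact_diff)
  then obtain g where g: "cutoff (K - V) U g"
    using ex_cutoff[OF locally_compact _ assms(1)] by blast
  then have g': "continuous_on UNIV g" "\<And>z. 0 \<le> g z" "\<And>z. g z \<le> 1" "\<And>z. z \<in> K - V \<Longrightarrow> g z = 1"
    "\<And>z. z \<notin> U \<Longrightarrow> g z = 0"
    by (auto simp: cutoff_def)
  have abs: "\<bar>g z\<bar> \<le> 1" "\<bar>1 - g z\<bar> \<le> 1" for z
    using g'(2,3)[of z] by auto
  have C0: "C0_fun (\<lambda>z. g z *\<^sub>R f z)" "C0_fun (\<lambda>z. (1 - g z) *\<^sub>R f z)"
    using f_props(1) g'(1) abs by (auto intro!: C0_fun_scaleR[where C = 1] continuous_intros)
  have le: "norm (h *\<^sub>R f z) \<le> 1" if "\<bar>h\<bar> \<le> 1" for h z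
    using mult_mono[OF that f_props(2)[of z]] by simp
  have zero': "g z *\<^sub>R f z = 0" if "z \<notin> U" for z
    using g'(5) that by simp
  have zero: "(1 - g z) *\<^sub>R f z = 0" if "z \<notin> V" for z
    using f_props(3)[of z] g'(4)[of z] that by (cases "z \<in> K") auto
  have "(\<lambda>z. g z *\<^sub>R f z) \<in> unit_ball_on U" "(\<lambda>z. (1 - g z) *\<^sub>R f z) \<in> unit_ball_on V"
    unfolding unit_ball_on_def mem_Collect_eq using C0 le abs zero zero' by blast+
  then have "norm (\<Phi> (\<lambda>z. g z *\<^sub>R f z)) + norm (\<Phi> (\<lambda>z. (1 - g z) *\<^sub>R f z)) \<le> mass U + mass V"
    by (intro add_mono mass_upper)
  moreover have "\<Phi> f = \<Phi> (\<lambda>z. g z *\<^sub>R f z) + \<Phi> (\<lambda>z. (1 - g z) *\<^sub>R f z)"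
    using \<Phi>_add[OF C0] by (simp flip: scaleR_left_distrib)
  ultimately show False
    using less norm_triangle_ineq[of "\<Phi> (\<lambda>z. g z *\<^sub>R f z)" "\<Phi> (\<lambda>z. (1 - g z) *\<^sub>R f z)"] by simp
qed

lemma mass_UN_le_sum:
  "finite I \<Longrightarrow> (\<And>i. i \<in> I \<Longrightarrow> open (U i)) \<Longrightarrow> mass (\<Union>i\<in>I. U i) \<le> (\<Sum>i\<in>I. mass (U i))"
proof (induction I rule: finite_induct)
  case (insert i I)
  have "mass (\<Union>j\<in>insert i I. U j) \<le> mass (U i) + mass (\<Union>j\<in>I. U j)"
    using insert.prems mass_Un_le[of "U i" "\<Union>j\<in>I. U j"] by auto
  then show ?case using insert by fastforce
qed (simp add: mass_empty)

text \<open>A nearly extremal function may be taken to vanish off a compact set, and compactness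
  reduces the countable cover to a finite one.\<close>

lemma mass_UN_le_suminf:
  fixes U :: "nat \<Rightarrow> 'z set"
  assumes "\<And>n. open (U n)"
  shows "ennreal (mass (\<Union>n. U n)) \<le> (\<Sum>n. ennreal (mass (U n)))"
proof (rule ccontr)
  assume "\<not> ?thesis"
  then have "(\<Sum>n. ennreal (mass (U n))) < ennreal (mass (\<Union>n. U n))" by simp
  then obtain s where s: "(\<Sum>n. ennreal (mass (U n))) = ennreal s" "s \<ge> 0"
    by (cases "\<Sum>n. ennreal (mass (U n))") (auto simp: top_unique)
  with \<open>\<not> ?thesis\<close> have "s < mass (\<Union>n. U n)"
    by (auto simp: not_le intro: ennreal_leI)
  then obtain K f where K: "compact K" "K \<subseteq> (\<Union>n. U n)" and f: "f \<in> unit_ball_on K" "s < norm (\<Phi> f)"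
    by (rule mass_compact_approx)
  obtain D where D: "finite D" "K \<subseteq> (\<Union>n\<in>D. U n)"
    by (rule compactE_image[OF K(1), of UNIV U]) (use K(2) assms in auto)
  have "norm (\<Phi> f) \<le> mass (\<Union>n\<in>D. U n)"
    using f(1) unit_ball_on_mono[OF D(2)] by (intro mass_upper) blast
  also have "\<dots> \<le> (\<Sum>n\<in>D. mass (U n))"
    using D(1) assms by (rule mass_UN_le_sum)
  finally have "ennreal (norm (\<Phi> f)) \<le> (\<Sum>n\<in>D. ennreal (mass (U n)))"
    by (simp add: sum_ennreal mass_nonneg ennreal_leI)
  also have "\<dots> \<le> (\<Sum>n. ennreal (mass (U n)))"
    by (rule sum_le_suminf) (use D(1) in auto)
  finally show False
    using f(2) s by (simp add: ennreal_le_iff2)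
qed

text \<open>Unimodular factors turn both values into nonnegative reals, so that their norms add up;
  disjointness keeps the sum of the rotated functions in the unit ball. The applications pair a
  compact set with an open one.\<close>

lemma mass_disjoint:
  assumes "U \<inter> V = {}" and f: "f \<in> unit_ball_on U" and g: "g \<in> unit_ball_on V"
  shows "norm (\<Phi> f) + norm (\<Phi> g) \<le> mass (U \<union> V)"
proof -
  obtain c d where c: "norm c = 1" "c * \<Phi> f = of_real (norm (\<Phi> f))"
    and d: "norm d = 1" "d * \<Phi> g = of_real (norm (\<Phi> g))"
    using ex_unimodular_mult_eq_norm by metis
  note f_props = unit_ball_onD[OF f] and g_props = unit_ball_onD[OF g]
  have C0: "C0_fun (\<lambda>z. scale c (f z))" "C0_fun (\<lambda>z. scale d (g z))"
    using f_props(1) g_props(1) by (auto intro: C0_fun_scale)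
  have "norm (scale c (f z) + scale d (g z)) \<le> 1" for z
  proof (cases "z \<in> U")
    case True
    then have "g z = 0" using assms(1) g_props(3) by blast
    then show ?thesis using f_props(2)[of z] by (simp add: norm_scale c(1))
  next
    case False
    then show ?thesis using f_props(3) g_props(2)[of z] by (simp add: norm_scale d(1))
  qed
  then have "(\<lambda>z. scale c (f z) + scale d (g z)) \<in> unit_ball_on (U \<union> V)"
    using C0 f_props(3) g_props(3) by (auto simp: unit_ball_on_def intro: C0_fun_add)
  from mass_upper[OF this] show ?thesis
    using f_props(1) g_props(1) c(2) d(2)
    by (simp add: \<Phi>_add C0 \<Phi>_scale flip: of_real_add)
qed

section \<open>Extension of the mass to a Borel measure\<close>

definition outer :: "'z set \<Rightarrow> ennreal" where
  "outer A = (INF U\<in>{U. open U \<and> A \<subseteq> U}. ennreal (mass U))"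

lemma outer_le: "open U \<Longrightarrow> A \<subseteq> U \<Longrightarrow> outer A \<le> ennreal (mass U)"
  unfolding outer_def by (rule INF_lower) simp

lemma outer_greatest: "(\<And>U. open U \<Longrightarrow> A \<subseteq> U \<Longrightarrow> c \<le> ennreal (mass U)) \<Longrightarrow> c \<le> outer A"
  unfolding outer_def by (rule INF_greatest) simp

lemma outer_open: "open U \<Longrightarrow> outer U = ennreal (mass U)"
  by (intro antisym outer_le outer_greatest) (auto intro: ennreal_leI mass_mono)

lemma outer_mono: "A \<subseteq> A' \<Longrightarrow> outer A \<le> outer A'"
  by (intro outer_greatest outer_le) auto

lemma outer_less_top: "outer A < top"
  using outer_le[of UNIV A] by (simp add: ennreal_less_top le_less_trans)

lemma outer_neq_top [simp]: "outer A \<noteq> top"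
  using outer_less_top[of A] by simp

lemma outer_measure_space_outer: "outer_measure_space (Pow UNIV) outer"
  unfolding outer_measure_space_def
proof (intro conjI)
  show "positive (Pow UNIV) outer"
    using outer_open[of "{}"] by (simp add: positive_def mass_empty)
  show "increasing (Pow UNIV) outer"
    by (simp add: increasing_def outer_mono)
  show "countably_subadditive (Pow UNIV) outer"
    unfolding countably_subadditive_def
  proof (intro allI impI)
    fix A :: "nat \<Rightarrow> 'z set"
    show "outer (\<Union>n. A n) \<le> (\<Sum>n. outer (A n))"
    proof (rule ennreal_le_epsilon)
      fix e :: real assume "e > 0"
      have "\<exists>U. open U \<and> A n \<subseteq> U \<and> ennreal (mass U) < outer (A n) + ennreal (e * (1 / 2) ^ Suc n)" for n
      proof -
        have "outer (A n) < outer (A n) + ennreal (e * (1 / 2) ^ Suc n)"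
          using \<open>e > 0\<close> by simp
        then show ?thesis
          unfolding outer_def[of "A n"] by (auto simp: INF_less_iff)
      qed
      then obtain U where U: "\<And>n. open (U n)" "\<And>n. A n \<subseteq> U n"
        "\<And>n. ennreal (mass (U n)) < outer (A n) + ennreal (e * (1 / 2) ^ Suc n)"
        by metis
      have "outer (\<Union>n. A n) \<le> ennreal (mass (\<Union>n. U n))"
        using U by (intro outer_le) auto
      also have "\<dots> \<le> (\<Sum>n. ennreal (mass (U n)))"
        using U by (intro mass_UN_le_suminf)
      also have "\<dots> \<le> (\<Sum>n. outer (A n) + ennreal (e * (1 / 2) ^ Suc n))"
        using U(3) by (intro suminf_le) (auto intro: less_imp_le)
      also have "\<dots> = (\<Sum>n. outer (A n)) + (\<Sum>n. ennreal (e * (1 / 2) ^ Suc n))"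
        by (intro suminf_add[symmetric]) auto
      also have "(\<lambda>n. e * (1 / 2) ^ Suc n) sums e"
        using sums_mult[OF power_half_series, of e] by simp
      then have "(\<Sum>n. ennreal (e * (1 / 2) ^ Suc n)) = ennreal e"
        using \<open>e > 0\<close> by (intro suminf_ennreal_eq) auto
      finally show "outer (\<Union>n. A n) \<le> (\<Sum>n. outer (A n)) + ennreal e" .
    qed
  qed
qed

text \<open>This is Caratheodory's criterion for \<open>U\<close>, tested on an open set.
  \<open>V - U\<close> may fail to be open and is enlarged to the open set \<open>V - K\<close>,
  where some nearly extremal function for \<open>U \<inter> V\<close> vanishes off the compact
  \<open>K\<close>; superadditivity then applies to \<open>K\<close> and
  \<open>V - K\<close>.\<close>

lemma outer_Int_Diff_le:
  assumes "open U" "open V"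
  shows "ennreal (mass (U \<inter> V)) + outer (V - U) \<le> ennreal (mass V)"
proof (rule ccontr)
  obtain s where s: "outer (V - U) = ennreal s" "s \<ge> 0"
    using outer_less_top[of "V - U"] by (cases "outer (V - U)") auto
  assume "\<not> ?thesis"
  then have "mass V - s < mass (U \<inter> V)"
    using s mass_nonneg by (simp add: not_le ennreal_less_iff flip: ennreal_plus)
  then obtain K f where K: "compact K" "K \<subseteq> U \<inter> V" and f: "f \<in> unit_ball_on K"
    and less: "mass V - s < norm (\<Phi> f)"
    by (rule mass_compact_approx)
  have "open (V - K)"
    using assms K(1) by (simp add: open_Diff compact_imp_closed)
  then have "outer (V - U) \<le> ennreal (mass (V - K))"
    using K(2) by (intro outer_le) auto
  then have "s \<le> mass (V - K)"
    using s mass_nonneg by (simp add: ennreal_le_iff)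
  also have "\<dots> \<le> mass V - norm (\<Phi> f)"
  proof (rule mass_least)
    fix g assume "g \<in> unit_ball_on (V - K)"
    then have "norm (\<Phi> f) + norm (\<Phi> g) \<le> mass (K \<union> (V - K))"
      using f by (intro mass_disjoint) auto
    also have "\<dots> \<le> mass V"
      using K(2) by (intro mass_mono) auto
    finally show "norm (\<Phi> g) \<le> mass V - norm (\<Phi> f)" by simp
  qed
  finally show False using less by simp
qed

lemma open_in_lambda_system:
  assumes "open U"
  shows "U \<in> lambda_system UNIV (Pow UNIV) outer"
proof -
  have "outer (U \<inter> X) + outer ((UNIV - U) \<inter> X) = outer X" for X
  proof (rule antisym)
    show "outer (U \<inter> X) + outer ((UNIV - U) \<inter> X) \<le> outer X"
    proof (rule outer_greatest)
      fix V assume V: "open V" "X \<subseteq> V"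
      have "outer (U \<inter> X) + outer ((UNIV - U) \<inter> X) \<le> ennreal (mass (U \<inter> V)) + outer (V - U)"
        using V assms by (intro add_mono outer_le outer_mono) auto
      also have "\<dots> \<le> ennreal (mass V)"
        using assms V(1) by (rule outer_Int_Diff_le)
      finally show "outer (U \<inter> X) + outer ((UNIV - U) \<inter> X) \<le> ennreal (mass V)" .
    qed
    interpret Pow: sigma_algebra UNIV "Pow UNIV :: 'z set set"
      by (rule sigma_algebra_Pow)
    have "subadditive (Pow UNIV) outer"
      using outer_measure_space_outer
      unfolding outer_measure_space_def by (blast intro: Pow.countably_subadditive_subadditive)
    then have "outer ((U \<inter> X) \<union> ((UNIV - U) \<inter> X)) \<le> outer (U \<inter> X) + outer ((UNIV - U) \<inter> X)"
      unfolding subadditive_def by (elim ballE allE impE) auto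
    moreover have "(U \<inter> X) \<union> ((UNIV - U) \<inter> X) = X" by blast
    ultimately show "outer X \<le> outer (U \<inter> X) + outer ((UNIV - U) \<inter> X)"
      by simp
  qed
  then show ?thesis by (simp add: lambda_system_def)
qed

definition variation :: "'z measure" where
  "variation = measure_of UNIV (sets borel) outer"

lemma sets_variation [measurable_cong]: "sets variation = sets borel"
  using sets.sigma_sets_eq[of "borel :: 'z measure"]
  by (simp add: variation_def sets_measure_of_conv)

lemma space_variation: "space variation = UNIV"
  by (simp add: variation_def space_measure_of_conv)

lemma emeasure_variation: "A \<in> sets borel \<Longrightarrow> emeasure variation A = outer A"
proof (rule emeasure_measure_of[OF variation_def])
  have "measure_space UNIV (lambda_system UNIV (Pow UNIV) outer) outer"
    by (rule sigma_algebra.caratheodory_lemma[OF sigma_algebra_Pow outer_measure_space_outer])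
  moreover have "sets borel \<subseteq> lambda_system UNIV (Pow UNIV) outer"
    using sigma_algebra.sigma_sets_subset[of UNIV "lambda_system UNIV (Pow UNIV) outer" "{U. open U}"]
      open_in_lambda_system calculation
    by (auto simp: sets_borel measure_space_def)
  moreover have "sigma_algebra UNIV (sets (borel :: 'z measure))"
    using sets.sigma_algebra_axioms[of "borel :: 'z measure"] by simp
  ultimately have "measure_space UNIV (sets borel) outer"
    using measure_down by blast
  then show "positive (sets variation) outer" "countably_additive (sets variation) outer"
    by (auto simp: measure_space_def sets_variation)
qed (auto simp: sets_variation)

end

sublocale C0_functional \<subseteq> variation: finite_measure variation
  by standard (simp add: emeasure_variation space_variation )

context C0_functional
begin

lemma measure_variation_open: "open U \<Longrightarrow> measure variation U = mass U"
  by (simp add: measure_def emeasure_variation outer_open mass_nonneg)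

lemma norm_\<Phi>_le_variation:
  assumes "C0_fun f" "\<And>z. norm (f z) \<le> b" "\<And>z. z \<notin> U \<Longrightarrow> f z = 0" "U \<subseteq> A" "open U" "A \<in> sets borel"
  shows "norm (\<Phi> f) \<le> b * measure variation A"
proof -
  have "norm (\<Phi> f) \<le> b * measure variation U"
    using norm_\<Phi>_le_mass[OF assms(1-3)] assms(5) by (simp add: measure_variation_open)
  also have "\<dots> \<le> b * measure variation A"
    using assms(4-6) order_trans[OF norm_ge_zero assms(2)]
    by (intro mult_left_mono variation.finite_measure_mono) (auto simp: sets_variation)
  finally show ?thesis .
qed

section \<open>Regularity of the variation measure\<close>

lemma variation_outer_regular:
  assumes A: "A \<in> sets borel" and "\<epsilon> > 0"
  obtains U where "open U" "A \<subseteq> U" "measure variation (U - A) < \<epsilon>"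
proof -
  have "outer A < outer A + ennreal \<epsilon>"
    using \<open>\<epsilon> > 0\<close> by simp
  then obtain U where U: "open U" "A \<subseteq> U" "ennreal (mass U) < outer A + ennreal \<epsilon>"
    unfolding outer_def[of A] by (auto simp: INF_less_iff)
  have "ennreal (measure variation U) < ennreal (measure variation A) + ennreal \<epsilon>"
    using U(3) A by (simp add: measure_variation_open[OF U(1)] variation.emeasure_eq_measure
        flip: emeasure_variation)
  then have "measure variation U < measure variation A + \<epsilon>"
    using \<open>\<epsilon> > 0\<close> by (simp add: ennreal_less_iff flip: ennreal_plus)
  moreover have "measure variation (U - A) = measure variation U - measure variation A"
    using U A by (intro variation.finite_measure_Diff) (auto simp: sets_variation)
  ultimately show thesis using U that by auto
qed

text \<open>A nearly extremal function vanishing off a compact \<open>K\<close> uses up almost the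
  whole mass, so superadditivity leaves little for functions vanishing on \<open>K\<close>.\<close>

lemma variation_tight:
  assumes "\<epsilon> > 0"
  obtains K where "compact K" "measure variation (- K) < \<epsilon>"
proof -
  have "mass UNIV - \<epsilon> < mass UNIV" using assms by simp
  then obtain K f where K: "compact K" and f: "f \<in> unit_ball_on K" "mass UNIV - \<epsilon> < norm (\<Phi> f)"
    by (rule mass_compact_approx)
  have "mass (- K) \<le> mass UNIV - norm (\<Phi> f)"
  proof (rule mass_least)
    fix g assume "g \<in> unit_ball_on (- K)"
    then show "norm (\<Phi> g) \<le> mass UNIV - norm (\<Phi> f)"
      using mass_disjoint[OF _ f(1), of "- K" g] by simp
  qed
  then have "measure variation (- K) < \<epsilon>"
    using f(2) K by (simp add: measure_variation_open open_Compl compact_imp_closed)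
  with K show thesis by (rule that)
qed

text \<open>Outer regularity of the complement approximates \<open>A\<close> from inside by a closed
  set; intersecting it with a compact set that carries almost all of the variation makes it
  compact.\<close>

lemma variation_regular:
  assumes A: "A \<in> sets borel" and "\<epsilon> > 0"
  obtains K U where "compact K" "open U" "K \<subseteq> A" "A \<subseteq> U" "measure variation (U - K) < \<epsilon>"
proof -
  have e: "\<epsilon> / 3 > 0" using \<open>\<epsilon> > 0\<close> by simp
  obtain U where U: "open U" "A \<subseteq> U" "measure variation (U - A) < \<epsilon> / 3"
    using variation_outer_regular[OF A e] .
  have "- A \<in> sets borel" using A by (simp add: borel_comp)
  then obtain W where W: "open W" "- A \<subseteq> W" "measure variation (W - - A) < \<epsilon> / 3"
    using variation_outer_regular[OF _ e] by blast
  obtain L where L: "compact L" "measure variation (- L) < \<epsilon> / 3"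
    using variation_tight[OF e] .
  have "compact (L - W)" using L(1) W(1) by (rule compact_diff)
  moreover have "L - W \<subseteq> A" using W(2) by blast
  moreover have "measure variation (U - (L - W)) < \<epsilon>"
  proof -
    have sets: "U - A \<in> sets borel" "W - - A \<in> sets borel" "- L \<in> sets borel"
      using A U(1) W(1) L(1) by (auto intro: borel_comp simp: borel_compact)
    have "measure variation (U - (L - W)) \<le> measure variation ((U - A) \<union> (W - - A) \<union> - L)"
      using sets by (intro variation.finite_measure_mono) (auto simp: sets_variation)
    also have "\<dots> \<le> measure variation (U - A) + measure variation (W - - A) + measure variation (- L)"
      using sets by (intro order_trans[OF measure_Un_le] add_right_mono measure_Un_le)
        (auto simp: sets_variation)
    finally show ?thesis using U(3) W(3) L(2) by simp
  qed
  ultimately show thesis using U that by blast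
qed

end

section \<open>The representing measure of a functional\<close>

text \<open>The value at \<open>A\<close> of the representing measure is the limit of \<open>\<Phi> (g x)\<close> as the cutoff
  functions \<open>g\<close> approach the indicator function of \<open>A\<close>.  The variation measure is needed only for the
  existence of this limit, so that its linearity in \<open>\<Phi>\<close> is visible.\<close>

definition cutoff_limit ::
    "(('z::topological_space \<Rightarrow> 'e::real_normed_vector) \<Rightarrow> 'k::real_normed_vector) \<Rightarrow> 'z set \<Rightarrow> 'e \<Rightarrow> 'k \<Rightarrow> bool" where
  "cutoff_limit \<Phi> A x c \<longleftrightarrow>
     (\<forall>\<epsilon>>0. \<exists>K U. compact K \<and> open U \<and> K \<subseteq> A \<and> A \<subseteq> U \<and>
        (\<forall>g. cutoff K U g \<longrightarrow> norm (\<Phi> (\<lambda>z. g z *\<^sub>R x) - c) \<le> \<epsilon>))"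

text \<open>Two pairs around \<open>A\<close> are refined by \<open>K \<union> L\<close> and
  \<open>U \<inter> V\<close>, and local compactness supplies a cutoff function for the refinement,
  to which both bounds apply.\<close>

lemma cutoff_limit_unique:
  fixes A :: "'z::t2_space set"
  assumes lc: "locally_compact_space (euclidean :: 'z topology)"
    and c: "cutoff_limit \<Phi> A x c" and d: "cutoff_limit \<Phi> A x d"
  shows "c = d"
proof -
  have "norm (c - d) \<le> 0 + \<epsilon> * 2" if "\<epsilon> > 0" for \<epsilon>
  proof -
    obtain K U where K: "compact K" "open U" "K \<subseteq> A" "A \<subseteq> U"
      and c': "\<And>g. cutoff K U g \<Longrightarrow> norm (\<Phi> (\<lambda>z. g z *\<^sub>R x) - c) \<le> \<epsilon>"
      using c \<open>\<epsilon> > 0\<close> unfolding cutoff_limit_def by metis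
    obtain L V where L: "compact L" "open V" "L \<subseteq> A" "A \<subseteq> V"
      and d': "\<And>g. cutoff L V g \<Longrightarrow> norm (\<Phi> (\<lambda>z. g z *\<^sub>R x) - d) \<le> \<epsilon>"
      using d \<open>\<epsilon> > 0\<close> unfolding cutoff_limit_def by metis
    have "compact (K \<union> L)" "open (U \<inter> V)" "K \<union> L \<subseteq> U \<inter> V"
      using K L by auto
    then obtain g where "cutoff (K \<union> L) (U \<inter> V) g"
      using ex_cutoff[OF lc] by blast
    then have "cutoff K U g" "cutoff L V g"
      by (auto elim: cutoff_mono)
    then have "norm (\<Phi> (\<lambda>z. g z *\<^sub>R x) - d - (\<Phi> (\<lambda>z. g z *\<^sub>R x) - c)) \<le> \<epsilon> + \<epsilon>"
      by (intro order_trans[OF norm_triangle_ineq4] add_mono[OF d' c'])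
    then show ?thesis by simp
  qed
  then have "norm (c - d) \<le> 0" by (rule le_of_le_add_mult_epsilon)
  then show ?thesis by simp
qed

text \<open>Functionals and vectors vary together, so that additivity in the vector and additivity
  in the functional are both instances.\<close>

lemma cutoff_limit_add:
  assumes c: "cutoff_limit \<Phi> A x c" and d: "cutoff_limit \<Psi> A y d"
    and eq: "\<And>g. cutoff {} UNIV g \<Longrightarrow> \<Xi> (\<lambda>z. g z *\<^sub>R w) = \<Phi> (\<lambda>z. g z *\<^sub>R x) + \<Psi> (\<lambda>z. g z *\<^sub>R y)"
  shows "cutoff_limit \<Xi> A w (c + d)"
  unfolding cutoff_limit_def
proof (intro allI impI)
  fix \<epsilon> :: real assume "\<epsilon> > 0"
  then have \<epsilon>: "\<epsilon> / 2 > 0" by simp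
  obtain K U where K: "compact K" "open U" "K \<subseteq> A" "A \<subseteq> U"
    and c': "\<And>g. cutoff K U g \<Longrightarrow> norm (\<Phi> (\<lambda>z. g z *\<^sub>R x) - c) \<le> \<epsilon> / 2"
    using c \<epsilon> unfolding cutoff_limit_def by metis
  obtain L V where L: "compact L" "open V" "L \<subseteq> A" "A \<subseteq> V"
    and d': "\<And>g. cutoff L V g \<Longrightarrow> norm (\<Psi> (\<lambda>z. g z *\<^sub>R y) - d) \<le> \<epsilon> / 2"
    using d \<epsilon> unfolding cutoff_limit_def by metis
  show "\<exists>K U. compact K \<and> open U \<and> K \<subseteq> A \<and> A \<subseteq> U \<and>
      (\<forall>g. cutoff K U g \<longrightarrow> norm (\<Xi> (\<lambda>z. g z *\<^sub>R w) - (c + d)) \<le> \<epsilon>)"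
  proof (intro exI conjI allI impI)
    show "compact (K \<union> L)" "open (U \<inter> V)" "K \<union> L \<subseteq> A" "A \<subseteq> U \<inter> V"
      using K L by auto
    fix g assume g: "cutoff (K \<union> L) (U \<inter> V) g"
    then have "cutoff K U g" "cutoff L V g" "cutoff {} UNIV g"
      by (auto elim: cutoff_mono)
    then have "norm ((\<Phi> (\<lambda>z. g z *\<^sub>R x) - c) + (\<Psi> (\<lambda>z. g z *\<^sub>R y) - d)) \<le> \<epsilon> / 2 + \<epsilon> / 2"
      using c' d' by (intro order_trans[OF norm_triangle_ineq] add_mono) auto
    then show "norm (\<Xi> (\<lambda>z. g z *\<^sub>R w) - (c + d)) \<le> \<epsilon>"
      using eq[OF \<open>cutoff {} UNIV g\<close>] by (simp add: algebra_simps)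
  qed
qed

lemma mult_divide_add_one_le:
  fixes t \<epsilon> :: real
  assumes "0 \<le> t" "0 \<le> \<epsilon>"
  shows "t * (\<epsilon> / (t + 1)) \<le> \<epsilon>"
  using assms by (simp add: divide_le_eq algebra_simps)

lemma cutoff_limit_mult:
  fixes k :: "'k::real_normed_field"
  assumes c: "cutoff_limit \<Phi> A x c"
    and eq: "\<And>g. cutoff {} UNIV g \<Longrightarrow> \<Xi> (\<lambda>z. g z *\<^sub>R w) = k * \<Phi> (\<lambda>z. g z *\<^sub>R x)"
  shows "cutoff_limit \<Xi> A w (k * c)"
  unfolding cutoff_limit_def
proof (intro allI impI)
  fix \<epsilon> :: real assume "\<epsilon> > 0"
  then have \<epsilon>: "\<epsilon> / (norm k + 1) > 0"
    by (intro divide_pos_pos add_nonneg_pos) auto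
  then obtain K U where K: "compact K" "open U" "K \<subseteq> A" "A \<subseteq> U"
    and c': "\<And>g. cutoff K U g \<Longrightarrow> norm (\<Phi> (\<lambda>z. g z *\<^sub>R x) - c) \<le> \<epsilon> / (norm k + 1)"
    using c unfolding cutoff_limit_def by metis
  have "norm (\<Xi> (\<lambda>z. g z *\<^sub>R w) - k * c) \<le> \<epsilon>" if g: "cutoff K U g" for g
  proof -
    have "norm (\<Xi> (\<lambda>z. g z *\<^sub>R w) - k * c) = norm k * norm (\<Phi> (\<lambda>z. g z *\<^sub>R x) - c)"
      using eq[OF cutoff_mono[OF g]] by (simp flip: right_diff_distrib norm_mult)
    also have "\<dots> \<le> norm k * (\<epsilon> / (norm k + 1))"
      using c'[OF g] by (intro mult_left_mono) auto
    also have "\<dots> \<le> \<epsilon>"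
      using \<open>\<epsilon> > 0\<close> by (intro mult_divide_add_one_le) auto
    finally show ?thesis .
  qed
  with K show "\<exists>K U. compact K \<and> open U \<and> K \<subseteq> A \<and> A \<subseteq> U \<and>
      (\<forall>g. cutoff K U g \<longrightarrow> norm (\<Xi> (\<lambda>z. g z *\<^sub>R w) - k * c) \<le> \<epsilon>)"
    by blast
qed

definition representing ::
    "(('z::topological_space \<Rightarrow> 'e::real_normed_vector) \<Rightarrow> 'k::real_normed_vector) \<Rightarrow> 'z set \<Rightarrow> 'e \<Rightarrow> 'k" where
  "representing \<Phi> A x = (THE c. cutoff_limit \<Phi> A x c)"

lemma representing_eqI:
  fixes A :: "'z::t2_space set"
  assumes "locally_compact_space (euclidean :: 'z topology)" "cutoff_limit \<Phi> A x c"
  shows "representing \<Phi> A x = c"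
  unfolding representing_def using assms cutoff_limit_unique by blast

text \<open>Off \<open>U - K\<close> a cutoff function is the indicator function of every set
  between \<open>K\<close> and \<open>U\<close>; this confines the errors below to sets of this
  form.\<close>

lemma cutoff_cases:
  assumes "cutoff K U g"
  obtains "z \<in> K" "g z = 1" | "z \<notin> U" "z \<notin> K" "g z = 0" | "z \<in> U - K"
  using assms unfolding cutoff_def by (metis DiffI)

section \<open>Existence of the cutoff limits\<close>

context C0_functional
begin

lemma open_Diff_compact: "open U \<Longrightarrow> compact K \<Longrightarrow> open (U - K :: 'z set)"
  by (simp add: open_Diff compact_imp_closed)

lemma borel_Diff_compact: "open U \<Longrightarrow> compact K \<Longrightarrow> U - K \<in> sets (borel :: 'z measure)"
  by (intro borel_open open_Diff_compact)

lemma variation_Un_le: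
  "A \<in> sets borel \<Longrightarrow> A' \<in> sets borel \<Longrightarrow>
    measure variation (A \<union> A') \<le> measure variation A + measure variation A'"
  by (rule measure_Un_le) (auto simp: sets_variation)

lemma variation_mono: "A \<subseteq> A' \<Longrightarrow> A' \<in> sets borel \<Longrightarrow> measure variation A \<le> measure variation A'"
  by (rule variation.finite_measure_mono) (auto simp: sets_variation)

lemma variation_le_B: "measure variation A \<le> B"
proof -
  have "measure variation A \<le> measure variation UNIV"
    by (rule variation_mono) auto
  then show ?thesis using mass_le_B[of UNIV] by (simp add: measure_variation_open)
qed

text \<open>Both pairs surround the same \<open>A\<close>, so off the open set \<open>?W\<close> the
  two functions are both 1 or both 0.\<close>

lemma norm_\<Phi>_cutoff_diff_le:
  assumes K: "compact K" "open U" "K \<subseteq> A" "A \<subseteq> U" and g: "cutoff K U g"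
    and L: "compact L" "open V" "L \<subseteq> A" "A \<subseteq> V" and h: "cutoff L V h"
  shows "norm (\<Phi> (\<lambda>z. g z *\<^sub>R x) - \<Phi> (\<lambda>z. h z *\<^sub>R x)) \<le>
    norm x * (measure variation (U - K) + measure variation (V - L))"
proof -
  let ?W = "(U - K) \<union> (V - L)"
  have "open ?W" using K L by (auto intro: open_Diff_compact)
  have "\<bar>g z - h z\<bar> \<le> 1" for z
    using g h unfolding cutoff_def by (smt (verit))
  then have "norm ((g z - h z) *\<^sub>R x) \<le> norm x" for z
    by (simp add: mult_left_le_one_le)
  moreover have "(g z - h z) *\<^sub>R x = 0" if "z \<notin> ?W" for z
    using that K L by (cases rule: cutoff_cases[OF g, of z]; cases rule: cutoff_cases[OF h, of z]) auto
  moreover have "C0_fun (\<lambda>z. (g z - h z) *\<^sub>R x)"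
    using C0_fun_diff[OF cutoff_C0_fun[OF g] cutoff_C0_fun[OF h], of x x]
    by (simp add: scaleR_left_diff_distrib)
  ultimately have "norm (\<Phi> (\<lambda>z. (g z - h z) *\<^sub>R x)) \<le> norm x * measure variation ?W"
    using \<open>open ?W\<close> by (intro norm_\<Phi>_le_variation[of _ _ ?W]) auto
  also have "\<dots> \<le> norm x * (measure variation (U - K) + measure variation (V - L))"
    using K L by (intro mult_left_mono variation_Un_le borel_Diff_compact) auto
  finally show ?thesis
    using \<Phi>_diff[OF cutoff_C0_fun[OF g] cutoff_C0_fun[OF h], of x x]
    by (simp add: scaleR_left_diff_distrib)
qed

text \<open>The limit is taken along one sequence of pairs whose differences have variation tending
  to zero; comparison of two pairs carries the bound over to every pair. As the bound is explicit in
  \<open>x\<close>, a single cutoff function can serve all vectors at once.\<close>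

lemma ex_cutoff_limit:
  assumes A: "A \<in> sets borel"
  shows "\<exists>c. \<forall>K U g. compact K \<longrightarrow> open U \<longrightarrow> K \<subseteq> A \<longrightarrow> A \<subseteq> U \<longrightarrow> cutoff K U g \<longrightarrow>
    norm (\<Phi> (\<lambda>z. g z *\<^sub>R x) - c) \<le> norm x * measure variation (U - K)"
proof -
  have "\<exists>K U g. compact K \<and> open U \<and> K \<subseteq> A \<and> A \<subseteq> U \<and> cutoff K U g \<and>
      measure variation (U - K) < 1 / real (Suc n)" for n
  proof -
    have "1 / real (Suc n) > 0" by simp
    then obtain K U where "compact K" "open U" "K \<subseteq> A" "A \<subseteq> U" "measure variation (U - K) < 1 / real (Suc n)"
      using variation_regular[OF A] by metis
    moreover from this obtain g where "cutoff K U g"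
      using ex_cutoff[OF locally_compact] by blast
    ultimately show ?thesis by blast
  qed
  then obtain K U g where K: "\<And>n. compact (K n)" "\<And>n. open (U n)" "\<And>n. K n \<subseteq> A" "\<And>n. A \<subseteq> U n"
    and g: "\<And>n. cutoff (K n) (U n) (g n)"
    and small: "\<And>n. measure variation (U n - K n) < 1 / real (Suc n)"
    by metis
  define a where "a n = \<Phi> (\<lambda>z. g n z *\<^sub>R x)" for n
  have le: "norm (\<Phi> (\<lambda>z. h z *\<^sub>R x) - a n) \<le> norm x * (measure variation (V - L) + 1 / real (Suc n))"
    if "compact L" "open V" "L \<subseteq> A" "A \<subseteq> V" "cutoff L V h" for L V h n
    unfolding a_def using small[of n]
    by (intro order_trans[OF norm_\<Phi>_cutoff_diff_le[OF that K g]] mult_left_mono add_left_mono) auto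
  have lim0: "(\<lambda>n. 1 / real (Suc n)) \<longlonglongrightarrow> 0"
    using LIMSEQ_inverse_real_of_nat by (simp add: inverse_eq_divide)
  have "Cauchy a"
  proof (rule metric_CauchyI)
    fix \<epsilon> :: real assume "\<epsilon> > 0"
    have "(\<lambda>n. norm x * (1 / real (Suc n) + 1 / real (Suc n))) \<longlonglongrightarrow> norm x * (0 + 0)"
      by (intro tendsto_intros lim0)
    then have "\<forall>\<^sub>F n in sequentially. norm x * (1 / real (Suc n) + 1 / real (Suc n)) < \<epsilon>"
      using \<open>\<epsilon> > 0\<close> by (intro order_tendstoD(2)) auto
    then obtain N where N: "norm x * (1 / real (Suc N) + 1 / real (Suc N)) < \<epsilon>"
      unfolding eventually_sequentially by blast
    have "dist (a m) (a n) < \<epsilon>" if "m \<ge> N" "n \<ge> N" for m n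
    proof -
      have "norm (a m - a n) \<le> norm x * (measure variation (U m - K m) + 1 / real (Suc n))"
        using le[OF K g, of m n] by (simp add: a_def)
      also have "\<dots> \<le> norm x * (1 / real (Suc N) + 1 / real (Suc N))"
        using that small[of m]
        by (intro mult_left_mono add_mono order_trans[OF less_imp_le[OF small[of m]]] frac_le) auto
      finally show ?thesis using N by (simp add: dist_norm)
    qed
    then show "\<exists>N. \<forall>m\<ge>N. \<forall>n\<ge>N. dist (a m) (a n) < \<epsilon>" by blast
  qed
  then obtain c where c: "a \<longlonglongrightarrow> c"
    using Cauchy_convergent convergent_def by blast
  show ?thesis
  proof (intro exI[of _ c] allI impI)
    fix L V h assume *: "compact L" "open V" "L \<subseteq> A" "A \<subseteq> V" "cutoff L V h"
    have "(\<lambda>n. norm (\<Phi> (\<lambda>z. h z *\<^sub>R x) - a n)) \<longlonglongrightarrow> norm (\<Phi> (\<lambda>z. h z *\<^sub>R x) - c)"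
      by (intro tendsto_intros c)
    moreover have "(\<lambda>n. norm x * (measure variation (V - L) + 1 / real (Suc n)))
        \<longlonglongrightarrow> norm x * (measure variation (V - L) + 0)"
      by (intro tendsto_intros lim0)
    ultimately show "norm (\<Phi> (\<lambda>z. h z *\<^sub>R x) - c) \<le> norm x * measure variation (V - L)"
      using le[OF *] by (auto intro: LIMSEQ_le)
  qed
qed

abbreviation \<nu> :: "'z set \<Rightarrow> 'e \<Rightarrow> 'k" where
  "\<nu> \<equiv> representing \<Phi>"

lemma
  assumes A: "A \<in> sets borel"
  shows cutoff_limit_\<nu>: "cutoff_limit \<Phi> A x (\<nu> A x)"
    and norm_\<Phi>_cutoff_diff_\<nu>_le: "compact K \<Longrightarrow> open U \<Longrightarrow> K \<subseteq> A \<Longrightarrow> A \<subseteq> U \<Longrightarrow> cutoff K U g \<Longrightarrow>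
      norm (\<Phi> (\<lambda>z. g z *\<^sub>R x) - \<nu> A x) \<le> norm x * measure variation (U - K)"
proof -
  obtain c where c: "\<And>K U g. compact K \<Longrightarrow> open U \<Longrightarrow> K \<subseteq> A \<Longrightarrow> A \<subseteq> U \<Longrightarrow> cutoff K U g \<Longrightarrow>
    norm (\<Phi> (\<lambda>z. g z *\<^sub>R x) - c) \<le> norm x * measure variation (U - K)"
    using ex_cutoff_limit[OF A, of x] by metis
  have "cutoff_limit \<Phi> A x c"
    unfolding cutoff_limit_def
  proof (intro allI impI)
    fix \<epsilon> :: real assume "\<epsilon> > 0"
    then have "\<epsilon> / (norm x + 1) > 0"
      by (intro divide_pos_pos add_nonneg_pos) auto
    then obtain K U where K: "compact K" "open U" "K \<subseteq> A" "A \<subseteq> U"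
      "measure variation (U - K) < \<epsilon> / (norm x + 1)"
      using variation_regular[OF A] by metis
    have "norm x * measure variation (U - K) \<le> norm x * (\<epsilon> / (norm x + 1))"
      using K(5) by (intro mult_left_mono) auto
    also have "\<dots> \<le> \<epsilon>"
      using \<open>\<epsilon> > 0\<close> by (intro mult_divide_add_one_le) auto
    finally show "\<exists>K U. compact K \<and> open U \<and> K \<subseteq> A \<and> A \<subseteq> U \<and>
        (\<forall>g. cutoff K U g \<longrightarrow> norm (\<Phi> (\<lambda>z. g z *\<^sub>R x) - c) \<le> \<epsilon>)"
      using K(1-4) c by (meson order_trans)
  qed
  moreover from this have "\<nu> A x = c"
    by (rule representing_eqI[OF locally_compact])
  ultimately show "cutoff_limit \<Phi> A x (\<nu> A x)"
    "compact K \<Longrightarrow> open U \<Longrightarrow> K \<subseteq> A \<Longrightarrow> A \<subseteq> U \<Longrightarrow> cutoff K U g \<Longrightarrow>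
      norm (\<Phi> (\<lambda>z. g z *\<^sub>R x) - \<nu> A x) \<le> norm x * measure variation (U - K)"
    using c by auto
qed

lemma variation_cutoff:
  assumes "A \<in> sets borel" "\<epsilon> > 0"
  obtains K U g where "compact K" "open U" "K \<subseteq> A" "A \<subseteq> U" "measure variation (U - K) < \<epsilon>" "cutoff K U g"
    "\<And>x. norm (\<Phi> (\<lambda>z. g z *\<^sub>R x) - \<nu> A x) \<le> \<epsilon> * norm x"
proof -
  obtain K U where K: "compact K" "open U" "K \<subseteq> A" "A \<subseteq> U" "measure variation (U - K) < \<epsilon>"
    using variation_regular[OF assms] .
  moreover from this obtain g where g: "cutoff K U g"
    using ex_cutoff[OF locally_compact] by blast
  moreover have "norm (\<Phi> (\<lambda>z. g z *\<^sub>R x) - \<nu> A x) \<le> \<epsilon> * norm x" for x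
  proof -
    have "norm (\<Phi> (\<lambda>z. g z *\<^sub>R x) - \<nu> A x) \<le> norm x * measure variation (U - K)"
      by (rule norm_\<Phi>_cutoff_diff_\<nu>_le[OF assms(1) K(1-4) g])
    also have "\<dots> \<le> norm x * \<epsilon>"
      using K(5) by (intro mult_left_mono) auto
    finally show ?thesis by (simp add: mult.commute)
  qed
  ultimately show thesis by (rule that)
qed

text \<open>Domination by the finite measure \<open>variation\<close> transfers countable
  additivity, summability and regularity to \<open>\<nu>\<close>.\<close>

lemma norm_\<nu>_le:
  assumes A: "A \<in> sets borel"
  shows "norm (\<nu> A x) \<le> norm x * measure variation A"
proof (rule le_of_le_add_mult_epsilon)
  fix \<epsilon> :: real assume "\<epsilon> > 0"
  obtain K U g where K: "compact K" "open U" "K \<subseteq> A" "A \<subseteq> U" "measure variation (U - K) < \<epsilon>"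
    and g: "cutoff K U g" and le: "norm (\<Phi> (\<lambda>z. g z *\<^sub>R x) - \<nu> A x) \<le> \<epsilon> * norm x"
    using variation_cutoff[OF A \<open>\<epsilon> > 0\<close>] by metis
  have "norm (g z *\<^sub>R x) \<le> norm x" for z
    using g by (auto simp: cutoff_def mult_left_le_one_le)
  then have "norm (\<Phi> (\<lambda>z. g z *\<^sub>R x)) \<le> norm x * measure variation U"
    using g K(2) by (intro norm_\<Phi>_le_variation cutoff_C0_fun) (auto simp: cutoff_def)
  also have "measure variation U \<le> measure variation (A \<union> (U - K))"
    using K A by (intro variation_mono sets.Un borel_Diff_compact) auto
  also have "\<dots> \<le> measure variation A + measure variation (U - K)"
    using K A by (intro variation_Un_le borel_Diff_compact) auto
  also have "\<dots> \<le> measure variation A + \<epsilon>"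
    using K(5) by simp
  finally have "norm (\<Phi> (\<lambda>z. g z *\<^sub>R x)) \<le> norm x * (measure variation A + \<epsilon>)"
    by (simp add: mult_left_mono)
  then show "norm (\<nu> A x) \<le> norm x * measure variation A + \<epsilon> * (2 * norm x)"
    using le norm_triangle_ineq2[of "\<nu> A x" "\<Phi> (\<lambda>z. g z *\<^sub>R x)"]
    by (simp add: norm_minus_commute algebra_simps)
qed

section \<open>Additivity and regularity of the representing measure\<close>

lemma \<nu>_add: "A \<in> sets borel \<Longrightarrow> \<nu> A (x + y) = \<nu> A x + \<nu> A y"
  by (intro representing_eqI[OF locally_compact] cutoff_limit_add[OF cutoff_limit_\<nu> cutoff_limit_\<nu>])
    (simp_all add: scaleR_add_right \<Phi>_add cutoff_C0_fun)

lemma \<nu>_scale: "A \<in> sets borel \<Longrightarrow> \<nu> A (scale c x) = c * \<nu> A x"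
proof (intro representing_eqI[OF locally_compact] cutoff_limit_mult[OF cutoff_limit_\<nu>])
  fix g :: "'z \<Rightarrow> real" assume "cutoff {} UNIV g"
  moreover have "g z *\<^sub>R scale c x = scale c (g z *\<^sub>R x)" for z
    by (simp add: scale_left_commute flip: scale_of_real)
  ultimately show "\<Phi> (\<lambda>z. g z *\<^sub>R scale c x) = c * \<Phi> (\<lambda>z. g z *\<^sub>R x)"
    by (simp add: \<Phi>_scale cutoff_C0_fun)
qed

text \<open>Off the three small difference sets each cutoff function is the indicator function of
  its set, so for disjoint sets \<open>g + g' - h\<close> vanishes there.\<close>

lemma \<nu>_Un:
  assumes A: "A \<in> sets borel" "A' \<in> sets borel" and disj: "A \<inter> A' = {}"
  shows "\<nu> (A \<union> A') x = \<nu> A x + \<nu> A' x"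
proof -
  \<comment> \<open>The constant is 2 * 3 + 3: the combination of cutoff functions is bounded by 2
    and lives on three sets of variation below \<open>\<epsilon>\<close>, and three values of
    \<open>\<nu>\<close> are each approximated up to \<open>\<epsilon> * norm x\<close>.\<close>
  have "norm (\<nu> A x + \<nu> A' x - \<nu> (A \<union> A') x) \<le> 0 + \<epsilon> * (9 * norm x)" if "\<epsilon> > 0" for \<epsilon>
  proof -
    obtain K U g where K: "compact K" "open U" "K \<subseteq> A" "A \<subseteq> U" "measure variation (U - K) < \<epsilon>"
      and g: "cutoff K U g" and le: "norm (\<Phi> (\<lambda>z. g z *\<^sub>R x) - \<nu> A x) \<le> \<epsilon> * norm x"
      using variation_cutoff[OF A(1) \<open>\<epsilon> > 0\<close>] by metis
    obtain K' U' g' where K': "compact K'" "open U'" "K' \<subseteq> A'" "A' \<subseteq> U'" "measure variation (U' - K') < \<epsilon>"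
      and g': "cutoff K' U' g'" and le': "norm (\<Phi> (\<lambda>z. g' z *\<^sub>R x) - \<nu> A' x) \<le> \<epsilon> * norm x"
      using variation_cutoff[OF A(2) \<open>\<epsilon> > 0\<close>] by metis
    have "A \<union> A' \<in> sets borel" using A by auto
    then obtain L V h where L: "compact L" "open V" "L \<subseteq> A \<union> A'" "A \<union> A' \<subseteq> V" "measure variation (V - L) < \<epsilon>"
      and h: "cutoff L V h" and leh: "norm (\<Phi> (\<lambda>z. h z *\<^sub>R x) - \<nu> (A \<union> A') x) \<le> \<epsilon> * norm x"
      using variation_cutoff[OF _ \<open>\<epsilon> > 0\<close>] by metis
    let ?W = "(U - K) \<union> (U' - K') \<union> (V - L)"
    have op: "open (U - K)" "open (U' - K')" "open (V - L)"
      using K K' L by (auto intro: open_Diff_compact)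
    have "\<bar>g z + g' z - h z\<bar> \<le> 2" for z
      using g g' h unfolding cutoff_def by (smt (verit))
    then have "norm ((g z + g' z - h z) *\<^sub>R x) \<le> 2 * norm x" for z
      by (simp add: mult_right_mono)
    moreover have "(g z + g' z - h z) *\<^sub>R x = 0" if "z \<notin> ?W" for z
      using that K K' L disj by (cases rule: cutoff_cases[OF g, of z]; cases rule: cutoff_cases[OF g', of z];
          cases rule: cutoff_cases[OF h, of z]) auto
    moreover have C0: "C0_fun (\<lambda>z. g z *\<^sub>R x)" "C0_fun (\<lambda>z. g' z *\<^sub>R x)" "C0_fun (\<lambda>z. h z *\<^sub>R x)"
      "C0_fun (\<lambda>z. g z *\<^sub>R x + g' z *\<^sub>R x)"
      using g g' h by (auto intro!: C0_fun_add cutoff_C0_fun)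
    ultimately have "norm (\<Phi> (\<lambda>z. g z *\<^sub>R x + g' z *\<^sub>R x - h z *\<^sub>R x)) \<le> 2 * norm x * measure variation ?W"
      using op C0_fun_diff[OF C0(4) C0(3)]
      by (intro norm_\<Phi>_le_variation[of _ _ ?W]) (auto simp: algebra_simps)
    also have "measure variation ?W \<le> measure variation (U - K) + measure variation (U' - K') + measure variation (V - L)"
      using op by (intro order_trans[OF variation_Un_le] add_right_mono variation_Un_le) auto
    also have "\<dots> \<le> 3 * \<epsilon>" using K(5) K'(5) L(5) by simp
    finally have small: "norm (\<Phi> (\<lambda>z. g z *\<^sub>R x) + \<Phi> (\<lambda>z. g' z *\<^sub>R x) - \<Phi> (\<lambda>z. h z *\<^sub>R x)) \<le> 2 * norm x * (3 * \<epsilon>)"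
      using C0 by (simp add: \<Phi>_diff \<Phi>_add mult_left_mono)
    have "\<nu> A x + \<nu> A' x - \<nu> (A \<union> A') x =
        (\<Phi> (\<lambda>z. g z *\<^sub>R x) + \<Phi> (\<lambda>z. g' z *\<^sub>R x) - \<Phi> (\<lambda>z. h z *\<^sub>R x)) - (\<Phi> (\<lambda>z. g z *\<^sub>R x) - \<nu> A x)
        - (\<Phi> (\<lambda>z. g' z *\<^sub>R x) - \<nu> A' x) + (\<Phi> (\<lambda>z. h z *\<^sub>R x) - \<nu> (A \<union> A') x)"
      by simp
    also have "norm \<dots> \<le> 2 * norm x * (3 * \<epsilon>) + \<epsilon> * norm x + \<epsilon> * norm x + \<epsilon> * norm x"
      by (intro order_trans[OF norm_triangle_ineq] order_trans[OF norm_triangle_ineq4] add_mono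
          small le le' leh)
    finally show ?thesis by (simp add: algebra_simps)
  qed
  then have "norm (\<nu> A x + \<nu> A' x - \<nu> (A \<union> A') x) \<le> 0"
    by (rule le_of_le_add_mult_epsilon)
  then show ?thesis by simp
qed

lemma \<nu>_empty: "\<nu> {} x = 0"
  using norm_\<nu>_le[of "{}" x] by simp

lemma \<nu>_UN:
  "finite I \<Longrightarrow> (\<And>i. i \<in> I \<Longrightarrow> A i \<in> sets borel) \<Longrightarrow> disjoint_family_on A I \<Longrightarrow>
    \<nu> (\<Union>i\<in>I. A i) x = (\<Sum>i\<in>I. \<nu> (A i) x)"
proof (induction I rule: finite_induct)
  case (insert i I)
  have "A i \<inter> (\<Union>j\<in>I. A j) = {}"
    using insert.prems(2) insert.hyps(2) by (auto simp: disjoint_family_on_def)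
  moreover have "disjoint_family_on A I"
    using insert.prems(2) by (auto simp: disjoint_family_on_def)
  ultimately show ?case
    using insert by (simp add: \<nu>_Un sets.finite_UN)
qed (simp add: \<nu>_empty)

lemma \<nu>_sums:
  fixes A :: "nat \<Rightarrow> 'z set"
  assumes A: "range A \<subseteq> sets borel" and disj: "disjoint_family A"
  shows "(\<lambda>n. \<nu> (A n) x) sums \<nu> (\<Union>n. A n) x"
proof -
  have A': "A n \<in> sets borel" for n using A by auto
  let ?d = "\<lambda>n. measure variation (\<Union>i. A i) - (\<Sum>i<n. measure variation (A i))"
  have "(\<lambda>n. measure variation (A n)) sums measure variation (\<Union>n. A n)"
    using A disj by (intro variation.finite_measure_UNION) (auto simp: sets_variation)
  then have "(\<lambda>n. norm x * ?d n) \<longlonglongrightarrow> norm x * (measure variation (\<Union>n. A n) - measure variation (\<Union>n. A n))"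
    unfolding sums_def by (intro tendsto_intros)
  then have lim: "(\<lambda>n. norm x * ?d n) \<longlonglongrightarrow> 0" by simp
  have "norm ((\<Sum>i<n. \<nu> (A i) x) - \<nu> (\<Union>i. A i) x) \<le> norm x * ?d n" for n
  proof -
    let ?R = "(\<Union>i. A i) - (\<Union>i<n. A i)"
    have disj': "disjoint_family_on A {..<n}"
      using disj by (auto simp: disjoint_family_on_def)
    have sets: "(\<Union>i<n. A i) \<in> sets borel" "(\<Union>i. A i) \<in> sets borel"
      using A' by auto
    have "\<nu> (\<Union>i. A i) x = \<nu> ((\<Union>i<n. A i) \<union> ?R) x"
      by (rule arg_cong[where f = "\<lambda>A. \<nu> A x"]) auto
    also have "\<dots> = \<nu> (\<Union>i<n. A i) x + \<nu> ?R x"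
      using sets by (intro \<nu>_Un) auto
    finally have "norm ((\<Sum>i<n. \<nu> (A i) x) - \<nu> (\<Union>i. A i) x) = norm (\<nu> ?R x)"
      using \<nu>_UN[of "{..<n}" A x] disj' A' by simp
    also have "\<dots> \<le> norm x * measure variation ?R"
      using sets by (intro norm_\<nu>_le) auto
    also have "measure variation ?R = measure variation (\<Union>i. A i) - measure variation (\<Union>i<n. A i)"
      using sets by (intro variation.finite_measure_Diff) (auto simp: sets_variation)
    also have "measure variation (\<Union>i<n. A i) = (\<Sum>i<n. measure variation (A i))"
      using A' disj' by (intro variation.finite_measure_finite_Union) (auto simp: sets_variation)
    finally show ?thesis .
  qed
  then have "(\<lambda>n. (\<Sum>i<n. \<nu> (A i) x) - \<nu> (\<Union>i. A i) x) \<longlonglongrightarrow> 0"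
    by (intro Lim_null_comparison[OF _ lim] always_eventually) auto
  then show ?thesis
    unfolding sums_def by (rule LIM_zero_cancel)
qed

lemma i_measure_\<nu>: "i_measure scale (*) borel \<nu>"
  unfolding i_measure_def
proof (intro conjI ballI allI impI)
  fix A :: "'z set" assume A: "A \<in> sets borel"
  have "bounded_linear (\<nu> A)"
  proof (rule bounded_linear_intro)
    show "\<nu> A (r *\<^sub>R x) = r *\<^sub>R \<nu> A x" for r x
      using \<nu>_scale[OF A, of "of_real r" x] by (simp add: scale_of_real scaleR_conv_of_real)
  qed (use A in \<open>auto intro: \<nu>_add norm_\<nu>_le\<close>)
  then show "continuous_klinear_on UNIV scale (*) (\<nu> A)"
    using A by (simp add: continuous_klinear_on_def \<nu>_add \<nu>_scale linear_continuous_on)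
next
  fix A :: "nat \<Rightarrow> 'z set" assume A: "range A \<subseteq> sets borel" "disjoint_family A"
  then show "(\<lambda>n. \<nu> (A n) x) sums \<nu> (\<Union>n. A n) x" for x by (rule \<nu>_sums)
  show "independently_convergent (\<lambda>n. \<nu> (A n))"
    unfolding independently_convergent_def
  proof (intro allI impI)
    fix x :: "nat \<Rightarrow> 'e" assume "bounded (range x)"
    then obtain b where b: "\<And>n. norm (x n) \<le> b" by (auto simp: bounded_iff)
    show "summable (\<lambda>n. \<nu> (A n) (x n))"
    proof (rule summable_comparison_test')
      have "summable (\<lambda>n. measure variation (A n))"
        using variation.finite_measure_UNION[of A] A by (auto simp: sets_variation sums_iff)
      then show "summable (\<lambda>n. b * measure variation (A n))" by (rule summable_mult)
      show "norm (\<nu> (A n) (x n)) \<le> b * measure variation (A n)" for n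
        using A b[of n] by (intro order_trans[OF norm_\<nu>_le] mult_right_mono) auto
    qed
  qed
qed

text \<open>Compact inner approximations with errors tending to zero have a union that misses only a
  set of variation zero.\<close>

lemma regular_i_measure_\<nu>: "regular_i_measure scale (*) \<nu>"
  unfolding regular_i_measure_def
proof (intro conjI ballI i_measure_\<nu>)
  fix A :: "'z set" assume A: "A \<in> sets borel"
  have "\<exists>K U. compact K \<and> open U \<and> K \<subseteq> A \<and> A \<subseteq> U \<and> measure variation (U - K) < 1 / real (Suc n)" for n
    using variation_regular[OF A, of "1 / real (Suc n)"] by (metis divide_pos_pos of_nat_0_less_iff zero_less_Suc zero_less_one)
  then obtain K U where K: "\<And>n. compact (K n)" "\<And>n. open (U n)" "\<And>n. K n \<subseteq> A" "\<And>n. A \<subseteq> U n"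
    and small: "\<And>n. measure variation (U n - K n) < 1 / real (Suc n)"
    by metis
  show "\<exists>K. sigma_compact K \<and> K \<subseteq> A \<and> (\<forall>B\<in>sets borel. B \<subseteq> A - K \<longrightarrow> (\<forall>x. \<nu> B x = 0))"
  proof (intro exI[of _ "\<Union>n. K n"] conjI ballI impI allI)
    show "sigma_compact (\<Union>n. K n)" using K(1) by (auto simp: sigma_compact_def)
    show "(\<Union>n. K n) \<subseteq> A" using K(3) by auto
    fix B x assume B: "B \<in> sets borel" "B \<subseteq> A - (\<Union>n. K n)"
    have "measure variation B \<le> 1 / real (Suc n)" for n
    proof -
      have "measure variation B \<le> measure variation (U n - K n)"
        using B K(4)[of n] K(1,2) by (intro variation_mono borel_Diff_compact) auto
      then show ?thesis using small[of n] by simp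
    qed
    then have "measure variation B \<le> 0"
      using LIMSEQ_inverse_real_of_nat by (intro LIMSEQ_le_const) (auto simp: inverse_eq_divide)
    then have "measure variation B = 0"
      using measure_nonneg by (intro antisym)
    then show "\<nu> B x = 0" using norm_\<nu>_le[OF B(1), of x] by simp
  qed
qed

text \<open>The bound is independent of the partition. It gives absolute convergence of the
  integrals of countably valued functions and later bounds the semivariation by the norm of
  \<open>T\<close>.\<close>

lemma norm_sum_\<nu>_le:
  assumes "finite I" "\<And>i. i \<in> I \<Longrightarrow> A i \<in> sets borel" "disjoint_family_on A I" "\<And>i. i \<in> I \<Longrightarrow> norm (x i) \<le> b"
    and "b \<ge> 0"
  shows "(\<Sum>i\<in>I. norm (\<nu> (A i) (x i))) \<le> b * B"
proof -
  have "(\<Sum>i\<in>I. norm (\<nu> (A i) (x i))) \<le> (\<Sum>i\<in>I. b * measure variation (A i))"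
    using assms(2,4) by (intro sum_mono order_trans[OF norm_\<nu>_le] mult_right_mono) auto
  also have "\<dots> = b * measure variation (\<Union>i\<in>I. A i)"
    using assms(1-3) by (subst variation.finite_measure_finite_Union) (auto simp: sets_variation sum_distrib_left)
  also have "\<dots> \<le> b * B"
    using assms(5) variation_le_B by (intro mult_left_mono)
  finally show ?thesis .
qed

end

section \<open>The weak* integral\<close>

lemma ex_finite_valued_selection:
  fixes f :: "'z::topological_space \<Rightarrow> 'e::real_normed_vector"
  assumes f: "continuous_on UNIV f" and D: "finite D"
  shows "\<exists>g. range g \<subseteq> insert 0 D \<and> (\<forall>y. g -` {y} \<in> sets borel) \<and>
    (\<forall>z. (\<exists>e\<in>D. norm (f z - e) < \<delta>) \<longrightarrow> norm (f z - g z) < \<delta>) \<and>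
    (\<forall>z. (\<forall>e\<in>D. \<delta> \<le> norm (f z - e)) \<longrightarrow> g z = 0)"
  using D
proof (induction D rule: finite_induct)
  case empty
  have "(\<lambda>_. 0) -` {y} \<in> sets borel" for y :: 'e
    by (cases "y = 0") (auto simp: vimage_def)
  then show ?case by (intro exI[of _ "\<lambda>_. 0"]) auto
next
  case (insert e D)
  then obtain g where g: "range g \<subseteq> insert 0 D" "\<And>y. g -` {y} \<in> sets borel"
    "\<And>z. \<exists>e\<in>D. norm (f z - e) < \<delta> \<Longrightarrow> norm (f z - g z) < \<delta>"
    "\<And>z. \<forall>e\<in>D. \<delta> \<le> norm (f z - e) \<Longrightarrow> g z = 0"
    by metis
  define S where "S = {z. norm (f z - e) < \<delta>}"
  have "open S"
    unfolding S_def using f by (intro open_Collect_less continuous_intros)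
  define h where "h z = (if z \<in> S then e else g z)" for z
  have "h -` {y} = (if y = e then S else {}) \<union> (g -` {y} - S)" for y
    by (auto simp: h_def split: if_splits)
  then have "h -` {y} \<in> sets borel" for y
    using g(2)[of y] \<open>open S\<close> by auto
  moreover have "range h \<subseteq> insert 0 (insert e D)"
    using g(1) by (auto simp: h_def)
  moreover have "norm (f z - h z) < \<delta>" if "\<exists>e'\<in>insert e D. norm (f z - e') < \<delta>" for z
    using that g(3)[of z] by (auto simp: h_def S_def)
  moreover have "h z = 0" if "\<forall>e'\<in>insert e D. \<delta> \<le> norm (f z - e')" for z
    using that g(4)[of z] by (auto simp: h_def S_def)
  ultimately show ?case by blast
qed

text \<open>Finitely many balls cover the image of the compact set where \<open>norm f\<close> is at
  least \<open>\<delta>\<close>; elsewhere the value 0 is close enough. Centres taken from the range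
  of \<open>f\<close> keep the approximation in the unit ball whenever \<open>f\<close> is, as the
  comparison with the semivariation requires.\<close>

lemma C0_fun_finite_valued_approx:
  assumes f: "C0_fun f" and "\<delta> > 0"
  obtains g where "finite (range g)" "range g \<subseteq> insert 0 (range f)" "\<And>y. g -` {y} \<in> sets borel"
    "\<And>z. norm (f z - g z) < \<delta>"
proof -
  let ?K = "{z. \<delta> \<le> norm (f z)}"
  have c: "compact (f ` ?K)"
    using f \<open>\<delta> > 0\<close> by (intro compact_continuous_image) (auto simp: C0_fun_def intro: continuous_on_subset)
  have s: "f ` ?K \<subseteq> (\<Union>e\<in>f ` ?K. ball e \<delta>)"
    using \<open>\<delta> > 0\<close> by force
  obtain D where D: "D \<subseteq> f ` ?K" "finite D" "f ` ?K \<subseteq> (\<Union>e\<in>D. ball e \<delta>)"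
    by (rule compactE_image[OF c _ s]) auto
  obtain g where g: "range g \<subseteq> insert 0 D" "\<And>y. g -` {y} \<in> sets borel"
    "\<And>z. \<exists>e\<in>D. norm (f z - e) < \<delta> \<Longrightarrow> norm (f z - g z) < \<delta>"
    "\<And>z. \<forall>e\<in>D. \<delta> \<le> norm (f z - e) \<Longrightarrow> g z = 0"
    using ex_finite_valued_selection[OF C0_fun_continuous[OF f] D(2), of \<delta>] by metis
  show thesis
  proof
    show "finite (range g)"
      using g(1) D(2) finite_subset by blast
    show "range g \<subseteq> insert 0 (range f)"
      using g(1) D(1) by blast
    show "norm (f z - g z) < \<delta>" for z
    proof (cases "\<exists>e\<in>D. norm (f z - e) < \<delta>")
      case True
      then show ?thesis by (rule g(3))
    next
      case False
      then have "z \<notin> ?K"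
        using D(3) by (force simp: dist_norm norm_minus_commute)
      then show ?thesis using g(4)[of z] False by (auto simp: not_less)
    qed
  qed (rule g(2))
qed

lemma finite_valued_in_countably_valued:
  "finite (range g) \<Longrightarrow> (\<And>y. g -` {y} \<in> sets borel) \<Longrightarrow> g \<in> countably_valued borel"
  by (simp add: countably_valued_def finite_imp_bounded countable_finite)

lemma C0_fun_uniformly_measurable:
  assumes f: "C0_fun f"
  shows "f \<in> uniformly_measurable borel"
proof -
  have "\<exists>g\<in>countably_valued borel. \<forall>z. norm (f z - g z) < 1 / real (Suc n)" for n
    using C0_fun_finite_valued_approx[OF f, of "1 / real (Suc n)"] finite_valued_in_countably_valued
    by (metis of_nat_0_less_iff zero_less_Suc zero_less_divide_1_iff)
  then obtain g where g: "\<And>n. g n \<in> countably_valued borel" "\<And>n z. norm (f z - g n z) < 1 / real (Suc n)"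
    by metis
  have "uniform_limit UNIV g f sequentially"
  proof (rule uniform_limitI)
    fix e :: real assume "e > 0"
    then have "\<forall>\<^sub>F n in sequentially. 1 / real (Suc n) < e"
      using LIMSEQ_inverse_real_of_nat by (intro order_tendstoD(2)) (auto simp: inverse_eq_divide)
    then show "\<forall>\<^sub>F n in sequentially. \<forall>z\<in>UNIV. dist (g n z) (f z) < e"
    proof eventually_elim
      case (elim n)
      then show ?case
        using g(2)[of _ n] by (metis dist_norm norm_minus_commute order_less_trans)
    qed
  qed
  with g(1) show ?thesis by (auto simp: uniformly_measurable_def)
qed

context C0_functional
begin

text \<open>The error \<open>F\<close> is truncated at the two heights \<open>\<delta>\<close> and \<open>b\<close>: it exceeds \<open>\<delta>\<close> only near the
  uncovered part of the space, and it exceeds \<open>b\<close>, where its bound grows with \<open>I\<close>, only on a set \<open>W\<close>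
  that can be made small after \<open>I\<close> has been fixed.\<close>

lemma norm_\<Phi>_diff_sum_\<nu>_le:
  assumes f: "C0_fun f" and b: "\<And>z. norm (f z) \<le> b" "b > 0"
    and I: "finite I" and A: "\<And>i. i \<in> I \<Longrightarrow> A i \<in> sets borel" and disj: "disjoint_family_on A I"
    and close: "\<And>i z. i \<in> I \<Longrightarrow> z \<in> A i \<Longrightarrow> norm (f z - e i) \<le> \<delta>" and "\<delta> > 0"
  shows "norm (\<Phi> f - (\<Sum>i\<in>I. \<nu> (A i) (e i))) \<le> \<delta> * B + b * measure variation (- (\<Union>i\<in>I. A i))"
proof (rule le_of_le_add_mult_epsilon)
  fix \<epsilon> :: real assume "\<epsilon> > 0"
  define R where "R = - (\<Union>i\<in>I. A i)"
  have R: "R \<in> sets borel"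
    unfolding R_def using A I by (intro borel_comp sets.finite_UN) auto
  obtain V where V: "open V" "R \<subseteq> V" "measure variation (V - R) < \<epsilon>"
    using variation_outer_regular[OF R \<open>\<epsilon> > 0\<close>] .
  define P where "P i K U g \<longleftrightarrow> compact K \<and> open U \<and> K \<subseteq> A i \<and> A i \<subseteq> U \<and>
      measure variation (U - K) < \<epsilon> \<and> cutoff K U g \<and>
      (\<forall>x. norm (\<Phi> (\<lambda>z. g z *\<^sub>R x) - \<nu> (A i) x) \<le> \<epsilon> * norm x)" for i K U g
  have "\<exists>K U g. P i K U g" if "i \<in> I" for i
    unfolding P_def using variation_cutoff[OF A[OF that] \<open>\<epsilon> > 0\<close>] by metis
  then obtain K U g where "\<And>i. i \<in> I \<Longrightarrow> P i (K i) (U i) (g i)"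
    by metis
  then have K: "\<And>i. i \<in> I \<Longrightarrow> compact (K i)" "\<And>i. i \<in> I \<Longrightarrow> open (U i)"
      "\<And>i. i \<in> I \<Longrightarrow> K i \<subseteq> A i" "\<And>i. i \<in> I \<Longrightarrow> A i \<subseteq> U i"
    and small: "\<And>i. i \<in> I \<Longrightarrow> measure variation (U i - K i) < \<epsilon>"
    and g: "\<And>i. i \<in> I \<Longrightarrow> cutoff (K i) (U i) (g i)"
    and approx: "\<And>i x. i \<in> I \<Longrightarrow> norm (\<Phi> (\<lambda>z. g i z *\<^sub>R x) - \<nu> (A i) x) \<le> \<epsilon> * norm x"
    by (simp_all add: P_def)
  \<comment> \<open>Outside this set every \<open>g i\<close> is the indicator function of
    \<open>A i\<close>.\<close>
  define W where "W = (\<Union>i\<in>I. U i - K i)"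
  have "open W"
    unfolding W_def using K by (auto intro: open_Diff_compact)
  define F where "F z = f z - (\<Sum>i\<in>I. g i z *\<^sub>R e i)" for z
  define F' where "F' z = F z - clip \<delta> (F z)" for z
  define F'' where "F'' z = F' z - clip b (F' z)" for z
  have C0_sum: "C0_fun (\<lambda>z. \<Sum>i\<in>I. g i z *\<^sub>R e i)"
    using g by (intro C0_fun_sum cutoff_C0_fun) auto
  have C0: "C0_fun F" "C0_fun F'" "C0_fun F''"
    unfolding F_def F'_def F''_def using f C0_sum \<open>\<delta> > 0\<close> \<open>b > 0\<close>
    by (simp_all add: C0_fun_diff C0_fun_clip)
  \<comment> \<open>Off \<open>W\<close> the sum of the cutoff terms is \<open>e j\<close> on
    \<open>A j\<close> and 0 on \<open>R\<close>, so \<open>F\<close> is \<open>f - e j\<close> on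
    \<open>A j\<close> and \<open>f\<close> itself on \<open>R\<close>.\<close>
  have F_cases: "norm (F z) \<le> \<delta> \<or> (F z = f z \<and> z \<in> R)" if "z \<notin> W" for z
  proof (cases "z \<in> R")
    case True
    have "g i z = 0" if "i \<in> I" for i
    proof -
      have "z \<notin> K i" "z \<notin> U i - K i"
        using True \<open>z \<notin> W\<close> K(3) that by (auto simp: R_def W_def)
      then show ?thesis
        using g[OF that] by (auto simp: cutoff_def)
    qed
    then show ?thesis using True by (simp add: F_def)
  next
    case False
    then obtain j where j: "j \<in> I" "z \<in> A j" by (auto simp: R_def)
    have "g i z *\<^sub>R e i = (if i = j then e i else 0)" if "i \<in> I" for i
    proof (cases "i = j")
      case True
      then have "z \<in> K i"
        using j K(4)[OF that] \<open>z \<notin> W\<close> that by (auto simp: W_def)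
      then show ?thesis using True g[OF that] by (auto simp: cutoff_def)
    next
      case False
      then have "z \<notin> A i"
        using disj j that by (auto simp: disjoint_family_on_def)
      then have "z \<notin> U i"
        using K(3)[OF that] \<open>z \<notin> W\<close> that by (auto simp: W_def)
      then show ?thesis using False g[OF that] by (auto simp: cutoff_def)
    qed
    then have "F z = f z - e j"
      using j(1) I by (simp add: F_def)
    then show ?thesis using close[OF j] by simp
  qed
  have F'_zero: "F' z = 0" if "z \<notin> W \<union> V" for z
    using F_cases[of z] that V(2) \<open>\<delta> > 0\<close> by (auto simp: F'_def clip_eq)
  have F''_zero: "F'' z = 0" if "z \<notin> W" for z
  proof -
    have "norm (F' z) \<le> b"
      using F_cases[OF that]
    proof
      assume "norm (F z) \<le> \<delta>"
      then show ?thesis using \<open>\<delta> > 0\<close> \<open>b > 0\<close> by (simp add: F'_def clip_eq)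
    next
      assume "F z = f z \<and> z \<in> R"
      then show ?thesis
        using norm_diff_clip_le[OF \<open>\<delta> > 0\<close>, of "f z"] b(1)[of z] by (simp add: F'_def)
    qed
    then show ?thesis using \<open>b > 0\<close> by (simp add: F''_def clip_eq)
  qed
  let ?S = "\<Sum>i\<in>I. norm (e i)"
  have "norm (F'' z) \<le> b + ?S" for z
  proof -
    have "norm (F'' z) \<le> norm (F z)"
      unfolding F''_def F'_def using \<open>\<delta> > 0\<close> \<open>b > 0\<close>
      by (intro order_trans[OF norm_diff_clip_le norm_diff_clip_le])
    also have "\<dots> \<le> norm (f z) + norm (\<Sum>i\<in>I. g i z *\<^sub>R e i)"
      unfolding F_def by (rule norm_triangle_ineq4)
    also have "\<dots> \<le> b + (\<Sum>i\<in>I. norm (g i z *\<^sub>R e i))"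
      by (intro add_mono b norm_sum)
    also have "\<dots> \<le> b + ?S"
      using g by (intro add_left_mono sum_mono) (auto simp: cutoff_def mult_left_le_one_le)
    finally show ?thesis .
  qed
  then have 3: "norm (\<Phi> F'') \<le> (b + ?S) * mass W"
    using C0 F''_zero by (intro norm_\<Phi>_le_mass)
  have 2: "norm (\<Phi> F' - \<Phi> F'') \<le> b * mass (W \<union> V)"
    unfolding F''_def using C0 F'_zero \<open>b > 0\<close> by (intro norm_\<Phi>_truncate_le)
  have 1: "norm (\<Phi> F - \<Phi> F') \<le> \<delta> * mass UNIV"
    unfolding F'_def using C0 \<open>\<delta> > 0\<close> by (intro norm_\<Phi>_truncate_le) auto
  let ?N = "real (card I)"
  have W_le: "mass W \<le> ?N * \<epsilon>"
  proof -
    have "measure variation W \<le> (\<Sum>i\<in>I. measure variation (U i - K i))"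
      unfolding W_def using K I
      by (intro variation.finite_measure_subadditive_finite) (auto simp: sets_variation borel_Diff_compact)
    also have "\<dots> \<le> ?N * \<epsilon>"
      using small by (intro sum_bounded_above) (auto intro: less_imp_le)
    finally show ?thesis by (simp add: measure_variation_open[OF \<open>open W\<close>])
  qed
  \<comment> \<open>Since \<open>V\<close> exceeds \<open>R\<close> by little variation, the
    truncation at height \<open>b\<close> costs essentially \<open>b\<close> times the variation of
    the uncovered part.\<close>
  have WV_le: "mass (W \<union> V) \<le> ?N * \<epsilon> + (measure variation R + \<epsilon>)"
  proof -
    have "measure variation V = measure variation (R \<union> (V - R))"
      using V(2) by (intro arg_cong[where f = "measure variation"]) auto
    also have "\<dots> \<le> measure variation R + measure variation (V - R)"
      using R V(1) by (intro variation_Un_le) auto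
    finally have "mass V \<le> measure variation R + \<epsilon>"
      using V(3) by (simp add: measure_variation_open[OF V(1)])
    then show ?thesis
      using mass_Un_le[OF \<open>open W\<close> V(1)] W_le by simp
  qed
  have "norm (\<Phi> F) \<le> norm (\<Phi> F - \<Phi> F') + norm (\<Phi> F' - \<Phi> F'') + norm (\<Phi> F'')"
    using norm_triangle_ineq[of "\<Phi> F - \<Phi> F'" "\<Phi> F'"] norm_triangle_ineq[of "\<Phi> F' - \<Phi> F''" "\<Phi> F''"]
    by simp
  also have "\<dots> \<le> \<delta> * B + b * (?N * \<epsilon> + (measure variation R + \<epsilon>)) + (b + ?S) * (?N * \<epsilon>)"
    using \<open>\<delta> > 0\<close> \<open>b > 0\<close> mass_le_B W_le WV_le
    by (intro add_mono order_trans[OF 1] order_trans[OF 2] order_trans[OF 3] mult_left_mono)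
      (auto intro!: add_nonneg_nonneg sum_nonneg)
  finally have norm_F: "norm (\<Phi> F) \<le> \<dots>" .
  have \<Phi>_F: "\<Phi> F = \<Phi> f - (\<Sum>i\<in>I. \<Phi> (\<lambda>z. g i z *\<^sub>R e i))"
    unfolding F_def using \<Phi>_diff[OF f C0_sum] \<Phi>_sum[of I "\<lambda>i z. g i z *\<^sub>R e i", OF cutoff_C0_fun[OF g]]
    by simp
  have "norm (\<Sum>i\<in>I. \<Phi> (\<lambda>z. g i z *\<^sub>R e i) - \<nu> (A i) (e i)) \<le> (\<Sum>i\<in>I. \<epsilon> * norm (e i))"
    using approx by (rule sum_norm_le)
  then have sum_le: "norm ((\<Sum>i\<in>I. \<Phi> (\<lambda>z. g i z *\<^sub>R e i)) - (\<Sum>i\<in>I. \<nu> (A i) (e i))) \<le> \<epsilon> * ?S"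
    by (simp add: sum_subtractf sum_distrib_left)
  have "\<Phi> f - (\<Sum>i\<in>I. \<nu> (A i) (e i)) =
      \<Phi> F + ((\<Sum>i\<in>I. \<Phi> (\<lambda>z. g i z *\<^sub>R e i)) - (\<Sum>i\<in>I. \<nu> (A i) (e i)))"
    by (simp add: \<Phi>_F)
  also have "norm \<dots> \<le> \<delta> * B + b * (?N * \<epsilon> + (measure variation R + \<epsilon>)) + (b + ?S) * (?N * \<epsilon>) + \<epsilon> * ?S"
    by (intro order_trans[OF norm_triangle_ineq] add_mono norm_F sum_le)
  finally show "norm (\<Phi> f - (\<Sum>i\<in>I. \<nu> (A i) (e i))) \<le> \<delta> * B + b * measure variation (- (\<Union>i\<in>I. A i)) +
      \<epsilon> * (b * ?N + b + (b + ?S) * ?N + ?S)"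
    by (simp add: R_def algebra_simps)
qed

text \<open>The estimate for finitely many sets is applied to the fibres over the union of two
  finite sets of values: \<open>X\<close> brings the partial sum near the infinite sum, and
  \<open>Y\<close> makes the remaining fibres small in variation.\<close>

lemma norm_integral_diff_\<Phi>_le:
  assumes f: "C0_fun f" and g: "g \<in> countably_valued borel"
    and close: "\<And>z. norm (f z - g z) \<le> \<delta>" and "\<delta> > 0"
  shows "norm ((\<Sum>\<^sub>\<infinity>e\<in>UNIV. \<nu> (g -` {e}) e) - \<Phi> f) \<le> \<delta> * B"
proof -
  let ?h = "\<lambda>e. \<nu> (g -` {e}) e"
  have g_props: "countable (range g)" "\<And>e. g -` {e} \<in> sets borel"
    using g by (auto simp: countably_valued_def)
  have disj: "disjoint_family_on (\<lambda>e. g -` {e}) Y" for Y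
    by (auto simp: disjoint_family_on_def)
  obtain b0 where b0: "\<And>z. norm (g z) \<le> b0"
    using g by (auto simp: countably_valued_def bounded_iff)
  obtain b where b: "b > 0" "\<And>z. norm (f z) \<le> b"
    using C0_fun_bounded[OF f] by blast
  have "b0 \<ge> 0" using order_trans[OF norm_ge_zero b0] .
  \<comment> \<open>A common bound for the finite sums gives absolute summability; a family that is
    not summable would have the default sum 0.\<close>
  have "sum (\<lambda>e. norm (?h e)) Y \<le> b0 * B" if "finite Y" for Y
  proof -
    have "sum (\<lambda>e. norm (?h e)) Y = sum (\<lambda>e. norm (?h e)) (Y \<inter> range g)"
    proof (rule sum.mono_neutral_right)
      have "g -` {e} = {}" if "e \<notin> range g" for e using that by auto
      then show "\<forall>e\<in>Y - Y \<inter> range g. norm (?h e) = 0"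
        by (auto simp: \<nu>_empty)
    qed (use that in auto)
    also have "\<dots> \<le> b0 * B"
      using that g_props(2) disj b0 \<open>b0 \<ge> 0\<close> by (intro norm_sum_\<nu>_le) auto
    finally show ?thesis .
  qed
  then have "(\<lambda>e. norm (?h e)) summable_on UNIV"
    by (intro nonneg_bdd_above_summable_on) (auto intro!: bdd_aboveI2)
  then have "?h summable_on UNIV"
    by (rule abs_summable_summable)
  then have lim: "(sum ?h \<longlongrightarrow> (\<Sum>\<^sub>\<infinity>e\<in>UNIV. ?h e)) (finite_subsets_at_top UNIV)"
    using has_sum_infsum by (simp add: has_sum_def)
  have small: "\<exists>Y. finite Y \<and> measure variation (- g -` Y) < \<epsilon>" if "\<epsilon> > 0" for \<epsilon>
  proof -
    \<comment> \<open>If the range is finite, \<open>from_nat_into\<close> repeats values, which is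
      harmless in a union of fibres.\<close>
    define A where "A n = g -` (from_nat_into (range g) ` {..<n})" for n :: nat
    have A_eq: "A n = (\<Union>i<n. g -` {from_nat_into (range g) i})" for n
      by (auto simp: A_def)
    have sets_A: "A n \<in> sets borel" for n
      unfolding A_eq using g_props(2) by auto
    have "incseq A"
      by (rule incseq_SucI) (auto simp: A_def)
    moreover have "(\<Union>n. A n) = UNIV"
    proof -
      have "\<exists>i. g z = from_nat_into (range g) i" for z
        using from_nat_into_surj[OF g_props(1), of "g z"] by (metis rangeI)
      then show ?thesis by (fastforce simp: A_eq)
    qed
    ultimately have "(\<lambda>n. measure variation (A n)) \<longlonglongrightarrow> measure variation UNIV"
      using variation.finite_Lim_measure_incseq[of A] sets_A by (auto simp: sets_variation)
    then have "\<forall>\<^sub>F n in sequentially. measure variation UNIV - \<epsilon> < measure variation (A n)"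
      using that by (intro order_tendstoD(1)) auto
    then obtain n where n: "measure variation UNIV - \<epsilon> < measure variation (A n)"
      by (auto simp: eventually_sequentially)
    have "measure variation (- A n) = measure variation UNIV - measure variation (A n)"
      using sets_A variation.finite_measure_compl[of "A n"] by (simp add: sets_variation space_variation Compl_eq_Diff_UNIV)
    then have "measure variation (- A n) < \<epsilon>"
      using n by simp
    then show ?thesis unfolding A_def by (intro exI[of _ "from_nat_into (range g) ` {..<n}"]) auto
  qed
  show ?thesis
  proof (rule le_of_le_add_mult_epsilon)
    fix \<epsilon> :: real assume "\<epsilon> > 0"
    obtain X where X: "finite X" "\<And>Y. finite Y \<Longrightarrow> X \<subseteq> Y \<Longrightarrow> dist (sum ?h Y) (\<Sum>\<^sub>\<infinity>e\<in>UNIV. ?h e) < \<epsilon>"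
      using tendstoD[OF lim \<open>\<epsilon> > 0\<close>] unfolding eventually_finite_subsets_at_top by auto
    obtain Y where Y: "finite Y" "measure variation (- g -` Y) < \<epsilon>"
      using small[OF \<open>\<epsilon> > 0\<close>] by blast
    let ?Z = "X \<union> Y"
    have "norm (\<Phi> f - sum ?h ?Z) \<le> \<delta> * B + b * measure variation (- (\<Union>e\<in>?Z. g -` {e}))"
      using X(1) Y(1) g_props(2) disj close \<open>\<delta> > 0\<close> b
      by (intro norm_\<Phi>_diff_sum_\<nu>_le f) auto
    also have "measure variation (- (\<Union>e\<in>?Z. g -` {e})) \<le> measure variation (- g -` Y)"
    proof (rule variation_mono)
      have "g -` Y = (\<Union>e\<in>Y. g -` {e})" by auto
      then have "g -` Y \<in> sets borel"
        using Y(1) g_props(2) by auto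
      then show "- g -` Y \<in> sets borel"
        by (rule borel_comp)
    qed auto
    finally have "norm (\<Phi> f - sum ?h ?Z) \<le> \<delta> * B + b * \<epsilon>"
      using Y(2) b(1) by (simp add: mult_left_mono order_trans[OF _ add_left_mono])
    moreover have "norm ((\<Sum>\<^sub>\<infinity>e\<in>UNIV. ?h e) - sum ?h ?Z) < \<epsilon>"
      using X(2)[of ?Z] X(1) Y(1) by (simp add: dist_norm norm_minus_commute)
    ultimately show "norm ((\<Sum>\<^sub>\<infinity>e\<in>UNIV. ?h e) - \<Phi> f) \<le> \<delta> * B + \<epsilon> * (1 + b)"
      using norm_triangle_ineq4[of "(\<Sum>\<^sub>\<infinity>e\<in>UNIV. ?h e) - sum ?h ?Z" "\<Phi> f - sum ?h ?Z"]
      by (simp add: algebra_simps)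
  qed
qed

end

section \<open>Uniqueness of the representing measure\<close>

locale countably_additive_function =
  fixes M :: "'z measure" and \<sigma> :: "'z set \<Rightarrow> 'k::real_normed_vector"
  assumes sums: "range A \<subseteq> sets M \<Longrightarrow> disjoint_family A \<Longrightarrow> (\<lambda>n. \<sigma> (A n)) sums \<sigma> (\<Union>n. A n)"
begin

lemma empty: "\<sigma> {} = 0"
proof -
  have "(\<lambda>_::nat. \<sigma> {}) sums \<sigma> (\<Union>n::nat. {})"
    by (rule sums) (auto simp: disjoint_family_on_def)
  then show ?thesis
    using sums_summable summable_const_iff by blast
qed

lemma Un:
  assumes "A \<in> sets M" "A' \<in> sets M" "A \<inter> A' = {}"
  shows "\<sigma> (A \<union> A') = \<sigma> A + \<sigma> A'"
proof -
  have "(\<lambda>n. \<sigma> (binaryset A A' n)) sums \<sigma> (\<Union>n. binaryset A A' n)"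
    using assms by (intro sums) (auto simp: disjoint_family_on_def binaryset_def range_binaryset_eq)
  moreover have "(\<lambda>n. \<sigma> (binaryset A A' n)) sums (\<sigma> A + \<sigma> A')"
    by (rule binaryset_sums) (rule empty)
  ultimately show ?thesis
    by (simp add: UN_binaryset_eq sums_iff)
qed

lemma Diff: "A \<in> sets M \<Longrightarrow> A' \<in> sets M \<Longrightarrow> A' \<subseteq> A \<Longrightarrow> \<sigma> (A - A') = \<sigma> A - \<sigma> A'"
  using Un[of "A - A'" A'] by (simp add: Un_absorb2 sets.Diff Diff_disjoint Int_commute)

lemma tendsto_incseq:
  assumes A: "range A \<subseteq> sets M" and inc: "incseq A"
  shows "(\<lambda>n. \<sigma> (A n)) \<longlonglongrightarrow> \<sigma> (\<Union>n. A n)"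
proof -
  have A': "A n \<in> sets M" for n using A by auto
  have dA: "range (disjointed A) \<subseteq> sets M"
    by (rule sets.range_disjointed_sets[OF A])
  have sum_eq: "(\<Sum>i<Suc n. \<sigma> (disjointed A i)) = \<sigma> (A n)" for n
  proof (induction n)
    case 0
    then show ?case by (simp add: disjointed_def)
  next
    case (Suc n)
    have eq: "disjointed A (Suc n) = A (Suc n) - A n"
      using incseqD[OF inc, of _ n] by (fastforce simp: disjointed_def less_Suc_eq_le)
    have "(\<Sum>i<Suc (Suc n). \<sigma> (disjointed A i)) = \<sigma> (A n) + \<sigma> (disjointed A (Suc n))"
      using Suc by (simp only: sum.lessThan_Suc[of _ "Suc n"])
    also have "\<dots> = \<sigma> (A (Suc n))"
      unfolding eq using Diff[of "A (Suc n)" "A n"] A' incseq_SucD[OF inc] by simp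
    finally show ?case .
  qed
  have "(\<lambda>n. \<sigma> (disjointed A n)) sums \<sigma> (\<Union>n. disjointed A n)"
    using dA disjoint_family_disjointed by (rule sums)
  then have "(\<lambda>n. \<Sum>i<Suc n. \<sigma> (disjointed A i)) \<longlonglongrightarrow> \<sigma> (\<Union>n. A n)"
    unfolding sums_def UN_disjointed_eq by (rule LIMSEQ_Suc)
  then show ?thesis by (simp only: sum_eq)
qed

text \<open>Otherwise the sets on which \<open>\<sigma>\<close> is large could be made disjoint by cutting off a later
  \<open>D m\<close>, and the values of \<open>\<sigma>\<close> on them would not tend to zero.\<close>

lemma small_on_decseq:
  assumes D: "range D \<subseteq> sets M" and dec: "decseq D"
    and null: "\<And>A. A \<in> sets M \<Longrightarrow> A \<subseteq> (\<Inter>n. D n) \<Longrightarrow> \<sigma> A = 0" and "\<epsilon> > 0"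
  shows "\<exists>n. \<forall>A\<in>sets M. A \<subseteq> D n \<longrightarrow> norm (\<sigma> A) \<le> \<epsilon>"
proof (rule ccontr)
  assume "\<not> ?thesis"
  then have "\<forall>n. \<exists>A. A \<in> sets M \<and> A \<subseteq> D n \<and> \<epsilon> < norm (\<sigma> A)"
    by (auto simp: not_le)
  then obtain A where A: "\<And>n. A n \<in> sets M" "\<And>n. A n \<subseteq> D n" "\<And>n. \<epsilon> < norm (\<sigma> (A n))"
    by metis
  have D': "D n \<in> sets M" for n using D by auto
  \<comment> \<open>As \<open>m\<close> grows, \<open>A n - D m\<close> increases to
    \<open>A n\<close> up to a part lying in every \<open>D m\<close>, where \<open>\<sigma>\<close>
    vanishes; a late enough cut keeps the value above \<open>\<epsilon>\<close>.\<close>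
  have "\<exists>m>n. \<epsilon> < norm (\<sigma> (A n - D m))" for n
  proof -
    have "(\<lambda>m. \<sigma> (A n - D m)) \<longlonglongrightarrow> \<sigma> (\<Union>m. A n - D m)"
      using A(1) D' by (intro tendsto_incseq) (auto simp: incseq_def dest: decseqD[OF dec])
    moreover have "\<sigma> (\<Union>m. A n - D m) = \<sigma> (A n)"
    proof -
      have I: "(\<Inter>m. D m) \<in> sets M" using D' by auto
      have "(\<Union>m. A n - D m) = A n - (A n \<inter> (\<Inter>m. D m))" by auto
      then show ?thesis
        using Diff[of "A n" "A n \<inter> (\<Inter>m. D m)"] null[of "A n \<inter> (\<Inter>m. D m)"] A(1) I by simp
    qed
    ultimately have "(\<lambda>m. norm (\<sigma> (A n - D m))) \<longlonglongrightarrow> norm (\<sigma> (A n))"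
      by (metis tendsto_norm)
    then have "\<forall>\<^sub>F m in sequentially. \<epsilon> < norm (\<sigma> (A n - D m))"
      using A(3) by (rule order_tendstoD)
    then have "\<forall>\<^sub>F m in sequentially. n < m \<and> \<epsilon> < norm (\<sigma> (A n - D m))"
      using eventually_gt_at_top by (rule eventually_conj[rotated])
    then show ?thesis
      using eventually_happens'[OF sequentially_bot] by fast
  qed
  then obtain h where h: "\<And>n. n < h n" "\<And>n. \<epsilon> < norm (\<sigma> (A n - D (h n)))"
    by metis
  define r where "r k = (h ^^ k) 0" for k
  have r_Suc: "r (Suc k) = h (r k)" for k by (simp add: r_def)
  then have "strict_mono r"
    using h(1) by (simp add: strict_mono_Suc_iff)
  \<comment> \<open>For \<open>j < k\<close> the set \<open>C k\<close> lies in
    \<open>A (r k)\<close>, hence in \<open>D (r (Suc j))\<close>, which has been removed from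
    \<open>C j\<close>.\<close>
  define C where "C k = A (r k) - D (r (Suc k))" for k
  have disj: "C j \<inter> C k = {}" if "j < k" for j k
  proof -
    have "r (Suc j) \<le> r k"
      using \<open>strict_mono r\<close> that by (simp add: strict_mono_less_eq)
    then have "D (r k) \<subseteq> D (r (Suc j))"
      using dec by (simp add: decseqD)
    then show ?thesis
      using A(2)[of "r k"] by (auto simp: C_def)
  qed
  have "C j \<inter> C k = {}" if "j \<noteq> k" for j k
    using that disj[of j k] disj[of k j] by (cases "j < k") auto
  then have "disjoint_family C"
    by (simp add: disjoint_family_on_def)
  moreover have "range C \<subseteq> sets M"
    using A(1) D' by (auto simp: C_def)
  ultimately have "(\<lambda>k. \<sigma> (C k)) \<longlonglongrightarrow> 0"
    using sums sums_summable summable_LIMSEQ_zero by blast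
  then have "(\<lambda>k. norm (\<sigma> (C k))) \<longlonglongrightarrow> 0"
    by (rule tendsto_norm_zero)
  then have "\<forall>\<^sub>F k in sequentially. norm (\<sigma> (C k)) < \<epsilon>"
    using \<open>\<epsilon> > 0\<close> by (rule order_tendstoD)
  then obtain k where "norm (\<sigma> (C k)) < \<epsilon>"
    by (auto simp: eventually_sequentially)
  then show False
    using h(2)[of "r k"] by (simp add: C_def r_Suc)
qed

end

lemma sigma_compact_incseq:
  fixes K :: "'z::topological_space set"
  assumes "sigma_compact K"
  obtains C where "\<And>n::nat. compact (C n)" "incseq C" "K = (\<Union>n. C n)"
proof -
  obtain C where C: "\<And>n::nat. compact (C n)" "K = (\<Union>n. C n)"
    using assms by (auto simp: sigma_compact_def)
  show thesis
  proof
    show "compact (\<Union>i\<le>n. C i)" for n using C(1) by auto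
    show "incseq (\<lambda>n. \<Union>i\<le>n. C i)" by (rule incseq_SucI) (auto simp: atMost_Suc)
    show "K = (\<Union>n. \<Union>i\<le>n. C i)" using C(2) by auto
  qed
qed

lemma sigma_compact_Un:
  assumes "sigma_compact K" "sigma_compact L"
  shows "sigma_compact (K \<union> L)"
proof -
  obtain C D where "\<And>n::nat. compact (C n)" "K = (\<Union>n. C n)" "\<And>n::nat. compact (D n)" "L = (\<Union>n. D n)"
    using assms by (auto simp: sigma_compact_def)
  then show ?thesis
    unfolding sigma_compact_def by (intro exI[of _ "\<lambda>n. C n \<union> D n"]) auto
qed

text \<open>The integral of a staircase approximation of \<open>g x\<close> with \<open>N\<close> steps, where \<open>0 \<le> g \<le> 1\<close>.\<close>

definition level_average :: "('z set \<Rightarrow> 'e \<Rightarrow> 'k::real_normed_field) \<Rightarrow> nat \<Rightarrow> ('z \<Rightarrow> real) \<Rightarrow> 'e \<Rightarrow> 'k" where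
  "level_average \<nu> N g x = (\<Sum>j=1..N. \<nu> {z. real j \<le> real N * g z} x) / of_nat N"

lemma i_measure_countably_additive:
  "i_measure s (*) M \<nu> \<Longrightarrow> countably_additive_function M (\<lambda>A. \<nu> A x)"
  by (simp add: i_measure_def countably_additive_function_def)

text \<open>For compact \<open>C\<close>, regularity gives compact sets \<open>L n\<close>
  exhausting the complement of \<open>C\<close> up to a part on whose Borel subsets the difference
  \<open>\<sigma>\<close> vanishes, so for some \<open>n\<close> it is small on all Borel subsets of
  \<open>- C - L n\<close>. A cutoff function equal to 1 on \<open>C\<close> and 0 on
  \<open>L n\<close> has its level sets between \<open>C\<close> and the complement of
  \<open>L n\<close>; hence the average of \<open>\<sigma>\<close> over them is close to
  \<open>\<sigma> C\<close>.\<close>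

lemma regular_i_measure_eqI:
  fixes \<nu> \<nu>' :: "'z::t2_space set \<Rightarrow> 'e::real_normed_vector \<Rightarrow> 'k::real_or_complex"
  assumes lc: "locally_compact_space (euclidean :: 'z topology)"
    and \<nu>: "regular_i_measure s (*) \<nu>" and \<nu>': "regular_i_measure s (*) \<nu>'"
    and lim: "\<And>g. cutoff {} UNIV g \<Longrightarrow>
      (\<lambda>N. level_average \<nu>' (Suc N) g x - level_average \<nu> (Suc N) g x) \<longlonglongrightarrow> 0"
    and A: "A \<in> sets borel"
  shows "\<nu>' A x = \<nu> A x"
proof -
  define \<sigma> where "\<sigma> A = \<nu>' A x - \<nu> A x" for A
  have i: "i_measure s (*) borel \<nu>" "i_measure s (*) borel \<nu>'"
    using \<nu> \<nu>' by (simp_all add: regular_i_measure_def)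
  interpret \<sigma>: countably_additive_function borel \<sigma>
  proof
    fix A :: "nat \<Rightarrow> 'z set" assume A: "range A \<subseteq> sets borel" "disjoint_family A"
    show "(\<lambda>n. \<sigma> (A n)) sums \<sigma> (\<Union>n. A n)"
      unfolding \<sigma>_def
      by (rule sums_diff[OF countably_additive_function.sums[OF i_measure_countably_additive[OF i(2)] A]
            countably_additive_function.sums[OF i_measure_countably_additive[OF i(1)] A]])
  qed
  have reg: "\<exists>K. sigma_compact K \<and> K \<subseteq> A \<and> (\<forall>B\<in>sets borel. B \<subseteq> A - K \<longrightarrow> \<sigma> B = 0)"
    if sets: "A \<in> sets borel" for A
  proof -
    obtain K where K: "sigma_compact K" "K \<subseteq> A" "\<forall>B\<in>sets borel. B \<subseteq> A - K \<longrightarrow> (\<forall>x. \<nu> B x = 0)"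
      using bspec[OF conjunct2[OF \<nu>[unfolded regular_i_measure_def]] sets] by (elim exE conjE)
    obtain K' where K': "sigma_compact K'" "K' \<subseteq> A" "\<forall>B\<in>sets borel. B \<subseteq> A - K' \<longrightarrow> (\<forall>x. \<nu>' B x = 0)"
      using bspec[OF conjunct2[OF \<nu>'[unfolded regular_i_measure_def]] sets] by (elim exE conjE)
    show ?thesis
    proof (intro exI[of _ "K \<union> K'"] conjI ballI impI)
      show "sigma_compact (K \<union> K')" using K(1) K'(1) by (rule sigma_compact_Un)
      show "K \<union> K' \<subseteq> A" using K(2) K'(2) by blast
      fix B :: "'z set" assume "B \<in> sets borel" "B \<subseteq> A - (K \<union> K')"
      moreover from this have "B \<subseteq> A - K" "B \<subseteq> A - K'" by auto
      ultimately show "\<sigma> B = 0" using K(3) K'(3) by (simp add: \<sigma>_def)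
    qed
  qed
  have compact_zero: "\<sigma> C = 0" if C: "compact C" for C
  proof -
    have "norm (\<sigma> C) \<le> \<epsilon>" if "\<epsilon> > 0" for \<epsilon>
    proof -
      have "- C \<in> sets borel" using C by (intro borel_comp borel_compact)
      then obtain K where K: "sigma_compact K" "K \<subseteq> - C" "\<And>B. B \<in> sets borel \<Longrightarrow> B \<subseteq> - C - K \<Longrightarrow> \<sigma> B = 0"
        using reg by metis
      obtain L where L: "\<And>n::nat. compact (L n)" "incseq L" "K = (\<Union>n. L n)"
        using sigma_compact_incseq[OF K(1)] by blast
      define D where "D n = - C - L n" for n
      have "\<exists>n. \<forall>A\<in>sets borel. A \<subseteq> D n \<longrightarrow> norm (\<sigma> A) \<le> \<epsilon>"
      proof (rule \<sigma>.small_on_decseq)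
        show "range D \<subseteq> sets borel"
          using \<open>- C \<in> sets borel\<close> L(1) by (auto simp: D_def intro: borel_compact)
        show "decseq D"
          by (auto simp: D_def decseq_def dest: incseqD[OF L(2)])
        fix B :: "'z set" assume "B \<in> sets borel" "B \<subseteq> (\<Inter>n. D n)"
        then show "\<sigma> B = 0"
          using L(3) by (intro K(3)) (auto simp: D_def)
      qed fact
      then obtain n where n: "\<And>A. A \<in> sets borel \<Longrightarrow> A \<subseteq> D n \<Longrightarrow> norm (\<sigma> A) \<le> \<epsilon>"
        by blast
      have "C \<subseteq> - L n" using K(2) L(3) by blast
      then obtain g where g: "cutoff C (- L n) g"
        using ex_cutoff[OF lc C, of "- L n"] L(1) compact_imp_closed by blast
      have "norm (\<sigma> C - (level_average \<nu>' (Suc N) g x - level_average \<nu> (Suc N) g x)) \<le> \<epsilon>" for N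
      proof -
        let ?E = "\<lambda>j. {z. real j \<le> real (Suc N) * g z}"
        have E: "norm (\<sigma> C - \<sigma> (?E j)) \<le> \<epsilon>" if j: "j \<in> {1..Suc N}" for j
        proof -
          have "closed (?E j)"
            using g by (intro closed_Collect_le continuous_intros) (auto simp: cutoff_def)
          then have sets: "?E j \<in> sets borel" "C \<in> sets borel"
            using C by (auto intro: borel_closed borel_compact)
          have "C \<subseteq> ?E j" using g j by (auto simp: cutoff_def)
          then have "\<sigma> (?E j - C) = \<sigma> (?E j) - \<sigma> C"
            using sets by (intro \<sigma>.Diff)
          moreover have "?E j - C \<subseteq> D n"
          proof -
            \<comment> \<open>Here it matters that the levels start at \<open>j = 1\<close>:
              \<open>g\<close> is 0 on \<open>L n\<close>, and the level 0 would give the whole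
              space.\<close>
            have "z \<notin> L n" if "real j \<le> real (Suc N) * g z" for z
              using g j that by (force simp: cutoff_def)
            then show ?thesis by (auto simp: D_def)
          qed
          ultimately show ?thesis
            using n[of "?E j - C"] sets by (auto simp: norm_minus_commute)
        qed
        have "level_average \<nu>' (Suc N) g x - level_average \<nu> (Suc N) g x =
            (\<Sum>j=1..Suc N. \<sigma> (?E j)) / of_nat (Suc N)"
          unfolding level_average_def \<sigma>_def sum_subtractf by (simp only: diff_divide_distrib)
        moreover have "\<sigma> C = (\<Sum>j=1..Suc N. \<sigma> C) / of_nat (Suc N)"
          by (simp del: of_nat_Suc)
        ultimately have "\<sigma> C - (level_average \<nu>' (Suc N) g x - level_average \<nu> (Suc N) g x) =
            (\<Sum>j=1..Suc N. \<sigma> C - \<sigma> (?E j)) / of_nat (Suc N)"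
          by (simp only: sum_subtractf diff_divide_distrib)
        also have "norm \<dots> = norm (\<Sum>j=1..Suc N. \<sigma> C - \<sigma> (?E j)) / real (Suc N)"
          by (simp only: norm_divide norm_of_nat)
        also have "\<dots> \<le> (\<Sum>j=1..Suc N. \<epsilon>) / real (Suc N)"
          using E by (intro divide_right_mono sum_norm_le) auto
        also have "\<dots> = \<epsilon>" by (simp del: of_nat_Suc)
        finally show ?thesis .
      qed
      moreover have "(\<lambda>N. norm (\<sigma> C - (level_average \<nu>' (Suc N) g x - level_average \<nu> (Suc N) g x)))
          \<longlonglongrightarrow> norm (\<sigma> C - 0)"
        using g by (intro tendsto_intros lim) (rule cutoff_mono, auto)
      ultimately show ?thesis
        by (intro LIMSEQ_le_const2[where x = "norm (\<sigma> C)"]) auto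
    qed
    then show ?thesis
      using field_le_epsilon[of "norm (\<sigma> C)" 0] by simp
  qed
  \<comment> \<open>A Borel set has the same value of \<open>\<sigma>\<close> as a sigma-compact
    subset, and this is an increasing union of compact sets.\<close>
  obtain K where K: "sigma_compact K" "K \<subseteq> A" "\<And>B. B \<in> sets borel \<Longrightarrow> B \<subseteq> A - K \<Longrightarrow> \<sigma> B = 0"
    using reg[OF A] by metis
  obtain C where C: "\<And>n::nat. compact (C n)" "incseq C" "K = (\<Union>n. C n)"
    using sigma_compact_incseq[OF K(1)] by blast
  have "(\<lambda>n. \<sigma> (C n)) \<longlonglongrightarrow> \<sigma> K"
    unfolding C(3) using C(1,2) by (intro \<sigma>.tendsto_incseq) (auto intro: borel_compact)
  then have "\<sigma> K = 0"
    using compact_zero[OF C(1)] by (simp add: LIMSEQ_const_iff)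
  moreover have "K \<in> sets borel"
    unfolding C(3) using C(1) by (auto intro: borel_compact)
  ultimately have "\<sigma> A = \<sigma> (A - K)"
    using \<sigma>.Diff[OF A _ K(2)] by simp
  also have "\<dots> = 0"
    using A \<open>K \<in> sets borel\<close> by (intro K(3)) auto
  finally show ?thesis by (simp add: \<sigma>_def)
qed

section \<open>Integrals of staircase functions\<close>

definition staircase :: "nat \<Rightarrow> ('z \<Rightarrow> real) \<Rightarrow> 'e::real_vector \<Rightarrow> 'z \<Rightarrow> 'e" where
  "staircase N g x z = (real (nat \<lfloor>real N * g z\<rfloor>) / real N) *\<^sub>R x"

lemma staircase_level_set:
  assumes "continuous_on UNIV g" "\<And>z. 0 \<le> g z"
  shows "{z. real j \<le> real N * g z} \<in> sets borel"
    and "{z. nat \<lfloor>real N * g z\<rfloor> = j} = {z. real j \<le> real N * g z} - {z. real (Suc j) \<le> real N * g z}"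
proof -
  have "closed {z. real j \<le> real N * g z}"
    using assms(1) by (intro closed_Collect_le continuous_intros)
  then show "{z. real j \<le> real N * g z} \<in> sets borel" by simp
  have "nat \<lfloor>real N * g z\<rfloor> = j \<longleftrightarrow> real j \<le> real N * g z \<and> real N * g z < real (Suc j)" for z
  proof -
    have "0 \<le> real N * g z" using assms(2) by simp
    then have "nat \<lfloor>real N * g z\<rfloor> = j \<longleftrightarrow> \<lfloor>real N * g z\<rfloor> = int j" by auto
    then show ?thesis by (simp add: floor_eq_iff add.commute)
  qed
  then show "{z. nat \<lfloor>real N * g z\<rfloor> = j} = {z. real j \<le> real N * g z} - {z. real (Suc j) \<le> real N * g z}"
    by (intro set_eqI) (simp only: mem_Collect_eq Diff_iff not_le)
qed

lemma staircase_countably_valued: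
  fixes g :: "'z::topological_space \<Rightarrow> real"
  assumes g: "cutoff {} UNIV g"
  shows "staircase N g x \<in> countably_valued borel"
proof (rule finite_valued_in_countably_valued)
  have g': "continuous_on UNIV g" "\<And>z. 0 \<le> g z" "\<And>z. g z \<le> 1"
    using g by (auto simp: cutoff_def)
  have le: "nat \<lfloor>real N * g z\<rfloor> \<le> N" for z
  proof -
    have "real N * g z \<le> real N" using g'(3)[of z] by (simp add: mult_left_le)
    then have "\<lfloor>real N * g z\<rfloor> \<le> int N" by linarith
    then show ?thesis by simp
  qed
  then have "range (staircase N g x) \<subseteq> (\<lambda>j. (real j / real N) *\<^sub>R x) ` {..N}"
    by (auto simp: staircase_def)
  then show "finite (range (staircase N g x))"
    using finite_subset by blast
  fix y
  have "staircase N g x -` {y} = (\<Union>j\<in>{j. j \<le> N \<and> (real j / real N) *\<^sub>R x = y}. {z. nat \<lfloor>real N * g z\<rfloor> = j})"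
    using le by (auto simp: staircase_def)
  also have "\<dots> \<in> sets borel"
    unfolding staircase_level_set(2)[OF g'(1,2)]
    by (intro sets.finite_UN sets.Diff staircase_level_set(1)[OF g'(1,2)]) simp
  finally show "staircase N g x -` {y} \<in> sets borel" .
qed

lemma staircase_uniform_limit:
  fixes x :: "'e::real_normed_vector"
  assumes g: "cutoff {} UNIV g"
  shows "uniform_limit UNIV (\<lambda>N. staircase (Suc N) g x) (\<lambda>z. g z *\<^sub>R x) sequentially"
proof (rule uniform_limitI)
  fix e :: real assume "e > 0"
  have "dist (staircase (Suc N) g x z) (g z *\<^sub>R x) \<le> norm x / real (Suc N)" for N z
  proof -
    have "0 \<le> real (Suc N) * g z" using g by (simp add: cutoff_def)
    then have "\<bar>real (nat \<lfloor>real (Suc N) * g z\<rfloor>) - real (Suc N) * g z\<bar> \<le> 1"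
      by linarith
    then have "\<bar>real (nat \<lfloor>real (Suc N) * g z\<rfloor>) - real (Suc N) * g z\<bar> / real (Suc N) \<le> 1 / real (Suc N)"
      by (rule divide_right_mono) simp
    moreover have "real (nat \<lfloor>real (Suc N) * g z\<rfloor>) / real (Suc N) - g z =
        (real (nat \<lfloor>real (Suc N) * g z\<rfloor>) - real (Suc N) * g z) / real (Suc N)"
      by (simp add: diff_divide_distrib del: of_nat_Suc)
    ultimately have "\<bar>real (nat \<lfloor>real (Suc N) * g z\<rfloor>) / real (Suc N) - g z\<bar> \<le> 1 / real (Suc N)"
      by (simp only: abs_divide abs_of_nat)
    then have "\<bar>real (nat \<lfloor>real (Suc N) * g z\<rfloor>) / real (Suc N) - g z\<bar> * norm x \<le> 1 / real (Suc N) * norm x"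
      by (rule mult_right_mono) simp
    then show ?thesis
      by (simp add: dist_norm staircase_def flip: scaleR_left_diff_distrib)
  qed
  moreover have "(\<lambda>N. norm x * inverse (real (Suc N))) \<longlonglongrightarrow> norm x * 0"
    by (intro tendsto_intros LIMSEQ_inverse_real_of_nat)
  then have "\<forall>\<^sub>F N in sequentially. norm x * inverse (real (Suc N)) < e"
    using \<open>e > 0\<close> by (intro order_tendstoD(2)) auto
  ultimately show "\<forall>\<^sub>F N in sequentially. \<forall>z\<in>UNIV. dist (staircase (Suc N) g x z) (g z *\<^sub>R x) < e"
    by (auto elim!: eventually_mono simp: divide_inverse intro: le_less_trans)
qed

text \<open>Summation by parts: weights on the fibres of a staircase become an unweighted sum over
  its superlevel sets.\<close>

lemma sum_mult_telescope:
  fixes s :: "nat \<Rightarrow> 'k::comm_ring_1"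
  shows "(\<Sum>j\<le>N. of_nat j * (s j - s (Suc j))) = (\<Sum>j=1..N. s j) - of_nat N * s (Suc N)"
  by (induction N) (simp_all add: algebra_simps)

text \<open>Since \<open>x \<noteq> 0\<close>, different levels have different values, so each fibre
  is the difference of two consecutive superlevel sets and summation by parts applies.\<close>

lemma (in banach_over) integral_staircase:
  fixes \<nu> :: "'z::topological_space set \<Rightarrow> 'v \<Rightarrow> 'k"
  assumes \<nu>: "i_measure scale (*) borel \<nu>" and g: "cutoff {} UNIV g" and "N > 0" "x \<noteq> 0"
  shows "(\<Sum>\<^sub>\<infinity>e\<in>UNIV. \<nu> (staircase N g x -` {e}) e) = level_average \<nu> N g x"
proof -
  interpret \<nu>x: countably_additive_function borel "\<lambda>A. \<nu> A y" for y
    using \<nu> by (rule i_measure_countably_additive)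
  have g': "continuous_on UNIV g" "\<And>z. 0 \<le> g z" "\<And>z. g z \<le> 1"
    using g by (auto simp: cutoff_def)
  let ?S = "\<lambda>j. {z. real j \<le> real N * g z}" and ?k = "\<lambda>z. nat \<lfloor>real N * g z\<rfloor>"
  let ?e = "\<lambda>j. (real j / real N) *\<^sub>R x"
  have inj: "inj_on ?e {..N}"
    using \<open>N > 0\<close> \<open>x \<noteq> 0\<close> by (auto simp: inj_on_def)
  have preimage: "staircase N g x -` {?e j} = {z. ?k z = j}" for j
    using \<open>N > 0\<close> \<open>x \<noteq> 0\<close> by (auto simp: staircase_def)
  have le: "?k z \<le> N" for z
  proof -
    have "real N * g z \<le> real N" using g'(3)[of z] by (simp add: mult_left_le)
    then have "\<lfloor>real N * g z\<rfloor> \<le> int N" by linarith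
    then show ?thesis by simp
  qed
  have "\<nu> (staircase N g x -` {e}) e = 0" if "e \<notin> ?e ` {..N}" for e
  proof -
    have "staircase N g x z \<in> ?e ` {..N}" for z
      using le[of z] by (auto simp: staircase_def)
    then have "staircase N g x -` {e} = {}" using that by auto
    then show ?thesis using \<nu>x.empty by simp
  qed
  then have "(\<Sum>\<^sub>\<infinity>e\<in>UNIV. \<nu> (staircase N g x -` {e}) e) = (\<Sum>\<^sub>\<infinity>e\<in>?e ` {..N}. \<nu> (staircase N g x -` {e}) e)"
    by (intro infsum_cong_neutral) auto
  also have "\<dots> = (\<Sum>j\<le>N. \<nu> {z. ?k z = j} (?e j))"
    using inj by (simp add: sum.reindex preimage)
  also have "\<dots> = (\<Sum>j\<le>N. of_nat j * (\<nu> (?S j) x - \<nu> (?S (Suc j)) x)) / of_nat N"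
    unfolding sum_divide_distrib
  proof (intro sum.cong refl)
    fix j
    have sets: "?S j \<in> sets borel" "?S (Suc j) \<in> sets borel"
      using staircase_level_set(1)[OF g'(1,2)] by blast+
    then have "{z. ?k z = j} \<in> sets borel"
      unfolding staircase_level_set(2)[OF g'(1,2)] by auto
    then have "\<nu> {z. ?k z = j} (scale (of_real (real j / real N)) x) = of_real (real j / real N) * \<nu> {z. ?k z = j} x"
      using \<nu> by (simp add: i_measure_def continuous_klinear_on_def)
    moreover have "\<nu> {z. ?k z = j} x = \<nu> (?S j) x - \<nu> (?S (Suc j)) x"
      unfolding staircase_level_set(2)[OF g'(1,2)]
      using sets by (intro \<nu>x.Diff) auto
    ultimately have "\<nu> {z. ?k z = j} (?e j) = of_real (real j / real N) * (\<nu> (?S j) x - \<nu> (?S (Suc j)) x)"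
      unfolding scale_of_real by simp
    then show "\<nu> {z. ?k z = j} (?e j) = of_nat j * (\<nu> (?S j) x - \<nu> (?S (Suc j)) x) / of_nat N"
      by simp
  qed
  also have "(\<Sum>j\<le>N. of_nat j * (\<nu> (?S j) x - \<nu> (?S (Suc j)) x)) = (\<Sum>j=1..N. \<nu> (?S j) x) - of_nat N * \<nu> (?S (Suc N)) x"
    by (rule sum_mult_telescope)
  \<comment> \<open>Here \<open>g \<le> 1\<close> enters: the boundary term of the summation by
    parts is a value at the empty set.\<close>
  also have "?S (Suc N) = {}"
  proof -
    have "real N * g z < real (Suc N)" for z
      using mult_left_le[OF g'(3)[of z], of "real N"] by simp
    then show ?thesis by (auto simp: not_le)
  qed
  finally show ?thesis by (simp add: level_average_def \<nu>x.empty)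
qed

section \<open>Operators on \<open>C\<^sub>0\<close>\<close>

lemma C0_iff_C0_fun: "f \<in> C0 \<longleftrightarrow> C0_fun (apply_bcontfun f)"
  by (simp add: C0_def C0_fun_def)

lemma C0_fun_bcontfun: "C0_fun f \<Longrightarrow> f \<in> bcontfun"
  by (metis C0_fun_bounded C0_fun_continuous bcontfun_normI)

lemma apply_Bcontfun_C0_fun: "C0_fun f \<Longrightarrow> apply_bcontfun (Bcontfun f) = f"
  by (simp add: Bcontfun_inverse C0_fun_bcontfun)

lemma Bcontfun_in_C0: "C0_fun f \<Longrightarrow> Bcontfun f \<in> C0"
  by (simp add: C0_iff_C0_fun apply_Bcontfun_C0_fun)

lemma op_norm_on_upper: "x \<in> S \<Longrightarrow> norm x \<le> 1 \<Longrightarrow> ereal (norm (T x)) \<le> op_norm_on S T"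
  unfolding op_norm_on_def by (rule SUP_upper) simp

lemma op_norm_on_least: "(\<And>x. x \<in> S \<Longrightarrow> norm x \<le> 1 \<Longrightarrow> ereal (norm (T x)) \<le> c) \<Longrightarrow> op_norm_on S T \<le> c"
  unfolding op_norm_on_def by (rule SUP_least) simp

lemma dual_spaceD:
  assumes "v \<in> dual_space s"
  shows "blinfun_apply v (s c y) = c * blinfun_apply v y"
  using assms by (simp add: dual_space_def continuous_klinear_on_def)

lemma dual_spaceI: "(\<And>c y. blinfun_apply v (s c y) = c * blinfun_apply v y) \<Longrightarrow> v \<in> dual_space s"
  by (simp add: dual_space_def continuous_klinear_on_def blinfun.add_right
      linear_continuous_on blinfun.bounded_linear_right)

lemma zero_in_dual_space: "0 \<in> dual_space s"
  by (rule dual_spaceI) simp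

lemma add_in_dual_space: "v \<in> dual_space s \<Longrightarrow> w \<in> dual_space s \<Longrightarrow> v + w \<in> dual_space s"
  by (rule dual_spaceI) (simp add: blinfun.add_left dual_spaceD distrib_left)

lemma diff_in_dual_space: "v \<in> dual_space s \<Longrightarrow> w \<in> dual_space s \<Longrightarrow> v - w \<in> dual_space s"
  by (rule dual_spaceI) (simp add: blinfun.diff_left dual_spaceD right_diff_distrib)

lemma dual_scale_apply: "blinfun_apply (dual_scale c v) y = c * blinfun_apply v y"
  by (simp add: dual_scale_def)

lemma dual_scale_in_dual_space: "v \<in> dual_space s \<Longrightarrow> dual_scale c v \<in> dual_space s"
  by (rule dual_spaceI) (simp add: dual_scale_apply dual_spaceD mult.left_commute)

lemma dual_scale_of_real: "dual_scale (of_real r) v = r *\<^sub>R v"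
  by (rule blinfun_eqI) (simp add: dual_scale_apply blinfun.scaleR_left scaleR_conv_of_real)

lemma dual_onI:
  fixes \<tau> :: "('f::real_normed_vector \<Rightarrow>\<^sub>L 'k::real_or_complex) \<Rightarrow> 'k"
  assumes "\<tau> \<in> extensional (dual_space s)"
    and add: "\<And>v w. v \<in> dual_space s \<Longrightarrow> w \<in> dual_space s \<Longrightarrow> \<tau> (v + w) = \<tau> v + \<tau> w"
    and scale: "\<And>c v. v \<in> dual_space s \<Longrightarrow> \<tau> (dual_scale c v) = c * \<tau> v"
    and bound: "\<And>v. v \<in> dual_space s \<Longrightarrow> norm (\<tau> v) \<le> b * norm v" and "b \<ge> 0"
  shows "\<tau> \<in> dual_on dual_scale (dual_space s)"
proof -
  have "b-lipschitz_on (dual_space s) \<tau>"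
  proof (rule lipschitz_onI)
    fix v w assume *: "v \<in> dual_space s" "w \<in> dual_space s"
    then have "\<tau> v - \<tau> w = \<tau> (v - w)"
      using add[OF diff_in_dual_space[OF *] *(2)] by simp
    then show "dist (\<tau> v) (\<tau> w) \<le> b * dist v w"
      using bound[OF diff_in_dual_space[OF *]] by (simp add: dist_norm)
  qed fact
  then show ?thesis
    using assms by (auto simp: dual_on_def continuous_klinear_on_def intro: lipschitz_on_continuous_on)
qed

text \<open>The measure of \<open>T\<close> is extensional and agrees with the scalar representing
  measures on Borel sets only; their properties are transferred by congruence.\<close>

lemma i_measure_cong:
  assumes "\<And>A. A \<in> sets M \<Longrightarrow> \<nu> A = \<nu>' A"
  shows "i_measure sE sG M \<nu> \<longleftrightarrow> i_measure sE sG M \<nu>'"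
proof -
  have "\<nu> (A n) = \<nu>' (A n)" "\<nu> (\<Union>n. A n) = \<nu>' (\<Union>n. A n)"
    if "range A \<subseteq> sets M" for A and n :: nat
    using that by (auto intro!: assms)
  then show ?thesis
    unfolding i_measure_def by (simp add: assms cong: conj_cong ball_cong imp_cong)
qed

lemma regular_i_measure_cong:
  assumes "\<And>A. A \<in> sets borel \<Longrightarrow> \<nu> A = \<nu>' A"
  shows "regular_i_measure sE sG \<nu> \<longleftrightarrow> regular_i_measure sE sG \<nu>'"
proof -
  have "i_measure sE sG borel \<nu> \<longleftrightarrow> i_measure sE sG borel \<nu>'"
    by (rule i_measure_cong) (rule assms)
  then show ?thesis
    unfolding regular_i_measure_def by (simp add: assms cong: ball_cong)
qed

lemma ereal_tendsto_zeroI: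
  fixes u :: "nat \<Rightarrow> ereal"
  assumes "\<And>n. 0 \<le> u n" "\<And>\<epsilon>. \<epsilon> > 0 \<Longrightarrow> \<forall>\<^sub>F n in sequentially. u n \<le> ereal \<epsilon>"
  shows "u \<longlonglongrightarrow> 0"
proof (rule order_tendstoI)
  fix a :: ereal assume "a < 0"
  then show "\<forall>\<^sub>F n in sequentially. a < u n"
    by (intro always_eventually allI less_le_trans[OF _ assms(1)])
next
  fix a :: ereal assume "0 < a"
  then obtain \<epsilon> where "0 < ereal \<epsilon>" "ereal \<epsilon> < a"
    using ereal_dense2[of 0 a] by auto
  then show "\<forall>\<^sub>F n in sequentially. u n < a"
    using eventually_mono[OF assms(2)[of \<epsilon>], of "\<lambda>n. u n < a"] by auto
qed

locale C0_operator = E: banach_over sE + F: banach_over sF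
  for sE :: "'k::real_or_complex \<Rightarrow> 'e::banach \<Rightarrow> 'e" and sF :: "'k \<Rightarrow> 'f::banach \<Rightarrow> 'f" +
  fixes T :: "('z::t2_space \<Rightarrow>\<^sub>C 'e) \<Rightarrow> 'f"
  assumes locally_compact: "locally_compact_space (euclidean :: 'z topology)"
    and T: "continuous_klinear_on C0 (bcontfun_scale sE) sF T"
begin

lemma T_add: "f \<in> C0 \<Longrightarrow> g \<in> C0 \<Longrightarrow> T (f + g) = T f + T g"
  using T by (simp add: continuous_klinear_on_def)

lemma T_scale: "f \<in> C0 \<Longrightarrow> T (bcontfun_scale sE c f) = sF c (T f)"
  using T by (simp add: continuous_klinear_on_def)

lemma T_scaleR:
  assumes "f \<in> C0"
  shows "T (r *\<^sub>R f) = r *\<^sub>R T f"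
proof -
  have "bcontfun_scale sE (of_real r) f = r *\<^sub>R f"
    by (rule bcontfun_eqI) (simp add: bcontfun_scale_def E.scale_of_real Bcontfun_inverse[OF scaleR_cont[OF apply_bcontfun]])
  then show ?thesis
    using T_scale[OF assms, of "of_real r"] by (simp add: F.scale_of_real)
qed

lemma zero_in_C0: "0 \<in> C0"
  by (simp add: C0_iff_C0_fun C0_fun_zero)

lemma scaleR_in_C0: "f \<in> C0 \<Longrightarrow> r *\<^sub>R f \<in> C0"
  using C0_fun_scaleR[of "apply_bcontfun f" "\<lambda>_. r" "\<bar>r\<bar>"] by (simp add: C0_iff_C0_fun)

lemma ex_op_norm: "\<exists>b. op_norm_on C0 T = ereal b \<and> b \<ge> 0 \<and> (\<forall>f\<in>C0. norm (T f) \<le> b * norm f)"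
proof -
  have T0: "T 0 = 0" using T_scaleR[OF zero_in_C0, of 0] by simp
  have "continuous_on C0 T" using T by (simp add: continuous_klinear_on_def)
  then have "\<exists>d>0. \<forall>f\<in>C0. dist f 0 < d \<longrightarrow> dist (T f) (T 0) < 1"
    using zero_in_C0 unfolding continuous_on_iff by (meson zero_less_one)
  then obtain d where d: "d > 0" "\<And>f. f \<in> C0 \<Longrightarrow> norm f < d \<Longrightarrow> norm (T f) < 1"
    by (auto simp: T0)
  \<comment> \<open>The factor \<open>d / 2\<close> brings the closed unit ball into the open ball
    of radius \<open>d\<close>, where the norm of \<open>T\<close> stays below 1.\<close>
  have "op_norm_on C0 T \<le> ereal (2 / d)"
  proof (rule op_norm_on_least)
    fix f :: "'z \<Rightarrow>\<^sub>C 'e" assume f: "f \<in> C0" "norm f \<le> 1"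
    have "norm ((d / 2) *\<^sub>R f) \<le> d / 2"
      using f(2) d(1) by (simp add: mult_left_le)
    then have "norm ((d / 2) *\<^sub>R f) < d"
      using d(1) by simp
    then have "norm (T ((d / 2) *\<^sub>R f)) < 1"
      using d(2) scaleR_in_C0[OF f(1)] by blast
    then show "ereal (norm (T f)) \<le> ereal (2 / d)"
      using d(1) by (simp add: T_scaleR[OF f(1)] field_simps)
  qed
  moreover have "0 \<le> op_norm_on C0 T"
    using op_norm_on_upper[OF zero_in_C0, of T] by (simp add: T0 zero_ereal_def)
  ultimately obtain b where b: "op_norm_on C0 T = ereal b" "b \<ge> 0"
    by (cases "op_norm_on C0 T") auto
  have "norm (T f) \<le> b * norm f" if f: "f \<in> C0" for f
  proof (cases "f = 0")
    case False
    have "ereal (norm (T ((1 / norm f) *\<^sub>R f))) \<le> op_norm_on C0 T"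
      using False by (intro op_norm_on_upper scaleR_in_C0 f) simp
    then show ?thesis
      using False by (simp add: b(1) T_scaleR[OF f] field_simps)
  qed (simp add: T0)
  with b show ?thesis by blast
qed

definition op_norm :: real where
  "op_norm = (SOME b. op_norm_on C0 T = ereal b \<and> b \<ge> 0 \<and> (\<forall>f\<in>C0. norm (T f) \<le> b * norm f))"

lemma op_norm_on_eq: "op_norm_on C0 T = ereal op_norm"
  and op_norm_nonneg: "op_norm \<ge> 0"
  and norm_T_le: "f \<in> C0 \<Longrightarrow> norm (T f) \<le> op_norm * norm f"
  using someI_ex[OF ex_op_norm] by (simp_all add: op_norm_def)

definition functional :: "('f \<Rightarrow>\<^sub>L 'k) \<Rightarrow> ('z \<Rightarrow> 'e) \<Rightarrow> 'k" where
  "functional v f = blinfun_apply v (T (Bcontfun f))"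

lemma C0_functional_functional:
  assumes v: "v \<in> dual_space sF"
  shows "C0_functional sE (functional v) (op_norm * norm v)"
proof (unfold_locales)
  show "locally_compact_space (euclidean :: 'z topology)" by (rule locally_compact)
next
  fix f g :: "'z \<Rightarrow> 'e" assume f: "C0_fun f" and g: "C0_fun g"
  have "Bcontfun (\<lambda>z. f z + g z) = Bcontfun f + Bcontfun g"
    by (rule bcontfun_eqI) (simp add: apply_Bcontfun_C0_fun f g C0_fun_add)
  then show "functional v (\<lambda>z. f z + g z) = functional v f + functional v g"
    by (simp add: functional_def T_add Bcontfun_in_C0 f g blinfun.add_right)
next
  fix f :: "'z \<Rightarrow> 'e" and c assume f: "C0_fun f"
  have "Bcontfun (\<lambda>z. sE c (f z)) = bcontfun_scale sE c (Bcontfun f)"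
    by (simp add: bcontfun_scale_def apply_Bcontfun_C0_fun f)
  then show "functional v (\<lambda>z. sE c (f z)) = c * functional v f"
    by (simp add: functional_def T_scale Bcontfun_in_C0 f dual_spaceD[OF v])
next
  fix f :: "'z \<Rightarrow> 'e" and b assume f: "C0_fun f" and b: "\<And>z. norm (f z) \<le> b"
  have "norm (functional v f) \<le> norm v * norm (T (Bcontfun f))"
    unfolding functional_def by (rule norm_blinfun)
  also have "\<dots> \<le> norm v * (op_norm * norm (Bcontfun f))"
    using norm_T_le[OF Bcontfun_in_C0[OF f]] by (intro mult_left_mono) auto
  also have "\<dots> \<le> norm v * (op_norm * b)"
    using b by (intro mult_left_mono norm_bound op_norm_nonneg) (simp_all add: apply_Bcontfun_C0_fun f)
  finally show "norm (functional v f) \<le> op_norm * norm v * b"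
    by (simp add: mult_ac)
qed

text \<open>The restrictions in \<open>A\<close> and \<open>v\<close> meet the extensionality
  demanded of measures and of functionals on the dual.\<close>

definition rep_measure :: "'z set \<Rightarrow> 'e \<Rightarrow> ('f \<Rightarrow>\<^sub>L 'k) \<Rightarrow> 'k" where
  "rep_measure = (\<lambda>A\<in>sets borel. \<lambda>x. \<lambda>v\<in>dual_space sF. representing (functional v) A x)"

lemma rep_measure_eq:
  "A \<in> sets borel \<Longrightarrow> v \<in> dual_space sF \<Longrightarrow> rep_measure A x v = representing (functional v) A x"
  by (simp add: rep_measure_def)

lemma norm_rep_measure_le:
  assumes A: "A \<in> sets borel" and v: "v \<in> dual_space sF"
  shows "norm (rep_measure A x v) \<le> op_norm * norm x * norm v"
proof -
  interpret C0_functional sE "functional v" "op_norm * norm v"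
    by (rule C0_functional_functional[OF v])
  have "norm (representing (functional v) A x) \<le> norm x * (op_norm * norm v)"
    by (intro order_trans[OF norm_\<nu>_le[OF A]] mult_left_mono variation_le_B) simp
  then show ?thesis
    by (simp add: rep_measure_eq A v mult_ac)
qed

text \<open>The functionals of \<open>v\<close>, \<open>w\<close> and \<open>v + w\<close> have
  their own variation measures, so linearity in \<open>v\<close> is taken from the calculus of
  cutoff limits, in which no variation occurs.\<close>

lemma rep_measure_in_operators_to_dual:
  assumes A: "A \<in> sets borel"
  shows "rep_measure A \<in> operators_to_dual sE dual_scale (dual_space sF)"
  unfolding operators_to_dual_def
proof (intro CollectI conjI allI ballI)
  have lim: "cutoff_limit (functional v) A x (representing (functional v) A x)"
    if "v \<in> dual_space sF" for v x
    by (rule C0_functional.cutoff_limit_\<nu>[OF C0_functional_functional[OF that] A])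
  show "rep_measure A x \<in> dual_on dual_scale (dual_space sF)" for x
  proof (rule dual_onI[where b = "op_norm * norm x"])
    show "rep_measure A x \<in> extensional (dual_space sF)"
      using A by (simp add: rep_measure_def)
    fix v w assume v: "v \<in> dual_space sF" and w: "w \<in> dual_space sF"
    have "representing (functional (v + w)) A x =
        representing (functional v) A x + representing (functional w) A x"
      by (rule representing_eqI[OF locally_compact cutoff_limit_add[OF lim[OF v] lim[OF w]]])
        (simp add: functional_def blinfun.add_left)
    then show "rep_measure A x (v + w) = rep_measure A x v + rep_measure A x w"
      using v w by (simp add: rep_measure_eq A add_in_dual_space)
  next
    fix c v assume v: "v \<in> dual_space sF"
    have "representing (functional (dual_scale c v)) A x = c * representing (functional v) A x"
      by (rule representing_eqI[OF locally_compact cutoff_limit_mult[OF lim[OF v]]])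
        (simp add: functional_def dual_scale_apply)
    then show "rep_measure A x (dual_scale c v) = c * rep_measure A x v"
      using v by (simp add: rep_measure_eq A dual_scale_in_dual_space)
  qed (use A norm_rep_measure_le op_norm_nonneg in auto)
  show "rep_measure A (x + y) v = rep_measure A x v + rep_measure A y v" if "v \<in> dual_space sF" for x y v
    using C0_functional.\<nu>_add[OF C0_functional_functional[OF that] A] by (simp add: rep_measure_eq A that)
  show "rep_measure A (sE c x) v = c * rep_measure A x v" if "v \<in> dual_space sF" for c x v
    using C0_functional.\<nu>_scale[OF C0_functional_functional[OF that] A] by (simp add: rep_measure_eq A that)
  show "\<exists>B. \<forall>x. op_norm_on (dual_space sF) (rep_measure A x) \<le> ereal (B * norm x)"
  proof (intro exI[of _ op_norm] allI op_norm_on_least)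
    fix x v assume v: "v \<in> dual_space sF" "norm v \<le> 1"
    have "norm (rep_measure A x v) \<le> op_norm * norm x * norm v"
      by (rule norm_rep_measure_le[OF A v(1)])
    also have "\<dots> \<le> op_norm * norm x"
      using v(2) op_norm_nonneg by (simp add: mult_left_le)
    finally show "ereal (norm (rep_measure A x v)) \<le> ereal (op_norm * norm x)" by simp
  qed
qed

lemma regular_rep_measure: "regular_weak_star_i_measure sE dual_scale (dual_space sF) rep_measure"
proof -
  have reg: "regular_i_measure sE (*) (\<lambda>A x. rep_measure A x v)" if v: "v \<in> dual_space sF" for v
    using C0_functional.regular_i_measure_\<nu>[OF C0_functional_functional[OF v]]
    by (subst regular_i_measure_cong[where \<nu>' = "representing (functional v)"])
      (auto simp: rep_measure_eq v)
  moreover have "rep_measure \<in> sets borel \<rightarrow>\<^sub>E operators_to_dual sE dual_scale (dual_space sF)"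
    using rep_measure_in_operators_to_dual by (auto simp: rep_measure_def PiE_iff extensional_def)
  ultimately show ?thesis
    by (simp add: regular_weak_star_i_measure_def weak_star_i_measure_def regular_i_measure_def)
qed

lemma norm_simple_integral_diff_le:
  assumes v: "v \<in> dual_space sF" and f: "f \<in> C0" and g: "g \<in> countably_valued borel"
    and close: "\<And>z. norm (apply_bcontfun f z - g z) \<le> \<delta>" and "\<delta> > 0"
  shows "norm (simple_weak_star_integral (dual_space sF) borel rep_measure g v - blinfun_apply v (T f))
    \<le> \<delta> * (op_norm * norm v)"
proof -
  have "g -` {e} \<in> sets borel" for e
    using g by (simp add: countably_valued_def)
  then have "simple_weak_star_integral (dual_space sF) borel rep_measure g v =
      (\<Sum>\<^sub>\<infinity>e\<in>UNIV. representing (functional v) (g -` {e}) e)"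
    using v by (simp add: simple_weak_star_integral_def rep_measure_eq)
  moreover have "functional v (apply_bcontfun f) = blinfun_apply v (T f)"
    by (simp add: functional_def apply_bcontfun_inverse)
  ultimately show ?thesis
    using C0_functional.norm_integral_diff_\<Phi>_le[OF C0_functional_functional[OF v] _ g close \<open>\<delta> > 0\<close>] f
    by (simp add: C0_iff_C0_fun)
qed

text \<open>The error \<open>\<delta> * op_norm\<close> is common to all \<open>v\<close> in the
  unit ball, although each \<open>v\<close> has its own measure; hence the integrals converge in
  norm and not just pointwise in \<open>v\<close>.\<close>

lemma has_integral_rep_measure:
  assumes f: "f \<in> C0"
  shows "has_weak_star_integral dual_scale (dual_space sF) borel rep_measure
    (apply_bcontfun f) (canonical_embedding sF (T f))"
  unfolding has_weak_star_integral_def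
proof (intro conjI allI impI)
  show "apply_bcontfun f \<in> uniformly_measurable borel"
    using f by (simp add: C0_iff_C0_fun C0_fun_uniformly_measurable)
  show "canonical_embedding sF (T f) \<in> dual_on dual_scale (dual_space sF)"
    unfolding canonical_embedding_def
    by (rule dual_onI[where b = "norm (T f)"])
      (simp_all add: add_in_dual_space dual_scale_in_dual_space blinfun.add_left dual_scale_apply
        norm_blinfun mult.commute[of "norm (T f)"])
  fix g :: "nat \<Rightarrow> 'z \<Rightarrow> 'e"
  assume g: "\<forall>n. g n \<in> countably_valued borel"
    and lim: "uniform_limit (space borel) g (apply_bcontfun f) sequentially"
  let ?d = "\<lambda>n v. simple_weak_star_integral (dual_space sF) borel rep_measure (g n) v -
    canonical_embedding sF (T f) v"
  show "(\<lambda>n. op_norm_on (dual_space sF) (?d n)) \<longlonglongrightarrow> 0"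
  proof (rule ereal_tendsto_zeroI)
    show "0 \<le> op_norm_on (dual_space sF) (?d n)" for n
      by (rule order_trans[OF _ op_norm_on_upper[OF zero_in_dual_space]]) (simp_all add: zero_ereal_def)
    fix \<epsilon> :: real assume "\<epsilon> > 0"
    define \<delta> where "\<delta> = \<epsilon> / (op_norm + 1)"
    have \<delta>: "\<delta> > 0" "\<delta> * op_norm \<le> \<epsilon>"
      using \<open>\<epsilon> > 0\<close> op_norm_nonneg mult_divide_add_one_le[of op_norm \<epsilon>]
      by (auto simp: \<delta>_def mult.commute)
    have "\<forall>\<^sub>F n in sequentially. \<forall>z\<in>space borel. dist (g n z) (apply_bcontfun f z) < \<delta>"
      using lim \<delta>(1) by (rule uniform_limitD)
    then show "\<forall>\<^sub>F n in sequentially. op_norm_on (dual_space sF) (?d n) \<le> ereal \<epsilon>"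
    proof eventually_elim
      case (elim n)
      then have close: "norm (apply_bcontfun f z - g n z) \<le> \<delta>" for z
        by (simp add: dist_norm norm_minus_commute less_imp_le)
      show ?case
      proof (rule op_norm_on_least)
        fix v :: "'f \<Rightarrow>\<^sub>L 'k" assume v: "v \<in> dual_space sF" "norm v \<le> 1"
        have "norm (?d n v) \<le> \<delta> * (op_norm * norm v)"
          using norm_simple_integral_diff_le[OF v(1) f _ close \<delta>(1)] g v(1)
          by (simp add: canonical_embedding_def)
        also have "\<dots> \<le> \<delta> * op_norm"
          using v(2) op_norm_nonneg \<delta>(1) by (simp add: mult_left_le)
        finally show "ereal (norm (?d n v)) \<le> ereal \<epsilon>" using \<delta>(2) by simp
      qed
    qed
  qed
qed

text \<open>Any competitor is tested on the staircase approximations of \<open>g x\<close>: their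
  integrals are averages over level sets, and the limit depends on \<open>T\<close> alone. This
  makes two competitors comparable on level sets.\<close>

lemma level_average_tendsto:
  assumes reg: "regular_weak_star_i_measure sE dual_scale (dual_space sF) \<mu>"
    and int: "\<And>f. f \<in> C0 \<Longrightarrow> has_weak_star_integral dual_scale (dual_space sF) borel \<mu>
      (apply_bcontfun f) (canonical_embedding sF (T f))"
    and v: "v \<in> dual_space sF" "norm v \<le> 1" and g: "cutoff {} UNIV g" and "x \<noteq> 0"
  shows "(\<lambda>N. level_average (\<lambda>A x. \<mu> A x v) (Suc N) g x) \<longlonglongrightarrow> functional v (\<lambda>z. g z *\<^sub>R x)"
proof -
  let ?f = "Bcontfun (\<lambda>z. g z *\<^sub>R x)"
  have C0: "C0_fun (\<lambda>z. g z *\<^sub>R x)" using g by (rule cutoff_C0_fun)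
  let ?d = "\<lambda>N v. simple_weak_star_integral (dual_space sF) borel \<mu> (staircase (Suc N) g x) v -
    canonical_embedding sF (T ?f) v"
  have "has_weak_star_integral dual_scale (dual_space sF) borel \<mu> (\<lambda>z. g z *\<^sub>R x) (canonical_embedding sF (T ?f))"
    using int[OF Bcontfun_in_C0[OF C0]] by (simp add: apply_Bcontfun_C0_fun[OF C0])
  then have lim: "(\<lambda>N. op_norm_on (dual_space sF) (?d N)) \<longlonglongrightarrow> 0"
    unfolding has_weak_star_integral_def
    by (elim conjE allE[of _ "\<lambda>N. staircase (Suc N) g x"])
      (use staircase_countably_valued[OF g] staircase_uniform_limit[OF g] in auto)
  have bounds: "0 \<le> ereal (norm (?d N v))" "ereal (norm (?d N v)) \<le> op_norm_on (dual_space sF) (?d N)" for N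
    using op_norm_on_upper[OF v, of "?d N"] by simp_all
  have "(\<lambda>N. ereal (norm (?d N v))) \<longlonglongrightarrow> 0"
    by (rule tendsto_sandwich[OF _ _ tendsto_const lim]; rule always_eventually, rule allI, rule bounds)
  then have "(\<lambda>N. ?d N v) \<longlonglongrightarrow> 0"
    by (simp add: zero_ereal_def tendsto_norm_zero_iff)
  moreover have "?d N v = level_average (\<lambda>A x. \<mu> A x v) (Suc N) g x - functional v (\<lambda>z. g z *\<^sub>R x)" for N
  proof -
    have "i_measure sE (*) borel (\<lambda>A x. \<mu> A x v)"
      using reg v(1) by (simp add: regular_weak_star_i_measure_def regular_i_measure_def)
    then have "(\<Sum>\<^sub>\<infinity>e\<in>UNIV. \<mu> (staircase (Suc N) g x -` {e}) e v) = level_average (\<lambda>A x. \<mu> A x v) (Suc N) g x"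
      using g \<open>x \<noteq> 0\<close> by (intro E.integral_staircase) auto
    then show ?thesis
      using v(1) by (simp add: simple_weak_star_integral_def canonical_embedding_def functional_def)
  qed
  ultimately show ?thesis
    by (simp add: LIM_zero_iff)
qed

lemma rep_measure_unique:
  assumes reg: "regular_weak_star_i_measure sE dual_scale (dual_space sF) \<mu>"
    and int: "\<And>f. f \<in> C0 \<Longrightarrow> has_weak_star_integral dual_scale (dual_space sF) borel \<mu>
      (apply_bcontfun f) (canonical_embedding sF (T f))"
  shows "\<mu> = rep_measure"
proof -
  have mem: "\<mu> \<in> sets borel \<rightarrow>\<^sub>E operators_to_dual sE dual_scale (dual_space sF)"
    "rep_measure \<in> sets borel \<rightarrow>\<^sub>E operators_to_dual sE dual_scale (dual_space sF)"
    using reg regular_rep_measure by (simp_all add: regular_weak_star_i_measure_def weak_star_i_measure_def)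
  show ?thesis
  proof (rule PiE_ext[OF mem])
    fix A :: "'z set" assume A: "A \<in> sets borel"
    have dual: "\<mu> A \<in> operators_to_dual sE dual_scale (dual_space sF)"
      "rep_measure A \<in> operators_to_dual sE dual_scale (dual_space sF)"
      using mem A by (auto simp: PiE_iff)
    have unit: "\<mu> A x v = rep_measure A x v" if v: "v \<in> dual_space sF" "norm v \<le> 1" for x v
    proof (cases "x = 0")
      case True
      \<comment> \<open>The staircase computation excludes the zero vector, so this case rests on
        homogeneity of the operators.\<close>
      have zero: "\<tau> 0 v = 0" if "\<tau> \<in> operators_to_dual sE dual_scale (dual_space sF)" for \<tau>
      proof -
        have "\<tau> (sE 0 0) v = 0 * \<tau> 0 v"
          using that v(1) unfolding operators_to_dual_def by blast
        then show ?thesis by simp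
      qed
      show ?thesis using True zero[OF dual(1)] zero[OF dual(2)] by simp
    next
      case False
      show ?thesis
      proof (rule regular_i_measure_eqI[where \<nu> = "\<lambda>A x. rep_measure A x v" and \<nu>' = "\<lambda>A x. \<mu> A x v",
            OF locally_compact _ _ _ A])
        show "regular_i_measure sE (*) (\<lambda>A x. \<mu> A x v)" "regular_i_measure sE (*) (\<lambda>A x. rep_measure A x v)"
          using reg regular_rep_measure v(1) by (simp_all add: regular_weak_star_i_measure_def)
        fix g :: "'z \<Rightarrow> real" assume g: "cutoff {} UNIV g"
        show "(\<lambda>N. level_average (\<lambda>A x. \<mu> A x v) (Suc N) g x -
            level_average (\<lambda>A x. rep_measure A x v) (Suc N) g x) \<longlonglongrightarrow> 0"
          using tendsto_diff[OF level_average_tendsto[OF reg int v g False]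
              level_average_tendsto[OF regular_rep_measure has_integral_rep_measure v g False]]
          by simp
      qed
    qed
    show "\<mu> A = rep_measure A"
    proof
      fix x
      have dual_x: "\<mu> A x \<in> dual_on dual_scale (dual_space sF)" "rep_measure A x \<in> dual_on dual_scale (dual_space sF)"
        using dual by (auto simp: operators_to_dual_def)
      show "\<mu> A x = rep_measure A x"
      proof (rule extensionalityI)
        show "\<mu> A x \<in> extensional (dual_space sF)" "rep_measure A x \<in> extensional (dual_space sF)"
          using dual_x by (auto simp: dual_on_def)
        fix v assume v: "v \<in> dual_space sF"
        \<comment> \<open>For \<open>v = 0\<close> the factor \<open>1 / norm v\<close> is 0 by
          convention, so \<open>u\<close> is 0 and \<open>v_eq\<close> below still holds.\<close>
        define u where "u = (1 / norm v) *\<^sub>R v"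
        have "u \<in> dual_space sF"
          unfolding u_def using dual_scale_in_dual_space[OF v, of "of_real (1 / norm v)"]
          by (simp only: dual_scale_of_real)
        moreover have "norm u \<le> 1" by (simp add: u_def)
        ultimately have u: "u \<in> dual_space sF" "norm u \<le> 1" .
        have v_eq: "v = dual_scale (of_real (norm v)) u"
          unfolding u_def dual_scale_of_real by simp
        have homogeneous: "\<tau> v = of_real (norm v) * \<tau> u" if "\<tau> \<in> dual_on dual_scale (dual_space sF)" for \<tau>
          using that u(1) by (subst v_eq) (simp add: dual_on_def continuous_klinear_on_def)
        show "\<mu> A x v = rep_measure A x v"
          unfolding homogeneous[OF dual_x(1)] homogeneous[OF dual_x(2)] by (simp add: unit[OF u])
      qed
    qed
  qed
qed

section \<open>Equality of the operator norm and the semivariation\<close>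

lemma total_semivariation_rep_measure_le:
  "total_semivariation (dual_space sF) borel rep_measure \<le> ereal op_norm"
  unfolding total_semivariation_def
proof (rule Sup_least, clarify, rule op_norm_on_least)
  fix N :: nat and A :: "nat \<Rightarrow> 'z set" and x :: "nat \<Rightarrow> 'e" and v
  assume A: "\<forall>n<N. A n \<in> sets borel \<and> norm (x n) \<le> 1" "disjoint_family_on A {..<N}"
    and v: "v \<in> dual_space sF" "norm v \<le> 1"
  have "norm (\<Sum>n<N. rep_measure (A n) (x n) v) \<le> (\<Sum>n<N. norm (rep_measure (A n) (x n) v))"
    by (rule norm_sum)
  also have "\<dots> = (\<Sum>n<N. norm (representing (functional v) (A n) (x n)))"
    using A(1) v(1) by (intro sum.cong) (auto simp: rep_measure_eq)
  also have "\<dots> \<le> 1 * (op_norm * norm v)"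
    using A by (intro C0_functional.norm_sum_\<nu>_le[OF C0_functional_functional[OF v(1)]]) auto
  also have "\<dots> \<le> op_norm"
    using v(2) op_norm_nonneg by (simp add: mult_left_le)
  finally show "ereal (norm (\<Sum>n<N. rep_measure (A n) (x n) v)) \<le> ereal op_norm" by simp
qed

text \<open>The fibres of \<open>g\<close>, with its values as vectors, are one of the families in
  the supremum that defines the semivariation; the bijection \<open>h\<close> provides their
  enumeration.\<close>

lemma norm_finite_integral_le_total_semivariation:
  assumes v: "v \<in> dual_space sF" "norm v \<le> 1" and g: "finite (range g)" "\<And>y. g -` {y} \<in> sets borel"
    and le: "\<And>z. norm (g z) \<le> 1"
  shows "ereal (norm (simple_weak_star_integral (dual_space sF) borel rep_measure g v))
    \<le> total_semivariation (dual_space sF) borel rep_measure"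
proof -
  obtain h where h: "bij_betw h {..<card (range g)} (range g)"
    using ex_bij_betw_nat_finite[OF g(1)] by (auto simp: atLeast0LessThan)
  let ?N = "card (range g)"
  have zero: "rep_measure {} e v = 0" for e
    using C0_functional.\<nu>_empty[OF C0_functional_functional[OF v(1)]] by (simp add: rep_measure_eq v(1))
  have "rep_measure (g -` {e}) e v = 0" if "e \<notin> range g" for e
  proof -
    have "g -` {e} = {}" using that by auto
    then show ?thesis by (simp add: zero)
  qed
  then have "(\<Sum>\<^sub>\<infinity>e\<in>UNIV. rep_measure (g -` {e}) e v) = (\<Sum>\<^sub>\<infinity>e\<in>range g. rep_measure (g -` {e}) e v)"
    by (intro infsum_cong_neutral) auto
  also have "\<dots> = (\<Sum>n<?N. rep_measure (g -` {h n}) (h n) v)"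
    using g(1) sum.reindex_bij_betw[OF h, of "\<lambda>e. rep_measure (g -` {e}) e v"] by simp
  finally have "simple_weak_star_integral (dual_space sF) borel rep_measure g v =
      (\<Sum>n<?N. rep_measure (g -` {h n}) (h n) v)"
    using v(1) by (simp add: simple_weak_star_integral_def)
  also have "ereal (norm \<dots>) \<le> op_norm_on (dual_space sF) (\<lambda>v. \<Sum>n<?N. rep_measure (g -` {h n}) (h n) v)"
    using v by (rule op_norm_on_upper)
  also have "\<dots> \<le> total_semivariation (dual_space sF) borel rep_measure"
    unfolding total_semivariation_def
  proof (rule Sup_upper, intro CollectI exI[of _ ?N] exI[of _ "\<lambda>n. g -` {h n}"] exI[of _ h]
        conjI allI impI refl)
    fix n assume "n < ?N"
    then have "h n \<in> range g" using h by (auto simp: bij_betw_def)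
    then show "norm (h n) \<le> 1" using le by auto
  next
    show "disjoint_family_on (\<lambda>n. g -` {h n}) {..<?N}"
      using h by (auto simp: disjoint_family_on_def bij_betw_def inj_on_def)
  qed (rule g(2))
  finally show ?thesis .
qed

text \<open>A functional that norms \<open>T f\<close> reduces the claim to scalars. There
  \<open>f\<close> is replaced by finitely valued functions in the unit ball, whose integrals the
  semivariation controls, at an error that vanishes with \<open>\<delta>\<close>.\<close>

lemma op_norm_le_total_semivariation:
  "op_norm_on C0 T \<le> total_semivariation (dual_space sF) borel rep_measure"
proof (rule op_norm_on_least)
  fix f :: "'z \<Rightarrow>\<^sub>C 'e" assume f: "f \<in> C0" "norm f \<le> 1"
  obtain v where v: "v \<in> dual_space sF" "norm v \<le> 1" "norm (blinfun_apply v (T f)) = norm (T f)"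
    using F.ex_norming_functional by blast
  have "\<exists>g. norm (T f) \<le> norm (simple_weak_star_integral (dual_space sF) borel rep_measure g v) + \<delta> * op_norm \<and>
    ereal (norm (simple_weak_star_integral (dual_space sF) borel rep_measure g v))
      \<le> total_semivariation (dual_space sF) borel rep_measure" if "\<delta> > 0" for \<delta>
  proof -
    obtain g where g: "finite (range g)" "range g \<subseteq> insert 0 (range (apply_bcontfun f))"
      "\<And>y. g -` {y} \<in> sets borel" "\<And>z. norm (apply_bcontfun f z - g z) < \<delta>"
      using C0_fun_finite_valued_approx[OF _ \<open>\<delta> > 0\<close>] f(1) by (metis C0_iff_C0_fun)
    have "norm (apply_bcontfun f z) \<le> 1" for z
      using norm_bounded[of f z] f(2) by simp
    moreover have "g z = 0 \<or> g z \<in> range (apply_bcontfun f)" for z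
      using g(2) by auto
    ultimately have le: "norm (g z) \<le> 1" for z
      by (metis norm_zero rangeE zero_le_one)
    have "norm (simple_weak_star_integral (dual_space sF) borel rep_measure g v - blinfun_apply v (T f))
        \<le> \<delta> * (op_norm * norm v)"
      using g by (intro norm_simple_integral_diff_le[OF v(1) f(1)] \<open>\<delta> > 0\<close> finite_valued_in_countably_valued)
        (auto intro: less_imp_le)
    also have "\<dots> \<le> \<delta> * op_norm"
      using v(2) op_norm_nonneg \<open>\<delta> > 0\<close> by (simp add: mult_left_le)
    finally have "norm (T f) \<le> norm (simple_weak_star_integral (dual_space sF) borel rep_measure g v) + \<delta> * op_norm"
      using norm_triangle_ineq2[of "blinfun_apply v (T f)"
          "simple_weak_star_integral (dual_space sF) borel rep_measure g v"] v(3)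
      by (simp add: norm_minus_commute)
    then show ?thesis
      using norm_finite_integral_le_total_semivariation[OF v(1,2) g(1,3) le] by blast
  qed
  note approx = this
  show "ereal (norm (T f)) \<le> total_semivariation (dual_space sF) borel rep_measure"
  proof (cases "total_semivariation (dual_space sF) borel rep_measure")
    case (real s)
    have "norm (T f) \<le> s + \<delta> * op_norm" if "\<delta> > 0" for \<delta>
      using approx[OF that] real by auto
    then have "norm (T f) \<le> s" by (rule le_of_le_add_mult_epsilon)
    then show ?thesis using real by simp
  next
    case PInf
    then show ?thesis by simp
  next
    case MInf
    then show ?thesis using approx[of 1] by simp
  qed
qed

lemma op_norm_on_eq_total_semivariation:
  "op_norm_on C0 T = total_semivariation (dual_space sF) borel rep_measure"
  using op_norm_le_total_semivariation total_semivariation_rep_measure_le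
  by (simp add: op_norm_on_eq antisym)

end

theorem corollary6p15:
  fixes sE :: "'k::real_or_complex \<Rightarrow> 'e::banach \<Rightarrow> 'e"
    and sF :: "'k \<Rightarrow> 'f::banach \<Rightarrow> 'f"
    and T :: "('z::t2_space \<Rightarrow>\<^sub>C 'e) \<Rightarrow> 'f"
  assumes "locally_compact_space (euclidean :: 'z topology)"
    and "banach_over sE" and "banach_over sF"
    and "continuous_klinear_on C0 (bcontfun_scale sE) sF T"
  shows "\<exists>\<mu> :: 'z set \<Rightarrow> 'e \<Rightarrow> ('f \<Rightarrow>\<^sub>L 'k) \<Rightarrow> 'k.
           (regular_weak_star_i_measure sE dual_scale (dual_space sF) \<mu> \<and>
            (\<forall>f\<in>C0. has_weak_star_integral dual_scale (dual_space sF) borel \<mu>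
                      (apply_bcontfun f) (canonical_embedding sF (T f)))) \<and>
           (\<forall>\<mu>'. regular_weak_star_i_measure sE dual_scale (dual_space sF) \<mu>' \<and>
                 (\<forall>f\<in>C0. has_weak_star_integral dual_scale (dual_space sF) borel \<mu>'
                           (apply_bcontfun f) (canonical_embedding sF (T f))) \<longrightarrow> \<mu>' = \<mu>) \<and>
           op_norm_on C0 T = total_semivariation (dual_space sF) borel \<mu>"
proof -
  interpret C0_operator sE sF T
    using assms by (simp add: C0_operator_def C0_operator_axioms_def)
  show ?thesis
    using regular_rep_measure has_integral_rep_measure rep_measure_unique op_norm_on_eq_total_semivariation
    by (intro exI[of _ rep_measure]) blast
qed

end
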